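(* Let $k$ be a field of characteristic $0$, $\mathfrak{g}$ a finite dimensional split simple Lie algebra over $k$, $R$ a commutative, associative, unital $k$-algebra, and $S/R$ a finite Galois extension of rings with Galois group $G$. Let $u=(u_g)_{g\in G}$ be a cocycle in $Z^1\big(G,\mathrm{Aut}_S(\mathfrak{g}_S)\big)$, where $\mathfrak{g}_S=\mathfrak{g}\otimes_k S$. For each $g \in G$ let $\widehat{u}_g\in \mathrm{Aut}_k(\widehat{\mathfrak{g}_S})$ be the unique lift of $u_g$ to the universal central extension $\widehat{\mathfrak{g}_S}=\mathfrak{g}_S\oplus\Omega_S/dS$ of $\mathfrak{g}_S$. Then: (1) $\widehat{u}=(\widehat{u}_g)_{g\in G}$ is a cocycle in $Z^1\big(G,\mathrm{Aut}_k(\widehat{\mathfrak{g}_S})\big)$. (2) $\mathcal{L}_{\widehat{u}}=\{x\in\widehat{\mathfrak{g}_S} : \widehat{u}_g\,({}^{g}x)=x \text{ for all } g\in G\}$ is a central extension of the descended algebra $\mathcal{L}_u=\{x\in\mathfrak{g}_S : u_g\,({}^{g}x)=x\text{ for all }g\in G\}$ corresponding to $u$. (3) There exist canonical isomorphisms $\mathfrak{z}(\mathcal{L}_{\widehat{u}})\simeq(\Omega_S/dS)^G\simeq\Omega_R/dR$, where $\mathfrak{z}(\mathcal{L}_{\widehat{u}})$ is the centre of $\mathcal{L}_{\widehat{u}}$.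
   Context: For a commutative, associative, unital $k$-algebra $A$, $\mathfrak{g}_A=\mathfrak{g}\otimes_k A$ is the Lie algebra with bracket $[x\otimes a,y\otimes b]=[x,y]\otimes ab$; it is both a $k$-Lie algebra and an $A$-Lie algebra. $\mathrm{Aut}_A(\mathfrak{g}_A)$ and $\mathrm{Aut}_k(\mathfrak{g}_A)$ denote its groups of $A$-linear and $k$-linear Lie algebra automorphisms. $(\Omega_A,d)$ is the $A$-module of Kähler differentials of $A/k$, $dA\subset\Omega_A$ is the $k$-subspace $d(A)$, and $\overline{\omega}$ is the class of $\omega\in\Omega_A$ in the $k$-space $\Omega_A/dA$. Let $(\cdot|\cdot)$ be the Killing form of $\mathfrak{g}$. The $k$-Lie algebra $\widehat{\mathfrak{g}_A}$ has underlying space $\mathfrak{g}_A\oplus\Omega_A/dA$, with $\Omega_A/dA$ central and bracket satisfying $[x\otimes a,y\otimes b]_{\widehat{\mathfrak{g}_A}}=[x,y]\otimes ab+(x|y)\overline{a\,db}$. With the projection $\pi:\widehat{\mathfrak{g}_A}\to\mathfrak{g}_A$ with kernel $\Omega_A/dA$, it is the universal central extension of the perfect centreless $k$-Lie algebra $\mathfrak{g}_A$ (Kassel). Every $\theta\in\mathrm{Aut}_k(\mathfrak{g}_A)$ has a unique lift $\widehat{\theta}\in\mathrm{Aut}_k(\widehat{\mathfrak{g}_A})$, i.e. a unique $k$-Lie algebra automorphism with $\pi\circ\widehat{\theta}=\theta\circ\pi$ (known fact). $S/R$ finite Galois with group $G$: $G$ is a finite group acting on $S$ by $R$-algebra automorphisms,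 $S^G=R$, and $S\otimes_R S\to\prod_{g\in G}S$, $a\otimes b\mapsto(a\,{}^{g}b)_g$ is an isomorphism. $G$ acts on $\mathfrak{g}_S$ by ${}^{g}(x\otimes s)=x\otimes{}^{g}s$, on $\Omega_S/dS$ by ${}^{g}(\overline{s\,dt})=\overline{{}^{g}s\,d\,{}^{g}t}$, and on $\widehat{\mathfrak{g}_S}$ by ${}^{g}(x\otimes s+z)=x\otimes{}^{g}s+{}^{g}z$ (by $k$-Lie algebra automorphisms). $G$ acts on $\mathrm{Aut}_S(\mathfrak{g}_S)$ and on $\mathrm{Aut}_k(\widehat{\mathfrak{g}_S})$ by conjugation, ${}^{g}\theta=g\circ\theta\circ g^{-1}$. A cocycle in $Z^1(G,H)$ is a family $(u_g)_{g\in G}$ in $H$ with $u_{gh}=u_g\,{}^{g}u_h$ for all $g,h\in G$. Central extensions are central extensions of Lie algebras over $k$ (surjective Lie algebra homomorphisms with central kernel). In (3), the first isomorphism is relative to the identification of $\Omega_S/dS$ with a subspace of $\widehat{\mathfrak{g}_S}$, and the second is relative to the $k$-linear map $\Omega_R/dR\to\Omega_S/dS$ induced by $R\to S$. *)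

theory Defs
  imports
    Complex_Main
    "HOL-Library.Poly_Mapping"
    "HOL-Library.Product_Plus"
    "HOL-Computational_Algebra.Group_Closure"
    "HOL-Algebra.Group"
begin

text \<open>
  Commutative unital rings are types of sort \<open>{comm_ring, comm_monoid_mult}\<close>. Unlike
  \<open>comm_ring_1\<close> this sort does not exclude the zero ring. The same reason prevents the use of the
  library locale \<open>module\<close> over such rings; over the ground field the library notions are used.
  A commutative unital \<open>A\<close>-algebra is given by its structure homomorphism.
\<close>

definition unital_ring_hom ::
    "('a::{comm_ring,comm_monoid_mult} \<Rightarrow> 'b::{comm_ring,comm_monoid_mult}) \<Rightarrow> bool" where
  "unital_ring_hom f \<longleftrightarrow>
     f 1 = 1 \<and> (\<forall>a b. f (a + b) = f a + f b) \<and> (\<forall>a b. f (a * b) = f a * f b)"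

definition unital_module ::
    "('a::{comm_ring,comm_monoid_mult} \<Rightarrow> 'm::ab_group_add \<Rightarrow> 'm) \<Rightarrow> bool" where
  "unital_module s \<longleftrightarrow>
     (\<forall>a x y. s a (x + y) = s a x + s a y) \<and>
     (\<forall>a b x. s (a + b) x = s a x + s b x) \<and>
     (\<forall>a b x. s a (s b x) = s (a * b) x) \<and>
     (\<forall>x. s 1 x = x)"

text \<open>
  The linear map from the free module on \<open>'x\<close> (finitely supported functions) to a module with
  scalar multiplication \<open>s\<close> that sends the basis element \<open>x\<close> to \<open>f x\<close>.
\<close>

definition lin_ext :: "('c::zero \<Rightarrow> 'm \<Rightarrow> 'm) \<Rightarrow> ('x \<Rightarrow> 'm::ab_group_add) \<Rightarrow> ('x \<Rightarrow>\<^sub>0 'c) \<Rightarrow> 'm" where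
  "lin_ext s f p = (\<Sum>x\<in>Poly_Mapping.keys p. s (Poly_Mapping.lookup p x) (f x))"

text \<open>
  The module with generators \<open>f x\<close> and relations \<open>Rel\<close>: the induced map from the quotient of the
  free module by the submodule generated by \<open>Rel\<close> is an isomorphism. All relation sets below are
  closed under scalar multiples, so that the additive closure is the generated submodule.
\<close>

definition presented_module ::
    "('c::{comm_ring,comm_monoid_mult} \<Rightarrow> 'm \<Rightarrow> 'm) \<Rightarrow> ('x \<Rightarrow> 'm::ab_group_add) \<Rightarrow> ('x \<Rightarrow>\<^sub>0 'c) set \<Rightarrow> bool"
  where
  "presented_module s f Rel \<longleftrightarrow>
     unital_module s \<and> surj (lin_ext s f) \<and> (\<forall>p. lin_ext s f p = 0 \<longleftrightarrow> p \<in> group_closure Rel)"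

definition tensor_relations ::
    "('c::{comm_ring,comm_monoid_mult} \<Rightarrow> 'm::ab_group_add \<Rightarrow> 'm) \<Rightarrow> ('c \<Rightarrow> 'n::ab_group_add \<Rightarrow> 'n)
      \<Rightarrow> ('m \<times> 'n \<Rightarrow>\<^sub>0 'c) set" where
  "tensor_relations sM sN =
     {Poly_Mapping.single (x + x', y) c - Poly_Mapping.single (x, y) c - Poly_Mapping.single (x', y) c
        | x x' y c. True} \<union>
     {Poly_Mapping.single (x, y + y') c - Poly_Mapping.single (x, y) c - Poly_Mapping.single (x, y') c
        | x y y' c. True} \<union>
     {Poly_Mapping.single (sM a x, y) c - Poly_Mapping.single (x, y) (c * a) | a x y c. True} \<union>
     {Poly_Mapping.single (x, sN a y) c - Poly_Mapping.single (x, y) (c * a) | a x y c. True}"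

text \<open>
  The module with scalar multiplication \<open>sT\<close>, together with the bilinear map \<open>ten\<close>, is the tensor
  product of the modules with scalar multiplications \<open>sM\<close> and \<open>sN\<close>.
\<close>

definition is_tensor_product ::
    "('c::{comm_ring,comm_monoid_mult} \<Rightarrow> 'm::ab_group_add \<Rightarrow> 'm) \<Rightarrow> ('c \<Rightarrow> 'n::ab_group_add \<Rightarrow> 'n)
      \<Rightarrow> ('c \<Rightarrow> 't::ab_group_add \<Rightarrow> 't) \<Rightarrow> ('m \<Rightarrow> 'n \<Rightarrow> 't) \<Rightarrow> bool" where
  "is_tensor_product sM sN sT ten \<longleftrightarrow>
     unital_module sM \<and> unital_module sN \<and>
     presented_module sT (\<lambda>(x, y). ten x y) (tensor_relations sM sN)"

text \<open>The map \<open>id \<otimes> f\<close>.\<close>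

definition tensor_map ::
    "('m \<Rightarrow> 'n \<Rightarrow> 't::ab_group_add) \<Rightarrow> ('n \<Rightarrow> 'n) \<Rightarrow> 't \<Rightarrow> 't" where
  "tensor_map ten f = (THE h. additive h \<and> (\<forall>x a. h (ten x a) = ten x (f a)))"

text \<open>The biadditive map whose value at \<open>(x \<otimes> a, y \<otimes> b)\<close> is \<open>F x a y b\<close>.\<close>

definition tensor_bilin ::
    "('m \<Rightarrow> 'n \<Rightarrow> 't::ab_group_add) \<Rightarrow> ('m \<Rightarrow> 'n \<Rightarrow> 'm \<Rightarrow> 'n \<Rightarrow> 'v::ab_group_add) \<Rightarrow> 't \<Rightarrow> 't \<Rightarrow> 'v" where
  "tensor_bilin ten F =
     (THE B. (\<forall>X. additive (B X)) \<and> (\<forall>Y. additive (\<lambda>X. B X Y)) \<and>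
             (\<forall>x a y b. B (ten x a) (ten y b) = F x a y b))"

text \<open>
  The extension is given by \<open>\<iota> : R \<rightarrow> S\<close>. The last two conditions say that
  \<open>S \<otimes>\<^sub>R S \<rightarrow> \<Prod>\<^sub>g S\<close>, \<open>a \<otimes> b \<mapsto> (a \<cdot> g b)\<^sub>g\<close>, is surjective and injective, where \<open>S \<otimes>\<^sub>R S\<close> is
  the quotient of the free \<open>R\<close>-module on \<open>S \<times> S\<close> by the tensor relations.
\<close>

definition galois_extension ::
    "('r::{comm_ring,comm_monoid_mult} \<Rightarrow> 's::{comm_ring,comm_monoid_mult})
      \<Rightarrow> ('p, 'e) monoid_scheme \<Rightarrow> ('p \<Rightarrow> 's \<Rightarrow> 's) \<Rightarrow> bool" where
  "galois_extension \<iota> G act \<longleftrightarrow>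
     unital_ring_hom \<iota> \<and> inj \<iota> \<and> group G \<and> finite (carrier G) \<and>
     (\<forall>g\<in>carrier G. unital_ring_hom (act g) \<and> (\<forall>r. act g (\<iota> r) = \<iota> r)) \<and>
     act \<one>\<^bsub>G\<^esub> = id \<and> (\<forall>g\<in>carrier G. \<forall>h\<in>carrier G. act (g \<otimes>\<^bsub>G\<^esub> h) = act g \<circ> act h) \<and>
     {s. \<forall>g\<in>carrier G. act g s = s} = range \<iota> \<and>
     (let can = (\<lambda>p g. lin_ext (\<lambda>r s. \<iota> r * s) (\<lambda>(a, b). a * act g b) p);
          rel = tensor_relations (\<lambda>r s. \<iota> r * s) (\<lambda>r s. \<iota> r * s)
      in (\<forall>f. \<exists>p. \<forall>g\<in>carrier G. can p g = f g) \<and>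
         (\<forall>p. (\<forall>g\<in>carrier G. can p g = 0) \<longrightarrow> p \<in> group_closure rel))"

definition kaehler_relations ::
    "('k \<Rightarrow> 'a::{comm_ring,comm_monoid_mult}) \<Rightarrow> ('a \<Rightarrow>\<^sub>0 'a) set" where
  "kaehler_relations \<eta> =
     {Poly_Mapping.single (a + b) c - Poly_Mapping.single a c - Poly_Mapping.single b c | a b c. True} \<union>
     {Poly_Mapping.single (a * b) c - Poly_Mapping.single b (c * a) - Poly_Mapping.single a (c * b)
        | a b c. True} \<union>
     {Poly_Mapping.single (\<eta> z) c | z c. True}"

text \<open>
  The module with scalar multiplication \<open>sO\<close> and the map \<open>d\<close> are the Kaehler differentials of the
  algebra with structure map \<open>\<eta>\<close>: generated by all \<open>d a\<close>, subject to additivity, the Leibniz rule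
  and \<open>d (\<eta> z) = 0\<close>.
\<close>

definition is_kaehler ::
    "('k::{comm_ring,comm_monoid_mult} \<Rightarrow> 'a::{comm_ring,comm_monoid_mult})
      \<Rightarrow> ('a \<Rightarrow> 'o::ab_group_add \<Rightarrow> 'o) \<Rightarrow> ('a \<Rightarrow> 'o) \<Rightarrow> bool" where
  "is_kaehler \<eta> sO d \<longleftrightarrow> presented_module sO d (kaehler_relations \<eta>)"

definition is_quotient_space ::
    "('k::field \<Rightarrow> 'v::ab_group_add \<Rightarrow> 'v) \<Rightarrow> 'v set \<Rightarrow> ('k \<Rightarrow> 'w::ab_group_add \<Rightarrow> 'w) \<Rightarrow> ('v \<Rightarrow> 'w) \<Rightarrow> bool"
  where
  "is_quotient_space sV W sW q \<longleftrightarrow>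
     Vector_Spaces.linear sV sW q \<and> surj q \<and> {v. q v = 0} = W"

text \<open>
  Here \<open>wA a b\<close> and \<open>wB a b\<close> stand for the classes of \<open>a db\<close> in \<open>\<Omega>\<^sub>A/dA\<close> and \<open>\<Omega>\<^sub>B/dB\<close>; the map
  is the one induced by \<open>f : A \<rightarrow> B\<close>.
\<close>

definition diff_class_map ::
    "('a \<Rightarrow> 'a \<Rightarrow> 'v::ab_group_add) \<Rightarrow> ('b \<Rightarrow> 'b \<Rightarrow> 'w::ab_group_add) \<Rightarrow> ('a \<Rightarrow> 'b) \<Rightarrow> 'v \<Rightarrow> 'w" where
  "diff_class_map wA wB f = (THE h. additive h \<and> (\<forall>a b. h (wA a b) = wB (f a) (f b)))"

definition lie_algebra_on ::
    "('k::field \<Rightarrow> 'v::ab_group_add \<Rightarrow> 'v) \<Rightarrow> ('v \<Rightarrow> 'v \<Rightarrow> 'v) \<Rightarrow> 'v set \<Rightarrow> bool" where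
  "lie_algebra_on s br L \<longleftrightarrow>
     vector_space s \<and> module.subspace s L \<and>
     (\<forall>x\<in>L. \<forall>y\<in>L. br x y \<in> L) \<and>
     (\<forall>x\<in>L. \<forall>y\<in>L. \<forall>z\<in>L. br (x + y) z = br x z + br y z \<and> br z (x + y) = br z x + br z y) \<and>
     (\<forall>c. \<forall>x\<in>L. \<forall>y\<in>L. br (s c x) y = s c (br x y) \<and> br x (s c y) = s c (br x y)) \<and>
     (\<forall>x\<in>L. br x x = 0) \<and>
     (\<forall>x\<in>L. \<forall>y\<in>L. \<forall>z\<in>L. br x (br y z) + br y (br z x) + br z (br x y) = 0)"

definition lie_center :: "('v \<Rightarrow> 'v \<Rightarrow> 'v::zero) \<Rightarrow> 'v set \<Rightarrow> 'v set" where
  "lie_center br L = {x\<in>L. \<forall>y\<in>L. br x y = 0}"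

definition lie_aut :: "('c \<Rightarrow> 'v \<Rightarrow> 'v) \<Rightarrow> ('v \<Rightarrow> 'v \<Rightarrow> 'v::ab_group_add) \<Rightarrow> ('v \<Rightarrow> 'v) set" where
  "lie_aut s br = {\<theta>. bij \<theta> \<and> (\<forall>x y. \<theta> (x + y) = \<theta> x + \<theta> y) \<and> (\<forall>c x. \<theta> (s c x) = s c (\<theta> x)) \<and>
                       (\<forall>x y. \<theta> (br x y) = br (\<theta> x) (\<theta> y))}"

definition central_extension ::
    "('k::field \<Rightarrow> 'v::ab_group_add \<Rightarrow> 'v) \<Rightarrow> ('v \<Rightarrow> 'v \<Rightarrow> 'v) \<Rightarrow> 'v set
      \<Rightarrow> ('k \<Rightarrow> 'w::ab_group_add \<Rightarrow> 'w) \<Rightarrow> ('w \<Rightarrow> 'w \<Rightarrow> 'w) \<Rightarrow> 'w set \<Rightarrow> ('v \<Rightarrow> 'w) \<Rightarrow> bool" where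
  "central_extension sE brE E sL brL L p \<longleftrightarrow>
     lie_algebra_on sE brE E \<and> lie_algebra_on sL brL L \<and> p ` E = L \<and>
     (\<forall>x\<in>E. \<forall>y\<in>E. p (x + y) = p x + p y) \<and> (\<forall>c. \<forall>x\<in>E. p (sE c x) = sL c (p x)) \<and>
     (\<forall>x\<in>E. \<forall>y\<in>E. p (brE x y) = brL (p x) (p y)) \<and>
     {x\<in>E. p x = 0} \<subseteq> lie_center brE E"

definition linear_iso_on ::
    "('k::field \<Rightarrow> 'v::ab_group_add \<Rightarrow> 'v) \<Rightarrow> 'v set \<Rightarrow> ('k \<Rightarrow> 'w::ab_group_add \<Rightarrow> 'w) \<Rightarrow> 'w set
      \<Rightarrow> ('v \<Rightarrow> 'w) \<Rightarrow> bool" where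
  "linear_iso_on s1 A s2 B f \<longleftrightarrow>
     vector_space s1 \<and> vector_space s2 \<and> module.subspace s1 A \<and> module.subspace s2 B \<and>
     (\<forall>x\<in>A. \<forall>y\<in>A. f (x + y) = f x + f y) \<and> (\<forall>c. \<forall>x\<in>A. f (s1 c x) = s2 c (f x)) \<and>
     bij_betw f A B"

text \<open>The trace does not depend on the chosen basis; meaningful for finite dimensional spaces.\<close>

definition lin_trace :: "('k::field \<Rightarrow> 'v::ab_group_add \<Rightarrow> 'v) \<Rightarrow> ('v \<Rightarrow> 'v) \<Rightarrow> 'k" where
  "lin_trace s f =
     (let B = (SOME B. \<not> module.dependent s B \<and> module.span s B = UNIV)
      in \<Sum>b\<in>B. module.representation s B (f b) b)"

definition killing ::
    "('k::field \<Rightarrow> 'v::ab_group_add \<Rightarrow> 'v) \<Rightarrow> ('v \<Rightarrow> 'v \<Rightarrow> 'v) \<Rightarrow> 'v \<Rightarrow> 'v \<Rightarrow> 'k" where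
  "killing s br x y = lin_trace s (br x \<circ> br y)"

text \<open>
  Split in the sense of Bourbaki: there is a Cartan subalgebra (a nilpotent subalgebra equal to its
  own normalizer) all of whose elements act triangularizably over the ground field.
\<close>

fun lower_central ::
    "('k::field \<Rightarrow> 'v::ab_group_add \<Rightarrow> 'v) \<Rightarrow> ('v \<Rightarrow> 'v \<Rightarrow> 'v) \<Rightarrow> 'v set \<Rightarrow> nat \<Rightarrow> 'v set" where
  "lower_central s br L 0 = L"
| "lower_central s br L (Suc n) = module.span s {br x y | x y. x \<in> L \<and> y \<in> lower_central s br L n}"

definition cartan_subalgebra ::
    "('k::field \<Rightarrow> 'v::ab_group_add \<Rightarrow> 'v) \<Rightarrow> ('v \<Rightarrow> 'v \<Rightarrow> 'v) \<Rightarrow> 'v set \<Rightarrow> bool" where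
  "cartan_subalgebra s br H \<longleftrightarrow>
     lie_algebra_on s br H \<and> (\<exists>n. lower_central s br H n = {0}) \<and>
     {x. \<forall>h\<in>H. br x h \<in> H} = H"

definition triangularizable ::
    "('k::field \<Rightarrow> 'v::ab_group_add \<Rightarrow> 'v) \<Rightarrow> ('v \<Rightarrow> 'v) \<Rightarrow> bool" where
  "triangularizable s f \<longleftrightarrow>
     (\<exists>bs. distinct bs \<and> \<not> module.dependent s (set bs) \<and> module.span s (set bs) = UNIV \<and>
           (\<forall>i<length bs. f (bs ! i) \<in> module.span s (set (take (Suc i) bs))))"

definition split_simple_lie_algebra ::
    "('k::field \<Rightarrow> 'v::ab_group_add \<Rightarrow> 'v) \<Rightarrow> ('v \<Rightarrow> 'v \<Rightarrow> 'v) \<Rightarrow> bool" where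
  "split_simple_lie_algebra s br \<longleftrightarrow>
     lie_algebra_on s br UNIV \<and>
     (\<exists>B. finite B \<and> module.span s B = UNIV) \<and>
     (\<exists>x y. br x y \<noteq> 0) \<and>
     (\<forall>I. module.subspace s I \<and> (\<forall>x. \<forall>y\<in>I. br x y \<in> I) \<longrightarrow> I = {0} \<or> I = UNIV) \<and>
     (\<exists>H. cartan_subalgebra s br H \<and> (\<forall>h\<in>H. triangularizable s (br h)))"

definition current_bracket ::
    "('v \<Rightarrow> 'v \<Rightarrow> 'v) \<Rightarrow> ('v \<Rightarrow> 'a::times \<Rightarrow> 't::ab_group_add) \<Rightarrow> 't \<Rightarrow> 't \<Rightarrow> 't" where
  "current_bracket br ten = tensor_bilin ten (\<lambda>x a y b. ten (br x y) (a * b))"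

definition current_scale :: "('v \<Rightarrow> 'a::times \<Rightarrow> 't::ab_group_add) \<Rightarrow> 'a \<Rightarrow> 't \<Rightarrow> 't" where
  "current_scale ten a = tensor_map ten ((*) a)"

text \<open>
  The bracket on \<open>\<gg>\<^sub>A \<oplus> \<Omega>\<^sub>A/dA\<close>, with \<open>w a b\<close> the class of \<open>a db\<close> and \<open>sQ\<close> the scalar
  multiplication of \<open>\<Omega>\<^sub>A/dA\<close>.
\<close>

definition uce_bracket ::
    "('k::field \<Rightarrow> 'v::ab_group_add \<Rightarrow> 'v) \<Rightarrow> ('v \<Rightarrow> 'v \<Rightarrow> 'v) \<Rightarrow> ('v \<Rightarrow> 'a::times \<Rightarrow> 't::ab_group_add)
      \<Rightarrow> ('k \<Rightarrow> 'q::ab_group_add \<Rightarrow> 'q) \<Rightarrow> ('a \<Rightarrow> 'a \<Rightarrow> 'q) \<Rightarrow> 't \<times> 'q \<Rightarrow> 't \<times> 'q \<Rightarrow> 't \<times> 'q" where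
  "uce_bracket s br ten sQ w = (\<lambda>(X, z) (Y, z').
     (current_bracket br ten X Y,
      tensor_bilin ten (\<lambda>x a y b. sQ (killing s br x y) (w a b)) X Y))"

text \<open>
  The unique automorphism of the central extension, with scalar multiplication \<open>sE\<close> and bracket
  \<open>brE\<close>, lifting \<open>\<theta>\<close> along the projection \<open>fst\<close>.
\<close>

definition lie_lift ::
    "('k \<Rightarrow> 't \<times> 'q \<Rightarrow> 't \<times> 'q) \<Rightarrow> ('t \<times> 'q \<Rightarrow> 't \<times> 'q \<Rightarrow> 't::ab_group_add \<times> 'q::ab_group_add)
      \<Rightarrow> ('t \<Rightarrow> 't) \<Rightarrow> 't \<times> 'q \<Rightarrow> 't \<times> 'q" where
  "lie_lift sE brE \<theta> = (THE \<psi>. \<psi> \<in> lie_aut sE brE \<and> fst \<circ> \<psi> = \<theta> \<circ> fst)"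

text \<open>
  \<open>\<rho>\<close> is an action of \<open>G\<close> on the underlying space, and \<open>G\<close> acts on the group \<open>H\<close> of
  transformations of this space by conjugation.
\<close>

definition cocycle ::
    "('p, 'e) monoid_scheme \<Rightarrow> ('p \<Rightarrow> 'v \<Rightarrow> 'v) \<Rightarrow> ('v \<Rightarrow> 'v) set \<Rightarrow> ('p \<Rightarrow> 'v \<Rightarrow> 'v) \<Rightarrow> bool" where
  "cocycle G \<rho> H u \<longleftrightarrow>
     (\<forall>g\<in>carrier G. u g \<in> H) \<and>
     (\<forall>g\<in>carrier G. \<forall>h\<in>carrier G. u (g \<otimes>\<^bsub>G\<^esub> h) = u g \<circ> (\<rho> g \<circ> u h \<circ> \<rho> (inv\<^bsub>G\<^esub> g)))"

definition descended ::
    "('p, 'e) monoid_scheme \<Rightarrow> ('p \<Rightarrow> 'v \<Rightarrow> 'v) \<Rightarrow> ('p \<Rightarrow> 'v \<Rightarrow> 'v) \<Rightarrow> 'v set" where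
  "descended G \<rho> u = {x. \<forall>g\<in>carrier G. u g (\<rho> g x) = x}"

end

theory Submission imports Defs
begin

text \<open>
  Write \<open>(X | Y)\<close> for the Killing form, extended \<open>S\<close>-bilinearly to \<open>\<gg>\<^sub>S\<close>, and \<open>\<nabla> = id \<otimes> d\<close>. Before
  passing to the quotient by \<open>dS\<close> the cocycle of the universal central extension is the form
  \<open>W(X, Y) = (X | \<nabla> Y)\<close> with values in \<open>\<Omega>\<^sub>S\<close>.

  The point on which everything turns is that the lift of an \<open>S\<close>-linear automorphism \<open>\<theta>\<close> fixes
  \<open>\<Omega>\<^sub>S/dS\<close> pointwise. Since \<open>\<theta>\<close> preserves the Killing form, \<open>W(\<theta> X, \<theta> Y) - W(X, Y) = (X | D Y)\<close> with
  \<open>D = \<theta>\<inverse> \<nabla> \<theta> - \<nabla>\<close>. This \<open>D\<close> is an \<open>S\<close>-linear derivation from \<open>\<gg>\<^sub>S\<close> to \<open>\<gg> \<otimes> \<Omega>\<^sub>S\<close>, hence inner, so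
  \<open>(X | D Y)\<close> has the form \<open>\<Phi> [X, Y]\<close> (\<open>derivation_form_factors_through_bracket\<close>,
  \<open>W_automorphism\<close>), and \<open>(X, z) \<mapsto> (\<theta> X, z + \<Phi> X)\<close>, with \<open>\<Phi> X\<close> read modulo \<open>dS\<close>, is a lift.
  The extension is perfect, so there is no other lift (\<open>perfect_induct\<close>,
  \<open>automorphism_determined_by_projection\<close>). Uniqueness of lifts gives the cocycle identity (1).

  For (2), a point of the descended algebra is lifted by averaging any lift over the twisted action
  of \<open>G\<close>. For (3), Galois descent shows that \<open>\<L>\<^sub>u\<close> spans \<open>\<gg>\<^sub>S\<close> over \<open>S\<close>, so an element commuting with
  \<open>\<L>\<^sub>u\<close> is central in \<open>\<gg>\<^sub>S\<close> and therefore zero (\<open>centralizer_Lu_zero\<close>). The centre thus lies in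
  \<open>\<Omega>\<^sub>S/dS\<close>, where the twisted action is the plain one because the lifts act trivially there.

  The comparison with \<open>R\<close> uses that \<open>S/R\<close> is etale. The separability idempotent supplied by the
  Galois condition shows that \<open>\<Omega>\<^sub>S\<close> is generated over \<open>S\<close> by the differentials of \<open>R\<close>, and it
  extends the derivation \<open>R \<rightarrow> \<Omega>\<^sub>R\<close> to \<open>S\<close>, which produces a trace \<open>\<Omega>\<^sub>S \<rightarrow> \<Omega>\<^sub>R\<close> inverse, up to the factor
  \<open>|G|\<close>, to the map in question (\<open>trace_classes_exists\<close>).

  All this rests on the nondegeneracy of the Killing form of \<open>\<gg>\<close>
  (\<open>split_simple_imp_nondegenerate_killing\<close>). If it were zero, Cartan's trace argument, applied
  to the triangularizable \<open>ad h\<close>, would make every element \<open>h\<close> of the splitting Cartan subalgebra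
  ad-nilpotent; by Engel's argument that subalgebra would be all of \<open>\<gg>\<close>, and \<open>\<gg>\<close> would be nilpotent.
\<close>

section \<open>Modules given by generators and relations\<close>

lemma additiveI: "(\<And>x y. f (x + y) = f x + f y) \<Longrightarrow> additive f"
  by unfold_locales

lemma additive_add_fun:
  assumes "additive f" "additive g" shows "additive (\<lambda>x. f x + g x :: _::ab_group_add)"
  using assms by (intro additiveI) (simp add: additive.add)

lemma additive_compose:
  assumes "additive f" "additive g" shows "additive (\<lambda>x. f (g x))"
  using assms by (intro additiveI) (simp add: additive.add)

lemma unital_moduleD:
  assumes "unital_module s"
  shows "s a (x + y) = s a x + s a y" "s (a + b) x = s a x + s b x"
    "s a (s b x) = s (a * b) x" "s 1 x = x"
  using assms unfolding unital_module_def by auto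

lemma unital_module_additive:
  assumes "unital_module s"
  shows "additive (s a)" "additive (\<lambda>a. s a x)"
  using unital_moduleD[OF assms] by (auto intro: additiveI)

text \<open>\<open>F x c\<close> is the prescribed image of \<open>c\<close> times the generator \<open>x\<close>. Separating the scalar from the
  generator covers additive maps that are not linear, such as those induced by ring automorphisms.\<close>

definition free_ext :: "('x \<Rightarrow> 'c::ab_group_add \<Rightarrow> 'w::ab_group_add) \<Rightarrow> ('x \<Rightarrow>\<^sub>0 'c) \<Rightarrow> 'w" where
  "free_ext F p = (\<Sum>x\<in>Poly_Mapping.keys p. F x (Poly_Mapping.lookup p x))"

lemma free_ext_superset:
  assumes "\<And>x. additive (F x)" "finite A" "Poly_Mapping.keys p \<subseteq> A"
  shows "free_ext F p = (\<Sum>x\<in>A. F x (Poly_Mapping.lookup p x))"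
  unfolding free_ext_def using assms
  by (intro sum.mono_neutral_left) (auto simp: additive.zero in_keys_iff)

lemma additive_free_ext:
  assumes F: "\<And>x. additive (F x)" shows "additive (free_ext F)"
proof (rule additiveI)
  fix p q :: "'a \<Rightarrow>\<^sub>0 'b"
  let ?A = "Poly_Mapping.keys p \<union> Poly_Mapping.keys q"
  have "Poly_Mapping.keys (p + q) \<subseteq> ?A" by (rule keys_add)
  then show "free_ext F (p + q) = free_ext F p + free_ext F q"
    using free_ext_superset[OF F, of ?A]
    by (simp add: lookup_add additive.add[OF F] sum.distrib)
qed

lemma free_ext_single:
  assumes F: "\<And>x. additive (F x)" shows "free_ext F (Poly_Mapping.single x c) = F x c"
  using additive.zero[OF F] by (cases "c = 0") (simp_all add: free_ext_def)

lemma lin_ext_eq_free_ext: "lin_ext s f = free_ext (\<lambda>x c. s c (f x))"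
  by (simp add: fun_eq_iff lin_ext_def free_ext_def)

lemma additive_kernel_group_closure:
  assumes "additive L" "\<And>p. p \<in> Rel \<Longrightarrow> L p = 0" "p \<in> group_closure Rel"
  shows "L p = 0"
  using assms(3)
  by (induction p rule: group_closure.induct)
    (auto simp: assms(2) additive.diff[OF assms(1)] additive.zero[OF assms(1)])

lemma presented_module_induct [consumes 1, case_names generator add]:
  assumes P: "presented_module s f Rel"
    and gen: "\<And>c x. Q (s c (f x))" and add: "\<And>v w. Q v \<Longrightarrow> Q w \<Longrightarrow> Q (v + w)"
  shows "Q m"
proof -
  have um: "unital_module s" and surj: "surj (lin_ext s f)"
    using P by (auto simp: presented_module_def)
  have "Q 0" using gen[of 0] additive.zero[OF unital_module_additive(2)[OF um]] by simp
  have "Q (\<Sum>x\<in>A. s (h x) (f x))" if "finite A" for A h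
    using that by (induction A) (auto intro: gen add \<open>Q 0\<close>)
  moreover obtain p where "m = lin_ext s f p" using surj by (auto elim: surjE)
  ultimately show ?thesis by (simp add: lin_ext_def)
qed

lemma presented_module_relation:
  assumes P: "presented_module s f Rel" and p: "p \<in> Rel"
  shows "free_ext (\<lambda>x c. s c (f x)) p = 0"
proof -
  have "p \<in> group_closure Rel" using p by (auto intro: group_closure.base)
  then show ?thesis using P by (simp add: presented_module_def lin_ext_eq_free_ext)
qed

text \<open>The relations generate the kernel of \<open>lin_ext\<close> additively, so \<open>free_ext F\<close> is constant on its
  fibres as soon as it kills them.\<close>

lemma presented_module_hom_exists:
  assumes P: "presented_module s f Rel" and F: "\<And>x. additive (F x)"
    and rel: "\<And>p. p \<in> Rel \<Longrightarrow> free_ext F p = 0"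
  obtains h where "additive h" "\<And>c x. h (s c (f x)) = F x c"
proof -
  have um: "unital_module s" and surj: "surj (lin_ext s f)"
    and ker: "\<And>p. lin_ext s f p = 0 \<longleftrightarrow> p \<in> group_closure Rel"
    using P by (auto simp: presented_module_def)
  have add: "additive (lin_ext s f)" unfolding lin_ext_eq_free_ext
    using unital_module_additive[OF um] by (intro additive_free_ext)
  note addF = additive_free_ext[OF F]
  define h where "h m = free_ext F (SOME p. lin_ext s f p = m)" for m
  have h: "h (lin_ext s f p) = free_ext F p" for p
  proof -
    let ?q = "SOME q. lin_ext s f q = lin_ext s f p"
    have "lin_ext s f ?q = lin_ext s f p" by (rule someI) simp
    then have "p - ?q \<in> group_closure Rel" using ker[of "p - ?q"] by (simp add: additive.diff[OF add])
    then have "free_ext F (p - ?q) = 0" by (rule additive_kernel_group_closure[OF addF, rotated]) (rule rel)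
    then show ?thesis by (simp add: h_def additive.diff[OF addF])
  qed
  have "additive h"
  proof (rule additiveI)
    fix v w obtain p q where "v = lin_ext s f p" "w = lin_ext s f q" using surj by (metis surjD)
    then show "h (v + w) = h v + h w"
      using h[of "p + q"] h[of p] h[of q] by (simp add: additive.add[OF add] additive.add[OF addF])
  qed
  moreover have "h (s c (f x)) = F x c" for c x
    using h[of "Poly_Mapping.single x c"]
    by (simp add: lin_ext_eq_free_ext free_ext_single F free_ext_single unital_module_additive[OF um])
  ultimately show ?thesis by (rule that)
qed

section \<open>Maps out of a tensor product\<close>

text \<open>For \<open>N = {0}\<close> this is the well-definedness of the map induced by a balanced biadditive map.
  Balancedness modulo a subgroup is what maps such as \<open>(u, v) \<mapsto> u dv\<close> satisfy.\<close>

lemma free_ext_tensor_relations: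
  assumes M: "unital_module sM"
    and F: "\<And>x. additive (F x)" "\<And>y. additive (\<lambda>x. F x y)"
    and N: "0 \<in> N" "\<And>v w. v \<in> N \<Longrightarrow> w \<in> N \<Longrightarrow> v - w \<in> N"
    and bal: "\<And>c x y. F (sM c x) y - F x (sN c y) \<in> N"
    and p: "p \<in> group_closure (tensor_relations sM sN)"
  shows "free_ext (\<lambda>(x, y) c. F (sM c x) y) p \<in> N"
proof -
  define F' where "F' = (\<lambda>(x, y) c. F (sM c x) y)"
  have F': "additive (F' xy)" for xy
    unfolding F'_def by (cases xy)
      (auto intro: additive_compose[OF F(2) unital_module_additive(2)[OF M]])
  note add = additive_free_ext[OF F']
  have single: "free_ext F' (Poly_Mapping.single (x, y) c) = F (sM c x) y" for x y c
    by (simp add: free_ext_single[OF F']) (simp add: F'_def)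
  have "free_ext F' q \<in> N" if q: "q \<in> tensor_relations sM sN" for q
  proof -
    have "F (sM (c * a) x) y - F (sM c x) (sN a y) \<in> N" for a c x y
      using bal[of a "sM c x" y] by (simp add: unital_moduleD(3)[OF M] mult.commute)
    then have "F (sM c x) (sN a y) - F (sM (c * a) x) y \<in> N" for a c x y
      using N(2)[OF N(1), of "F (sM (c * a) x) y - F (sM c x) (sN a y)"] by simp
    then show ?thesis using q N(1) unfolding tensor_relations_def
      by (auto simp: additive.diff[OF add] single additive.add[OF F(1)] additive.add[OF F(2)]
          unital_moduleD[OF M])
  qed
  with p have "free_ext F' p \<in> N"
    by (induction p rule: group_closure.induct)
      (auto simp: additive.diff[OF add] additive.zero[OF add] N)
  then show ?thesis by (simp add: F'_def)
qed

locale tensor_product =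
  fixes sM :: "'c::{comm_ring,comm_monoid_mult} \<Rightarrow> 'm::ab_group_add \<Rightarrow> 'm"
    and sN :: "'c \<Rightarrow> 'n::ab_group_add \<Rightarrow> 'n"
    and sT :: "'c \<Rightarrow> 't::ab_group_add \<Rightarrow> 't" and ten :: "'m \<Rightarrow> 'n \<Rightarrow> 't"
  assumes is_tensor: "is_tensor_product sM sN sT ten"
begin

lemma module_M: "unital_module sM"
  and presented: "presented_module sT (\<lambda>(x, y). ten x y) (tensor_relations sM sN)"
  using is_tensor by (auto simp: is_tensor_product_def)

lemma module_T: "unital_module sT"
  using presented by (simp add: presented_module_def)

lemma tensor_relation:
  assumes "p \<in> tensor_relations sM sN"
  shows "free_ext (\<lambda>xy c. sT c (case xy of (x, y) \<Rightarrow> ten x y)) p = 0"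
  using presented_module_relation[OF presented assms] .

lemma free_ext_tensor:
  "additive (free_ext (\<lambda>xy c. sT c (case xy of (x, y) \<Rightarrow> ten x y)))"
  "free_ext (\<lambda>xy c. sT c (case xy of (x, y) \<Rightarrow> ten x y)) (Poly_Mapping.single (x, y) c) = sT c (ten x y)"
  using unital_module_additive(2)[OF module_T]
  by (auto intro!: additive_free_ext simp: free_ext_single)

lemmas free_ext_tensor_simps = additive.diff[OF free_ext_tensor(1)] free_ext_tensor(2)
  unital_moduleD(4)[OF module_T]

lemma ten_add_left: "ten (x + x') y = ten x y + ten x' y"
proof -
  have "Poly_Mapping.single (x + x', y) 1 - Poly_Mapping.single (x, y) 1 - Poly_Mapping.single (x', y) 1
        \<in> tensor_relations sM sN" unfolding tensor_relations_def by blast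
  from tensor_relation[OF this] show ?thesis
    unfolding free_ext_tensor_simps by (simp add: algebra_simps)
qed

lemma ten_add_right: "ten x (y + y') = ten x y + ten x y'"
proof -
  have "Poly_Mapping.single (x, y + y') 1 - Poly_Mapping.single (x, y) 1 - Poly_Mapping.single (x, y') 1
        \<in> tensor_relations sM sN" unfolding tensor_relations_def by blast
  from tensor_relation[OF this] show ?thesis
    unfolding free_ext_tensor_simps by (simp add: algebra_simps)
qed

lemma ten_scale_left: "ten (sM c x) y = sT c (ten x y)"
proof -
  have "Poly_Mapping.single (sM c x, y) 1 - Poly_Mapping.single (x, y) (1 * c)
        \<in> tensor_relations sM sN" unfolding tensor_relations_def by blast
  from tensor_relation[OF this] show ?thesis
    unfolding free_ext_tensor_simps by simp
qed

lemma ten_scale_right: "ten x (sN c y) = sT c (ten x y)"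
proof -
  have "Poly_Mapping.single (x, sN c y) 1 - Poly_Mapping.single (x, y) (1 * c)
        \<in> tensor_relations sM sN" unfolding tensor_relations_def by blast
  from tensor_relation[OF this] show ?thesis
    unfolding free_ext_tensor_simps by simp
qed

lemma additive_ten: "additive (ten x)" "additive (\<lambda>x. ten x y)"
  by (auto intro!: additiveI simp: ten_add_left ten_add_right)

lemma ten_sum_left: "ten (sum f I) y = (\<Sum>i\<in>I. ten (f i) y)"
  using additive.sum[OF additive_ten(2)] .

lemma tensor_induct [case_names pure add]:
  assumes "\<And>x y. P (ten x y)" "\<And>X Y. P X \<Longrightarrow> P Y \<Longrightarrow> P (X + Y)"
  shows "P X"
  using presented by (induction X rule: presented_module_induct)
    (auto simp: assms(2) simp flip: ten_scale_left intro: assms(1))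

lemma tensor_eqI:
  assumes "additive h" "additive h'" "\<And>x y. h (ten x y) = h' (ten x y)"
  shows "h X = h' X"
  by (induction X rule: tensor_induct) (simp_all add: assms additive.add)

lemma tensor_eqI2:
  assumes "\<And>Y. additive (\<lambda>X. B X Y)" "\<And>X. additive (B X)"
    "\<And>Y. additive (\<lambda>X. B' X Y)" "\<And>X. additive (B' X)"
    "\<And>x a y b. B (ten x a) (ten y b) = B' (ten x a) (ten y b)"
  shows "B X Y = B' X Y"
  by (rule tensor_eqI[of "\<lambda>X. B X Y" "\<lambda>X. B' X Y"], rule assms, rule assms,
      rule tensor_eqI, rule assms, rule assms, rule assms)

lemma tensor_hom_exists:
  assumes F: "\<And>x. additive (F x)" "\<And>y. additive (\<lambda>x. F x y)"
    and bal: "\<And>c x y. F (sM c x) y = F x (sN c y)"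
  shows "\<exists>h. additive h \<and> (\<forall>x y. h (ten x y) = F x y)"
proof -
  define F' where "F' = (\<lambda>(x, y) c. F (sM c x) y)"
  have F': "additive (F' xy)" for xy
    unfolding F'_def by (cases xy)
      (auto intro: additive_compose[OF F(2) unital_module_additive(2)[OF module_M]])
  have "free_ext F' p = 0" if "p \<in> tensor_relations sM sN" for p
    using free_ext_tensor_relations[OF module_M F, of "{0}" sN p] bal that
    by (simp add: F'_def group_closure.base)
  then obtain h where h: "additive h" "\<And>c xy. h (sT c (case xy of (x, y) \<Rightarrow> ten x y)) = F' xy c"
    by (rule presented_module_hom_exists[OF presented F']) blast+
  have "h (ten x y) = F x y" for x y
    using h(2)[of 1 "(x, y)"]
    by (simp add: F'_def unital_moduleD[OF module_T] unital_moduleD[OF module_M])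
  with h(1) show ?thesis by blast
qed

text \<open>The map is induced in two steps: first in the second argument for fixed \<open>x\<close> and \<open>a\<close>, then the
  resulting family of maps is induced in the first argument.\<close>

lemma tensor_bihom_exists:
  assumes F: "\<And>a y b. additive (\<lambda>x. F x a y b)" "\<And>x y b. additive (\<lambda>a. F x a y b)"
      "\<And>x a b. additive (\<lambda>y. F x a y b)" "\<And>x a y. additive (\<lambda>b. F x a y b)"
    and bal: "\<And>c x a y b. F (sM c x) a y b = F x (sN c a) y b"
      "\<And>c x a y b. F x a (sM c y) b = F x a y (sN c b)"
  obtains B where "\<And>X. additive (B X)" "\<And>Y. additive (\<lambda>X. B X Y)"
    "\<And>x a y b. B (ten x a) (ten y b) = F x a y b"
proof -
  have "\<exists>h. additive h \<and> (\<forall>y b. h (ten y b) = F x a y b)" for x a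
    by (rule tensor_hom_exists) (rule F bal)+
  then have "\<exists>H. \<forall>x a. additive (H x a) \<and> (\<forall>y b. H x a (ten y b) = F x a y b)"
    by (intro choice allI)
  then obtain H where H: "\<And>x a. additive (H x a)" "\<And>x a y b. H x a (ten y b) = F x a y b"
    by blast
  have HY: "additive (\<lambda>a. H x a Y)" "additive (\<lambda>x. H x a Y)" "H (sM c x) a Y = H x (sN c a) Y"
    for c x a Y
  proof -
    show "additive (\<lambda>a. H x a Y)"
    proof (rule additiveI)
      fix a b show "H x (a + b) Y = H x a Y + H x b Y"
        using tensor_eqI[OF H(1) additive_add_fun[OF H(1) H(1)], of x "a + b" x a x b Y]
        by (simp add: H(2) additive.add[OF F(2)])
    qed
    show "additive (\<lambda>x. H x a Y)"
    proof (rule additiveI)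
      fix x y show "H (x + y) a Y = H x a Y + H y a Y"
        using tensor_eqI[OF H(1) additive_add_fun[OF H(1) H(1)], of "x + y" a x a y a Y]
        by (simp add: H(2) additive.add[OF F(1)])
    qed
    show "H (sM c x) a Y = H x (sN c a) Y"
      by (rule tensor_eqI[OF H(1) H(1)]) (simp add: H(2) bal)
  qed
  have "\<exists>h. additive h \<and> (\<forall>x a. h (ten x a) = H x a Y)" for Y
    by (rule tensor_hom_exists) (rule HY)+
  then have "\<exists>B. \<forall>Y. additive (B Y) \<and> (\<forall>x a. B Y (ten x a) = H x a Y)"
    by (intro choice allI)
  then obtain B' where B': "\<And>Y. additive (B' Y)" "\<And>x a Y. B' Y (ten x a) = H x a Y"
    by blast
  define B where "B X Y = B' Y X" for X Y
  have B: "additive (\<lambda>X. B X Y)" "B (ten x a) Y = H x a Y" for x a Y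
    using B' by (simp_all add: B_def)
  have B': "additive (B X)" for X
  proof (rule additiveI)
    fix Y Z show "B X (Y + Z) = B X Y + B X Z"
      by (rule tensor_eqI[OF B(1) additive_add_fun[OF B(1) B(1)]])
        (simp add: B(2) additive.add[OF H(1)])
  qed
  show ?thesis by (rule that[of B]) (simp_all add: B B' H)
qed

lemma tensor_bilin_eqI:
  assumes "\<And>X. additive (B X)" "\<And>Y. additive (\<lambda>X. B X Y)"
    "\<And>x a y b. B (ten x a) (ten y b) = F x a y b"
  shows "tensor_bilin ten F = B"
  unfolding tensor_bilin_def
proof (rule the_equality)
  fix B' assume B': "(\<forall>X. additive (B' X)) \<and> (\<forall>Y. additive (\<lambda>X. B' X Y)) \<and>
    (\<forall>x a y b. B' (ten x a) (ten y b) = F x a y b)"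
  show "B' = B" by (rule ext, rule ext, rule tensor_eqI2) (simp_all add: B' assms)
qed (simp add: assms)

lemma tensor_bilin_props:
  assumes F: "\<And>a y b. additive (\<lambda>x. F x a y b)" "\<And>x y b. additive (\<lambda>a. F x a y b)"
      "\<And>x a b. additive (\<lambda>y. F x a y b)" "\<And>x a y. additive (\<lambda>b. F x a y b)"
    and bal: "\<And>c x a y b. F (sM c x) a y b = F x (sN c a) y b"
      "\<And>c x a y b. F x a (sM c y) b = F x a y (sN c b)"
  shows "additive (tensor_bilin ten F X)" "additive (\<lambda>X. tensor_bilin ten F X Y)"
    "tensor_bilin ten F (ten x a) (ten y b) = F x a y b"
proof -
  obtain B where B: "\<And>X. additive (B X)" "\<And>Y. additive (\<lambda>X. B X Y)"
      "\<And>x a y b. B (ten x a) (ten y b) = F x a y b"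
    by (rule tensor_bihom_exists[OF F bal]) blast
  have "tensor_bilin ten F = B" using B by (rule tensor_bilin_eqI)
  then show "additive (tensor_bilin ten F X)" "additive (\<lambda>X. tensor_bilin ten F X Y)"
    "tensor_bilin ten F (ten x a) (ten y b) = F x a y b" using B by simp_all
qed

lemma tensor_induct2 [case_names pure add_left add_right]:
  assumes "\<And>x a y b. P (ten x a) (ten y b)"
    "\<And>X X' Y. P X Y \<Longrightarrow> P X' Y \<Longrightarrow> P (X + X') Y" "\<And>X Y Y'. P X Y \<Longrightarrow> P X Y' \<Longrightarrow> P X (Y + Y')"
  shows "P X Y"
proof (induction X rule: tensor_induct)
  case (pure x a)
  show ?case by (induction Y rule: tensor_induct) (blast intro: assms)+
qed (blast intro: assms)

lemma tensor_induct3 [case_names pure add_left add_mid add_right]: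
  assumes "\<And>x a y b z c. P (ten x a) (ten y b) (ten z c)"
    "\<And>X X' Y Z. P X Y Z \<Longrightarrow> P X' Y Z \<Longrightarrow> P (X + X') Y Z"
    "\<And>X Y Y' Z. P X Y Z \<Longrightarrow> P X Y' Z \<Longrightarrow> P X (Y + Y') Z"
    "\<And>X Y Z Z'. P X Y Z \<Longrightarrow> P X Y Z' \<Longrightarrow> P X Y (Z + Z')"
  shows "P X Y Z"
proof (induction X Y rule: tensor_induct2)
  case (pure x a y b)
  show ?case by (induction Z rule: tensor_induct) (blast intro: assms)+
qed (blast intro: assms)+

lemma tensor_map_eqI:
  assumes "additive h" "\<And>x a. h (ten x a) = ten x (f a)"
  shows "tensor_map ten f = h"
  unfolding tensor_map_def
proof (rule the_equality)
  fix h' assume h': "additive h' \<and> (\<forall>x a. h' (ten x a) = ten x (f a))"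
  show "h' = h" by (rule ext, rule tensor_eqI) (simp_all add: h' assms)
qed (simp add: assms)

lemma tensor_map_props:
  assumes "additive f" "\<And>c y. f (sN c y) = sN c (f y)"
  shows "additive (tensor_map ten f)" "tensor_map ten f (ten x a) = ten x (f a)"
proof -
  have "\<exists>h. additive h \<and> (\<forall>x a. h (ten x a) = ten x (f a))"
    by (rule tensor_hom_exists)
      (simp_all add: assms ten_scale_left ten_scale_right additive_ten
        additive_compose[OF additive_ten(1)])
  then obtain h where "additive h" "\<And>x a. h (ten x a) = ten x (f a)" by blast
  then show "additive (tensor_map ten f)" "tensor_map ten f (ten x a) = ten x (f a)"
    using tensor_map_eqI[of h f] by auto
qed

end

section \<open>Traces and generalized eigenvectors\<close>

locale linear_space = vector_space scale
  for scale :: "'a::field \<Rightarrow> 'b::ab_group_add \<Rightarrow> 'b" (infixr \<open>*s\<close> 75)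
begin

abbreviation endo :: "('b \<Rightarrow> 'b) \<Rightarrow> bool" where
  "endo \<equiv> Vector_Spaces.linear scale scale"

lemma endoI:
  assumes "\<And>x y. f (x + y) = f x + f y" "\<And>c x. f (c *s x) = c *s f x"
  shows "endo f"
  using assms vector_space_axioms by (simp add: Vector_Spaces.linear_iff)

lemma endoD:
  assumes "endo f"
  shows "f (x + y) = f x + f y" "f (c *s x) = c *s f x" "f (x - y) = f x - f y" "f 0 = 0"
    "f (sum g A) = (\<Sum>i\<in>A. f (g i))"
proof -
  interpret f: Vector_Spaces.linear scale scale f by fact
  show "f (x + y) = f x + f y" "f (c *s x) = c *s f x" "f (x - y) = f x - f y" "f 0 = 0"
    "f (sum g A) = (\<Sum>i\<in>A. f (g i))"
    by (rule f.add f.scale f.diff f.zero f.sum)+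
qed

lemma endo_ident: "endo (\<lambda>x. x)"
  and endo_compose: "endo f \<Longrightarrow> endo g \<Longrightarrow> endo (\<lambda>x. f (g x))"
  and endo_add: "endo f \<Longrightarrow> endo g \<Longrightarrow> endo (\<lambda>x. f x + g x)"
  and endo_diff: "endo f \<Longrightarrow> endo g \<Longrightarrow> endo (\<lambda>x. f x - g x)"
  and endo_scale: "endo f \<Longrightarrow> endo (\<lambda>x. c *s f x)"
  by (rule endoI; simp add: endoD algebra_simps)+

end

locale fin_dim_space = linear_space scale + finite_dimensional_vector_space scale Basis
  for scale :: "'a::field \<Rightarrow> 'b::ab_group_add \<Rightarrow> 'b" (infixr \<open>*s\<close> 75) and Basis :: "'b set"
begin

lemma linear_sum_scale:
  assumes "endo f"
  shows "f (\<Sum>b\<in>B. c b *s v b) = (\<Sum>b\<in>B. c b *s f (v b))"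
  by (simp add: endoD[OF assms])

lemma representation_linear_image:
  assumes B: "independent B" "span B = UNIV" and C: "independent C" "span C = UNIV"
    and f: "endo f"
  shows "representation C (f x) c = (\<Sum>b\<in>B. representation B x b * representation C (f b) c)"
proof -
  have fin: "finite B" using B(1) by (rule finiteI_independent)
  have "x = (\<Sum>b\<in>B. representation B x b *s b)"
    using sum_representation_eq[OF B(1) _ fin subset_refl] B(2) by simp
  then have "f x = (\<Sum>b\<in>B. representation B x b *s f b)"
    using linear_sum_scale[OF f, of "representation B x" "\<lambda>b. b" B] by simp
  then show ?thesis
    by (simp add: representation_sum representation_scale C)
qed

text \<open>Allowing two different bases makes this cover both cyclicity of the trace and, for
  \<open>g = id\<close>, its independence of the basis.\<close>

lemma trace_compose_swap:
  assumes B: "independent B" "span B = UNIV" and C: "independent C" "span C = UNIV"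
    and f: "endo f" and g: "endo g"
  shows "(\<Sum>b\<in>B. representation B (f (g b)) b) = (\<Sum>c\<in>C. representation C (g (f c)) c)"
proof -
  have "(\<Sum>b\<in>B. representation B (f (g b)) b)
      = (\<Sum>b\<in>B. \<Sum>c\<in>C. representation C (g b) c * representation B (f c) b)"
    by (intro sum.cong refl representation_linear_image[OF C B f])
  also have "\<dots> = (\<Sum>c\<in>C. \<Sum>b\<in>B. representation B (f c) b * representation C (g b) c)"
    by (subst sum.swap) (simp add: mult.commute)
  also have "\<dots> = (\<Sum>c\<in>C. representation C (g (f c)) c)"
    by (intro sum.cong refl representation_linear_image[OF B C g, symmetric])
  finally show ?thesis .
qed

lemma lin_trace_eq_sum:
  assumes B: "independent B" "span B = UNIV" and f: "endo f"
  shows "lin_trace scale f = (\<Sum>b\<in>B. representation B (f b) b)"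
proof -
  define C where "C = (SOME C. independent C \<and> span C = UNIV)"
  have "independent C \<and> span C = UNIV" unfolding C_def using B by (intro someI) blast
  moreover have "endo (\<lambda>x. x)" by (rule endo_ident)
  ultimately have "(\<Sum>c\<in>C. representation C (f c) c) = (\<Sum>b\<in>B. representation B (f b) b)"
    using trace_compose_swap[of C B f "\<lambda>x. x"] B f by simp
  then show ?thesis by (simp add: lin_trace_def C_def)
qed

lemma lin_trace_swap:
  assumes "endo f" "endo g"
  shows "lin_trace scale (\<lambda>x. f (g x)) = lin_trace scale (\<lambda>x. g (f x))"
proof -
  note B = independent_Basis span_Basis
  have "lin_trace scale (\<lambda>x. f (g x)) = (\<Sum>b\<in>Basis. representation Basis (f (g b)) b)"
    by (rule lin_trace_eq_sum[OF B endo_compose[OF assms]])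
  also have "\<dots> = (\<Sum>b\<in>Basis. representation Basis (g (f b)) b)"
    by (rule trace_compose_swap[OF B B assms])
  also have "\<dots> = lin_trace scale (\<lambda>x. g (f x))"
    by (rule lin_trace_eq_sum[OF B endo_compose[OF assms(2,1)], symmetric])
  finally show ?thesis .
qed

lemma lin_trace_add:
  assumes "endo f" "endo g"
  shows "lin_trace scale (\<lambda>x. f x + g x) = lin_trace scale f + lin_trace scale g"
  unfolding lin_trace_eq_sum[OF independent_Basis span_Basis assms(1)]
    lin_trace_eq_sum[OF independent_Basis span_Basis assms(2)]
    lin_trace_eq_sum[OF independent_Basis span_Basis endo_add[OF assms]]
  by (simp add: representation_add independent_Basis span_Basis sum.distrib)

lemma lin_trace_diff:
  assumes "endo f" "endo g"
  shows "lin_trace scale (\<lambda>x. f x - g x) = lin_trace scale f - lin_trace scale g"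
  unfolding lin_trace_eq_sum[OF independent_Basis span_Basis assms(1)]
    lin_trace_eq_sum[OF independent_Basis span_Basis assms(2)]
    lin_trace_eq_sum[OF independent_Basis span_Basis endo_diff[OF assms]]
  by (simp add: representation_diff independent_Basis span_Basis sum_subtractf)

lemma lin_trace_scale:
  assumes "endo f"
  shows "lin_trace scale (\<lambda>x. c *s f x) = c * lin_trace scale f"
  unfolding lin_trace_eq_sum[OF independent_Basis span_Basis assms]
    lin_trace_eq_sum[OF independent_Basis span_Basis endo_scale[OF assms]]
  by (simp add: representation_scale independent_Basis span_Basis sum_distrib_left)

end

context linear_space
begin

definition shift :: "('b \<Rightarrow> 'b) \<Rightarrow> 'a \<Rightarrow> 'b \<Rightarrow> 'b" where
  "shift T \<nu> v = T v - \<nu> *s v"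

lemma linear_shift: "endo T \<Longrightarrow> endo (shift T \<nu>)"
  unfolding shift_def[abs_def] by (intro endo_diff endo_scale endo_ident)

lemma linear_funpow: "endo f \<Longrightarrow> endo (f ^^ n)"
  by (induction n) (auto intro!: endoI simp: endoD)

lemma funpow_zero_mono:
  assumes "endo f" "(f ^^ n) v = 0" "n \<le> m"
  shows "(f ^^ m) v = 0"
proof -
  interpret f: Vector_Spaces.linear scale scale "f ^^ (m - n)" by (rule linear_funpow) fact
  have "(f ^^ (m - n + n)) v = 0" unfolding funpow_add using assms(2) f.zero by simp
  then show ?thesis using assms(3) by simp
qed

text \<open>On vectors killed by a power of \<open>T - \<mu>\<close> the operator \<open>T - \<nu>\<close> is the sum of a nilpotent
  operator and a nonzero scalar, so it can be inverted there.\<close>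

lemma shift_surj_on_generalized_eigenvectors:
  assumes T: "endo T" and X: "subspace X" "\<And>x. x \<in> X \<Longrightarrow> T x \<in> X"
    and neq: "\<nu> \<noteq> \<mu>" and u: "u \<in> X" "(shift T \<mu> ^^ N) u = 0"
  shows "\<exists>v\<in>X. shift T \<nu> v = u"
  using u
proof (induction N arbitrary: u)
  case 0
  interpret sh: Vector_Spaces.linear scale scale "shift T \<nu>" by (rule linear_shift[OF T])
  show ?case using 0 subspace_0[OF X(1)] by (intro bexI[of _ 0]) auto
next
  case (Suc N)
  interpret sh: Vector_Spaces.linear scale scale "shift T \<nu>" by (rule linear_shift[OF T])
  let ?w = "shift T \<mu> u"
  have "?w \<in> X" unfolding shift_def using X Suc.prems by (simp add: subspace_diff subspace_scale)
  moreover have "(shift T \<mu> ^^ N) ?w = 0" using Suc.prems(2) by (simp add: funpow_swap1)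
  ultimately obtain v where v: "v \<in> X" "shift T \<nu> v = ?w" using Suc.IH by blast
  let ?v' = "inverse (\<mu> - \<nu>) *s (u - v)"
  have "shift T \<nu> u - shift T \<nu> v = (\<mu> - \<nu>) *s u"
    unfolding v(2) by (simp add: shift_def algebra_simps)
  then have "shift T \<nu> ?v' = u" using neq by (simp add: sh.scale sh.diff)
  moreover have "?v' \<in> X" using X(1) v(1) Suc.prems(1) by (simp add: subspace_diff subspace_scale)
  ultimately show ?case by blast
qed

text \<open>The removal of \<open>b\<close> from the spanning set in the last condition makes the diagonal entry of
  \<open>T\<close> at \<open>b\<close> equal to \<open>\<chi> b\<close>.\<close>

definition generalized_eigenbasis :: "('b \<Rightarrow> 'b) \<Rightarrow> 'b set \<Rightarrow> ('b \<Rightarrow> 'a) \<Rightarrow> bool" where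
  "generalized_eigenbasis T B \<chi> \<longleftrightarrow> finite B \<and> independent B \<and>
     (\<forall>b\<in>B. (\<exists>N. (shift T (\<chi> b) ^^ N) b = 0) \<and>
            shift T (\<chi> b) b \<in> span ({c \<in> B. \<chi> c = \<chi> b} - {b}))"

lemma generalized_eigenbasis_invariant:
  assumes T: "endo T" and B: "generalized_eigenbasis T B \<chi>"
    and u: "u \<in> span {b \<in> B. P (\<chi> b)}"
  shows "T u \<in> span {b \<in> B. P (\<chi> b)}"
  using u
proof (induction rule: span_induct)
  case base
  interpret T: Vector_Spaces.linear scale scale T by fact
  have "{a. T a \<in> span {b \<in> B. P (\<chi> b)}} = T -` span {b \<in> B. P (\<chi> b)}" by auto
  then show ?case
    using T.subspace_vimage[OF subspace_span] by simp
next
  case (step b)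
  then have "shift T (\<chi> b) b \<in> span ({c \<in> B. \<chi> c = \<chi> b} - {b})"
    using B by (auto simp: generalized_eigenbasis_def)
  moreover have "span ({c \<in> B. \<chi> c = \<chi> b} - {b}) \<subseteq> span {b \<in> B. P (\<chi> b)}"
    by (rule span_mono) (use step in auto)
  ultimately have "shift T (\<chi> b) b + \<chi> b *s b \<in> span {b \<in> B. P (\<chi> b)}"
    using step by (intro span_add span_scale) (auto intro: span_base)
  then show ?case by (simp add: shift_def)
qed

lemma generalized_eigenbasis_surj:
  assumes T: "endo T" and B: "generalized_eigenbasis T B \<chi>"
    and u: "u \<in> span {b \<in> B. \<chi> b \<noteq> \<nu>}"
  shows "\<exists>v\<in>span {b \<in> B. \<chi> b \<noteq> \<nu>}. shift T \<nu> v = u"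
proof -
  let ?X = "span {b \<in> B. \<chi> b \<noteq> \<nu>}"
  interpret sh: Vector_Spaces.linear scale scale "shift T \<nu>" by (rule linear_shift[OF T])
  have "?X \<subseteq> shift T \<nu> ` ?X"
  proof (rule span_minimal)
    show "subspace (shift T \<nu> ` ?X)" by (rule sh.subspace_image) simp
    show "{b \<in> B. \<chi> b \<noteq> \<nu>} \<subseteq> shift T \<nu> ` ?X"
    proof safe
      fix b assume b: "b \<in> B" "\<chi> b \<noteq> \<nu>"
      obtain N where "(shift T (\<chi> b) ^^ N) b = 0" using B b by (auto simp: generalized_eigenbasis_def)
      then have "\<exists>v\<in>?X. shift T \<nu> v = b"
        using b generalized_eigenbasis_invariant[OF T B, where P = "\<lambda>c. c \<noteq> \<nu>"]
        by (intro shift_surj_on_generalized_eigenvectors[OF T subspace_span, of _ \<nu> "\<chi> b"])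
          (auto intro: span_base)
      then show "b \<in> shift T \<nu> ` ?X" by blast
    qed
  qed
  with u show ?thesis by blast
qed

lemma generalized_eigenbasis_nilpotent:
  assumes T: "endo T" and B: "generalized_eigenbasis T B \<chi>"
  shows "\<exists>N. \<forall>u\<in>span {b \<in> B. \<chi> b = \<nu>}. (shift T \<nu> ^^ N) u = 0"
proof -
  have "\<forall>b\<in>B. \<exists>N. (shift T (\<chi> b) ^^ N) b = 0" using B by (auto simp: generalized_eigenbasis_def)
  from bchoice[OF this] obtain n where n: "\<forall>b\<in>B. (shift T (\<chi> b) ^^ n b) b = 0" ..
  have fin: "finite B" using B by (simp add: generalized_eigenbasis_def)
  let ?N = "Max (insert 0 (n ` B))"
  interpret p: Vector_Spaces.linear scale scale "shift T \<nu> ^^ ?N" by (intro linear_funpow linear_shift T)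
  have "(shift T \<nu> ^^ ?N) b = 0" if "b \<in> B" "\<chi> b = \<nu>" for b
  proof (rule funpow_zero_mono[OF linear_shift[OF T]])
    show "(shift T \<nu> ^^ n b) b = 0" using bspec[OF n that(1)] that(2) by simp
    show "n b \<le> ?N" using that(1) fin by (intro Max_ge) auto
  qed
  then have "\<forall>u\<in>span {b \<in> B. \<chi> b = \<nu>}. (shift T \<nu> ^^ ?N) u = 0"
    using p.eq_0_on_span[of "{b \<in> B. \<chi> b = \<nu>}"] by auto
  then show ?thesis by blast
qed

text \<open>A triangular basis is straightened from the bottom up: the part of \<open>T x - \<nu> x\<close> that lies in
  the other generalized eigenspaces is removed by correcting \<open>x\<close> there.\<close>

lemma triangular_imp_generalized_eigenbasis:
  assumes T: "endo T"
    and "distinct bs" "independent (set bs)"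
      "\<And>i. i < length bs \<Longrightarrow> T (bs ! i) \<in> span (set (take (Suc i) bs))"
  shows "\<exists>B \<chi>. generalized_eigenbasis T B \<chi> \<and> span B = span (set bs)"
  using assms(2-)
proof (induction bs rule: rev_induct)
  case Nil
  have "generalized_eigenbasis T {} (\<lambda>_. 0)"
    by (simp add: generalized_eigenbasis_def independent_empty)
  then show ?case by auto
next
  case (snoc x bs)
  interpret T: Vector_Spaces.linear scale scale T by fact
  have "T (bs ! i) \<in> span (set (take (Suc i) bs))" if "i < length bs" for i
    using snoc.prems(3)[of i] that by (simp add: nth_append)
  moreover have "independent (set bs)" using snoc.prems(2) by (rule independent_mono) auto
  ultimately obtain B \<chi> where B: "generalized_eigenbasis T B \<chi>" "span B = span (set bs)"
    using snoc.IH snoc.prems(1) by auto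
  have x: "x \<notin> span B"
    using snoc.prems(1,2) unfolding B(2) dependent_def by auto
  have "T x \<in> span (insert x (set bs))" using snoc.prems(3)[of "length bs"] by simp
  then have "T x \<in> span (insert x B)" unfolding span_insert B(2) .
  then obtain \<nu> where w: "T x - \<nu> *s x \<in> span B" unfolding span_insert by blast
  let ?E = "{b \<in> B. \<chi> b = \<nu>}" and ?U = "{b \<in> B. \<chi> b \<noteq> \<nu>}"
  have "?E \<union> ?U = B" by auto
  then obtain w1 w2 where w12: "w1 \<in> span ?E" "w2 \<in> span ?U" "T x - \<nu> *s x = w1 + w2"
    using w span_Un[of ?E ?U] by (smt (verit) mem_Collect_eq)
  obtain v where v: "v \<in> span ?U" "shift T \<nu> v = w2"
    using generalized_eigenbasis_surj[OF T B(1) w12(2)] by blast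
  have vB: "v \<in> span B" using v(1) span_mono[of ?U B] by auto
  define y where "y = x - v"
  have Ty: "shift T \<nu> y = w1"
    using w12(3) v(2) by (simp add: shift_def y_def T.diff algebra_simps)
  have y: "y \<notin> span B"
    using x vB span_add[of y B v] by (auto simp: y_def)
  then have yB: "y \<notin> B" using span_base by blast
  have "span (insert y B) = span (insert x B)"
    using vB by (intro eq_span_insert_eq) (simp add: y_def span_neg)
  then have span_eq: "span (insert y B) = span (set (bs @ [x]))"
    by (simp add: span_insert B(2))
  obtain N where N: "\<And>u. u \<in> span ?E \<Longrightarrow> (shift T \<nu> ^^ N) u = 0"
    using generalized_eigenbasis_nilpotent[OF T B(1)] by blast
  have "(shift T \<nu> ^^ Suc N) y = 0"
    unfolding funpow_Suc_right using N[OF w12(1)] Ty by simp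
  let ?\<chi> = "\<chi>(y := \<nu>)"
  have "generalized_eigenbasis T (insert y B) ?\<chi>"
    unfolding generalized_eigenbasis_def
  proof (intro conjI ballI)
    show "finite (insert y B)" "independent (insert y B)"
      using B(1) independent_insertI[OF y] by (simp_all add: generalized_eigenbasis_def)
    fix b assume b: "b \<in> insert y B"
    show "\<exists>N. (shift T (?\<chi> b) ^^ N) b = 0"
      using b yB B(1) \<open>(shift T \<nu> ^^ Suc N) y = 0\<close>
      by (cases "b = y") (auto simp: generalized_eigenbasis_def simp del: funpow.simps)
    show "shift T (?\<chi> b) b \<in> span ({c \<in> insert y B. ?\<chi> c = ?\<chi> b} - {b})"
    proof (cases "b = y")
      case True
      have "?E \<subseteq> {c \<in> insert y B. ?\<chi> c = ?\<chi> b} - {b}" using True yB by auto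
      then have "w1 \<in> span ({c \<in> insert y B. ?\<chi> c = ?\<chi> b} - {b})"
        using span_mono w12(1) by blast
      moreover have "shift T (?\<chi> b) b = w1" using Ty True by simp
      ultimately show ?thesis by (simp only:)
    next
      case False
      then have "shift T (\<chi> b) b \<in> span ({c \<in> B. \<chi> c = \<chi> b} - {b})"
        using b B(1) by (auto simp: generalized_eigenbasis_def)
      moreover have "{c \<in> B. \<chi> c = \<chi> b} - {b} \<subseteq> {c \<in> insert y B. ?\<chi> c = ?\<chi> b} - {b}"
        using False yB by auto
      ultimately have "shift T (\<chi> b) b \<in> span ({c \<in> insert y B. ?\<chi> c = ?\<chi> b} - {b})"
        using span_mono by blast
      then show ?thesis using False by simp
    qed
  qed
  then show ?case using span_eq by (intro exI conjI)
qed

lemma generalized_eigenbasis_diagonal: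
  assumes B: "generalized_eigenbasis T B \<chi>" and b: "b \<in> B"
  shows "representation B (T b) b = \<chi> b"
proof -
  have ind: "independent B" using B by (simp add: generalized_eigenbasis_def)
  let ?C = "{c \<in> B. \<chi> c = \<chi> b} - {b}"
  have s: "shift T (\<chi> b) b \<in> span ?C" using B b by (auto simp: generalized_eigenbasis_def)
  have CB: "?C \<subseteq> B" by auto
  have "representation B (shift T (\<chi> b) b) b = 0"
    using representation_ne_zero[of ?C "shift T (\<chi> b) b" b] representation_extend[OF ind s CB] by auto
  moreover have "shift T (\<chi> b) b \<in> span B" using s span_mono[OF CB] by auto
  moreover have "T b = shift T (\<chi> b) b + \<chi> b *s b" by (simp add: shift_def)
  ultimately show ?thesis
    using b by (simp add: representation_add representation_scale representation_basis ind span_base span_scale)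
qed

end

text \<open>Conversely a vector killed by a power of \<open>T - \<nu>\<close> has no component along the other
  eigenvalues, because \<open>T - \<nu>\<close> maps their span bijectively to itself.\<close>

lemma (in fin_dim_space) generalized_eigenvector_component:
  assumes T: "endo T" and B: "generalized_eigenbasis T B \<chi>" "span B = UNIV"
    and v: "(shift T \<nu> ^^ N) v = 0"
  shows "v \<in> span {b \<in> B. \<chi> b = \<nu>}"
proof -
  let ?E = "{b \<in> B. \<chi> b = \<nu>}" and ?U = "{b \<in> B. \<chi> b \<noteq> \<nu>}"
  interpret vector_space_pair scale scale by unfold_locales
  have ind: "independent B" using B by (simp add: generalized_eigenbasis_def)
  interpret sh: Vector_Spaces.linear scale scale "shift T \<nu>" by (rule linear_shift[OF T])
  define F where "F = construct B (\<lambda>b. if \<chi> b = \<nu> then b else shift T \<nu> b)"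
  have F: "endo F" unfolding F_def by (rule linear_construct[OF ind])
  interpret F: Vector_Spaces.linear scale scale F by (rule F)
  have FE: "F u = u" if "u \<in> span ?E" for u
    by (rule linear_eq_on[OF F endo_ident that]) (simp add: F_def construct_basis[OF ind])
  have FU: "F u = shift T \<nu> u" if "u \<in> span ?U" for u
    by (rule linear_eq_on[OF F linear_shift[OF T] that]) (simp add: F_def construct_basis[OF ind])
  have "?E \<union> ?U = B" by auto
  have split: "\<exists>u1 u2. u1 \<in> span ?E \<and> u2 \<in> span ?U \<and> u = u1 + u2" for u
  proof -
    have "u \<in> span (?E \<union> ?U)" using \<open>?E \<union> ?U = B\<close> B(2) by simp
    then show ?thesis unfolding span_Un by blast
  qed
  have "surj F"
    unfolding surj_def
  proof (intro allI)
    fix u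
    obtain u1 u2 where u: "u1 \<in> span ?E" "u2 \<in> span ?U" "u = u1 + u2" using split by blast
    obtain w where "w \<in> span ?U" "shift T \<nu> w = u2"
      using generalized_eigenbasis_surj[OF T B(1) u(2)] by blast
    then have "F (u1 + w) = u" using FE[OF u(1)] FU[of w] u(3) by (simp add: F.add)
    then show "\<exists>x. u = F x" by blast
  qed
  then have inj: "inj F" by (rule linear_surj_imp_inj[OF F])
  have shU: "shift T \<nu> u \<in> span ?U" if "u \<in> span ?U" for u
    using generalized_eigenbasis_invariant[OF T B(1), where P = "\<lambda>c. c \<noteq> \<nu>"] that
    by (simp add: shift_def span_diff span_scale)
  have kerU: "u = 0" if "u \<in> span ?U" "(shift T \<nu> ^^ M) u = 0" for u M
    using that
  proof (induction M arbitrary: u)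
    case (Suc M)
    have "(shift T \<nu> ^^ M) (shift T \<nu> u) = 0" using Suc.prems(2) by (simp add: funpow_swap1)
    then have "shift T \<nu> u = 0" using Suc.IH shU Suc.prems(1) by blast
    then have "F u = F 0" using FU Suc.prems(1) by (simp only: F.zero)
    then show ?case by (rule injD[OF inj])
  qed simp
  obtain v1 v2 where v12: "v1 \<in> span ?E" "v2 \<in> span ?U" "v = v1 + v2" using split by blast
  obtain M where M: "(shift T \<nu> ^^ M) v1 = 0"
    using generalized_eigenbasis_nilpotent[OF T B(1)] v12(1) by blast
  let ?K = "max M N"
  interpret p: Vector_Spaces.linear scale scale "shift T \<nu> ^^ ?K" by (intro linear_funpow linear_shift T)
  have "(shift T \<nu> ^^ ?K) v = 0" "(shift T \<nu> ^^ ?K) v1 = 0"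
    by (rule funpow_zero_mono[OF linear_shift[OF T] v], simp,
        rule funpow_zero_mono[OF linear_shift[OF T] M], simp)
  then have "(shift T \<nu> ^^ ?K) v2 = 0" unfolding v12(3) p.add by simp
  then have "v2 = 0" using kerU v12(2) by blast
  then show ?thesis using v12 by simp
qed

section \<open>The Killing form of a split simple Lie algebra\<close>

locale fd_lie_algebra = fin_dim_space scale Basis
  for scale :: "'a::field_char_0 \<Rightarrow> 'b::ab_group_add \<Rightarrow> 'b" (infixr \<open>*s\<close> 75) and Basis +
  fixes br :: "'b \<Rightarrow> 'b \<Rightarrow> 'b"
  assumes lie: "lie_algebra_on scale br UNIV"
begin

lemma br_add: "br (x + y) z = br x z + br y z" "br z (x + y) = br z x + br z y"
  and br_scale: "br (c *s x) y = c *s br x y" "br x (c *s y) = c *s br x y"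
  and br_self: "br x x = 0"
  and jacobi_cyclic: "br x (br y z) + br y (br z x) + br z (br x y) = 0"
  using lie unfolding lie_algebra_on_def by auto

lemma endo_br: "endo (br x)" "endo (\<lambda>x. br x y)"
  by (auto intro!: endoI simp: br_add br_scale)

lemmas br_linear = endoD[OF endo_br(1)] endoD[OF endo_br(2)]

lemma br_swap: "br y x = - br x y"
proof -
  have "br (x + y) (x + y) = 0" by (rule br_self)
  then have "br x y + br y x = 0" unfolding br_add by (simp add: br_self add.commute)
  then show ?thesis by (simp add: eq_neg_iff_add_eq_0 add.commute)
qed

lemma br_minus: "br (- x) y = - br x y" "br x (- y) = - br x y"
  using br_linear(3)[of x 0 y] br_linear(4) br_linear(8)[of 0 x y] br_linear(9) by simp_all

lemma ad_br: "br (br x y) z = br x (br y z) - br y (br x z)"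
proof -
  have "br x (br y z) + br y (br z x) = - br z (br x y)"
    using jacobi_cyclic[of x y z] by (simp add: eq_neg_iff_add_eq_0)
  moreover have "- br z (br x y) = br (br x y) z" by (rule br_swap[symmetric])
  moreover have "br y (br z x) = - br y (br x z)" using br_swap[of z x] br_minus by simp
  ultimately show ?thesis by simp
qed

abbreviation \<kappa> :: "'b \<Rightarrow> 'b \<Rightarrow> 'a" where
  "\<kappa> \<equiv> killing scale br"

lemma killing_eq: "\<kappa> x y = lin_trace scale (\<lambda>z. br x (br y z))"
  by (simp add: killing_def o_def)

lemma endo_br_br: "endo (\<lambda>z. br x (br y z))"
  by (rule endo_compose) (rule endo_br)+

lemma killing_sym: "\<kappa> x y = \<kappa> y x"
  unfolding killing_eq by (rule lin_trace_swap) (rule endo_br)+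

lemma killing_add_left: "\<kappa> (x + y) z = \<kappa> x z + \<kappa> y z"
  unfolding killing_eq br_add by (rule lin_trace_add) (rule endo_br_br)+

lemma killing_scale_left: "\<kappa> (c *s x) z = c * \<kappa> x z"
  unfolding killing_eq br_scale by (rule lin_trace_scale) (rule endo_br_br)+

lemma killing_add_right: "\<kappa> z (x + y) = \<kappa> z x + \<kappa> z y"
  and killing_scale_right: "\<kappa> z (c *s x) = c * \<kappa> z x"
  using killing_sym[of z] by (simp_all add: killing_add_left killing_scale_left)

lemma killing_zero: "\<kappa> 0 z = 0" "\<kappa> z 0 = 0"
  using killing_scale_left[of 0] killing_scale_right[of _ 0] by simp_all

lemma killing_sum_left: "\<kappa> (sum f A) z = (\<Sum>i\<in>A. \<kappa> (f i) z)"
  and killing_sum_right: "\<kappa> z (sum f A) = (\<Sum>i\<in>A. \<kappa> z (f i))"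
  by (induction A rule: infinite_finite_induct)
    (simp_all add: killing_zero killing_add_left killing_add_right)

lemma endo_br3: "endo (\<lambda>w. br x (br y (br z w)))"
  by (rule endo_compose[OF endo_br(1) endo_br_br])

lemma killing_invariant: "\<kappa> (br x y) z = \<kappa> x (br y z)"
proof -
  have "\<kappa> (br x y) z
      = lin_trace scale (\<lambda>w. br x (br y (br z w))) - lin_trace scale (\<lambda>w. br y (br x (br z w)))"
    unfolding killing_eq ad_br[of x y] by (rule lin_trace_diff) (rule endo_br3)+
  also have "lin_trace scale (\<lambda>w. br y (br x (br z w))) = lin_trace scale (\<lambda>w. br x (br z (br y w)))"
    by (rule lin_trace_swap[OF endo_br(1) endo_br_br])
  also have "lin_trace scale (\<lambda>w. br x (br y (br z w))) - lin_trace scale (\<lambda>w. br x (br z (br y w)))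
      = \<kappa> x (br y z)"
    unfolding killing_eq ad_br[of y z] br_linear(3)
    by (rule lin_trace_diff[symmetric]) (rule endo_br3)+
  finally show ?thesis .
qed

text \<open>Because \<open>ad (D x)\<close> is the commutator of \<open>D\<close> with \<open>ad x\<close>, this is cyclicity of the trace.\<close>

lemma trace_derivation_ad_bracket:
  assumes D: "endo D" and der: "\<And>x y. D (br x y) = br (D x) y + br x (D y)"
  shows "lin_trace scale (\<lambda>w. D (br (br x y) w)) = \<kappa> (D x) y"
proof -
  have e: "endo (\<lambda>w. D (br x (br y w)))" for x y by (rule endo_compose[OF D endo_br_br])
  have e': "endo (\<lambda>w. br x (D (br y w)))" for x y
    by (rule endo_compose[OF endo_br(1)], rule endo_compose[OF D], rule endo_br)
  have "lin_trace scale (\<lambda>w. D (br (br x y) w))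
      = lin_trace scale (\<lambda>w. D (br x (br y w))) - lin_trace scale (\<lambda>w. D (br y (br x w)))"
    unfolding ad_br[of x y] endoD(3)[OF D] by (rule lin_trace_diff) (rule e)+
  also have "lin_trace scale (\<lambda>w. D (br y (br x w))) = lin_trace scale (\<lambda>w. br x (D (br y w)))"
    by (rule lin_trace_swap[OF endo_compose[OF D endo_br(1)] endo_br(1)])
  also have "lin_trace scale (\<lambda>w. D (br x (br y w))) - lin_trace scale (\<lambda>w. br x (D (br y w)))
      = lin_trace scale (\<lambda>w. D (br x (br y w)) - br x (D (br y w)))"
    by (rule lin_trace_diff[symmetric]) (rule e e')+
  also have "\<dots> = \<kappa> (D x) y"
    unfolding killing_eq by (simp add: der)
  finally show ?thesis .
qed

lemma shift_br:
  "shift (br h) (\<nu> + \<mu>) (br x y) = br (shift (br h) \<nu> x) y + br x (shift (br h) \<mu> y)"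
proof -
  have "br h (br x y) = br (br h x) y + br x (br h y)" by (simp add: ad_br)
  then show ?thesis by (simp add: shift_def br_linear scale_left_distrib)
qed

text \<open>Generalized eigenspaces of \<open>ad h\<close> multiply: by the Leibniz rule in \<open>shift_br\<close>, each application
  of the shifted operator lowers one of the two exponents.\<close>

lemma shift_funpow_br:
  assumes "(shift (br h) \<nu> ^^ N) x = 0" "(shift (br h) \<mu> ^^ M) y = 0"
  shows "(shift (br h) (\<nu> + \<mu>) ^^ (N + M)) (br x y) = 0"
  using assms
proof (induction "N + M" arbitrary: N M x y)
  case 0
  then show ?case by (simp add: br_linear)
next
  case (Suc n)
  have lin: "endo (shift (br h) (\<nu> + \<mu>) ^^ k)" for k
    by (rule linear_funpow[OF linear_shift[OF endo_br(1)]])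
  show ?case
  proof (cases "N = 0 \<or> M = 0")
    case True
    then have "br x y = 0" using Suc.prems by (auto simp: br_linear)
    then show ?thesis using endoD(4)[OF lin] by (simp only:)
  next
    case False
    then obtain N' M' where NM: "N = Suc N'" "M = Suc M'" by (metis not0_implies_Suc)
    have "(shift (br h) (\<nu> + \<mu>) ^^ (N' + M)) (br (shift (br h) \<nu> x) y) = 0"
      using Suc.hyps(2) Suc.prems NM by (intro Suc.hyps(1)) (auto simp: funpow_swap1)
    moreover have "(shift (br h) (\<nu> + \<mu>) ^^ (N + M')) (br x (shift (br h) \<mu> y)) = 0"
      using Suc.hyps(2) Suc.prems NM by (intro Suc.hyps(1)) (auto simp: funpow_swap1)
    moreover have "N' + M = n" "N + M' = n" using Suc.hyps(2) NM by auto
    ultimately have "(shift (br h) (\<nu> + \<mu>) ^^ n) (shift (br h) (\<nu> + \<mu>) (br x y)) = 0"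
      by (simp add: shift_br endoD(1)[OF lin])
    then show ?thesis by (simp add: Suc.hyps(2)[symmetric] funpow_swap1)
  qed
qed

end

text \<open>In an arbitrary field of characteristic \<open>0\<close> a sum of squares may vanish; the functional carries
  the eigenvalues to the rationals, where it may not.\<close>

lemma rational_functional_exists:
  fixes a :: "'a::field_char_0"
  assumes "a \<noteq> 0"
  obtains g :: "'a \<Rightarrow> rat" where "additive g" "\<And>q x. g (of_rat q * x) = q * g x" "g a = 1"
proof -
  interpret V: vector_space "\<lambda>(q::rat) (x::'a). of_rat q * x"
    by unfold_locales (simp_all add: algebra_simps of_rat_add of_rat_mult)
  interpret W: vector_space "\<lambda>(q::rat) (x::rat). q * x"
    by unfold_locales (simp_all add: algebra_simps)
  interpret vector_space_pair "\<lambda>(q::rat) (x::'a). of_rat q * x" "\<lambda>(q::rat) (x::rat). q * x"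
    by unfold_locales
  have "V.independent {a}" using assms by simp
  from linear_independent_extend[OF this, of "\<lambda>_. 1"]
  obtain g where g: "Vector_Spaces.linear (\<lambda>(q::rat) (x::'a). of_rat q * x) (\<lambda>(q::rat) (x::rat). q * x) g"
    and "g a = 1" by auto
  moreover have "additive g" "\<And>q x. g (of_rat q * x) = q * g x"
    using g by (auto intro: additiveI simp: Vector_Spaces.linear_iff)
  ultimately show ?thesis by (intro that)
qed

context fd_lie_algebra
begin

text \<open>Brackets add eigenvalues, so weighting the generalized eigenspaces of \<open>ad h\<close> by an additive
  function of the eigenvalue gives a derivation. It plays the part that replicas of the semisimple
  part of \<open>ad h\<close> play in Cartan's criterion.\<close>

lemma eigenvalue_derivation:
  assumes B: "generalized_eigenbasis (br h) B \<chi>" "span B = UNIV" and f: "additive f"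
  obtains D where "endo D" "\<And>x y. D (br x y) = br (D x) y + br x (D y)"
    "\<And>\<nu> v. v \<in> span {b \<in> B. \<chi> b = \<nu>} \<Longrightarrow> D v = f \<nu> *s v"
proof -
  interpret vector_space_pair scale scale by unfold_locales
  have ind: "independent B" using B by (simp add: generalized_eigenbasis_def)
  define D where "D = construct B (\<lambda>b. f (\<chi> b) *s b)"
  have D: "endo D" unfolding D_def by (rule linear_construct[OF ind])
  have Db: "D b = f (\<chi> b) *s b" if "b \<in> B" for b
    unfolding D_def by (rule construct_basis[OF ind that])
  have Dv: "D v = f \<nu> *s v" if "v \<in> span {b \<in> B. \<chi> b = \<nu>}" for \<nu> v
    by (rule linear_eq_on[OF D endo_scale[OF endo_ident] that]) (auto simp: Db)
  have DBB: "D (br b c) = br (D b) c + br b (D c)" if bc: "b \<in> B" "c \<in> B" for b c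
  proof -
    obtain N M where "(shift (br h) (\<chi> b) ^^ N) b = 0" "(shift (br h) (\<chi> c) ^^ M) c = 0"
      using B(1) bc unfolding generalized_eigenbasis_def by blast
    from generalized_eigenvector_component[OF endo_br(1) B shift_funpow_br[OF this]]
    have "D (br b c) = f (\<chi> b + \<chi> c) *s br b c" by (rule Dv)
    then show ?thesis using Db bc by (simp add: br_linear additive.add[OF f] scale_left_distrib)
  qed
  have DB: "D (br x c) = br (D x) c + br x (D c)" if "c \<in> B" for x c
  proof (rule linear_eq_on[where B = B and x = x])
    show "endo (\<lambda>x. D (br x c))" by (rule endo_compose[OF D endo_br(2)])
    show "endo (\<lambda>x. br (D x) c + br x (D c))"
      by (rule endo_add[OF endo_compose[OF endo_br(2) D] endo_br(2)])
  qed (simp_all add: B(2) DBB that)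
  have "D (br x y) = br (D x) y + br x (D y)" for x y
  proof (rule linear_eq_on[where B = B and x = y])
    show "endo (\<lambda>y. D (br x y))" by (rule endo_compose[OF D endo_br(1)])
    show "endo (\<lambda>y. br (D x) y + br x (D y))"
      by (rule endo_add[OF endo_br(1) endo_compose[OF endo_br(1) D]])
  qed (simp_all add: B(2) DB)
  with D Dv show ?thesis by (intro that)
qed

text \<open>For a rational functional \<open>g\<close> and the derivation \<open>D\<close> weighted by \<open>g\<close>, the trace of
  \<open>D \<circ> ad h\<close> is \<open>\<Sum> g(\<chi>) \<chi>\<close>; it vanishes if the Killing form does, because \<open>h\<close> is a sum of
  brackets. Applying \<open>g\<close> gives \<open>\<Sum> g(\<chi>)\<^sup>2 = 0\<close> in the rationals.\<close>

lemma killing_zero_imp_ad_nilpotent: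
  assumes \<kappa>: "\<And>x y. \<kappa> x y = 0" and perfect: "span {br x y | x y. True} = UNIV"
    and tri: "triangularizable scale (br h)"
  shows "\<exists>N. \<forall>v. (br h ^^ N) v = 0"
proof -
  obtain bs where bs: "distinct bs" "independent (set bs)" "span (set bs) = UNIV"
      "\<And>i. i < length bs \<Longrightarrow> br h (bs ! i) \<in> span (set (take (Suc i) bs))"
    using tri unfolding triangularizable_def by blast
  obtain B \<chi> where B: "generalized_eigenbasis (br h) B \<chi>" "span B = UNIV"
    using triangular_imp_generalized_eigenbasis[OF endo_br(1) bs(1,2,4)] bs(3) by metis
  have ind: "independent B" and fin: "finite B" using B(1) by (auto simp: generalized_eigenbasis_def)
  have "\<chi> b0 = 0" if b0: "b0 \<in> B" for b0
  proof (rule ccontr)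
    assume "\<chi> b0 \<noteq> 0"
    then obtain g :: "'a \<Rightarrow> rat" where g: "additive g" "\<And>q x. g (of_rat q * x) = q * g x" "g (\<chi> b0) = 1"
      by (rule rational_functional_exists) blast
    have "additive (\<lambda>x. of_rat (g x) :: 'a)"
      by (rule additiveI) (simp add: additive.add[OF g(1)] of_rat_add)
    then obtain D where D: "endo D" "\<And>x y. D (br x y) = br (D x) y + br x (D y)"
      "\<And>\<nu> v. v \<in> span {b \<in> B. \<chi> b = \<nu>} \<Longrightarrow> D v = of_rat (g \<nu>) *s v"
      using eigenvalue_derivation[OF B, of "\<lambda>x. of_rat (g x)"] by blast
    have e: "endo (\<lambda>w. D (br x w))" for x by (rule endo_compose[OF D(1) endo_br(1)])
    have "h \<in> span {br x y | x y. True}" using perfect by simp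
    then have "lin_trace scale (\<lambda>w. D (br h w)) = 0"
    proof (induction h rule: span_induct_alt)
      case base
      show ?case using lin_trace_scale[OF e, of 0 0] by (simp add: br_linear endoD(4)[OF D(1)])
    next
      case (step c x y)
      then obtain x1 x2 where "x = br x1 x2" by blast
      then have "lin_trace scale (\<lambda>w. D (br x w)) = 0"
        using trace_derivation_ad_bracket[OF D(1,2), of x1 x2] \<kappa> by simp
      moreover have "lin_trace scale (\<lambda>w. D (br (c *s x + y) w))
        = c * lin_trace scale (\<lambda>w. D (br x w)) + lin_trace scale (\<lambda>w. D (br y w))"
        unfolding br_linear endoD[OF D(1)] lin_trace_scale[OF e, symmetric]
        by (rule lin_trace_add[OF endo_scale[OF e] e])
      ultimately show ?case using step.IH by simp
    qed
    moreover have "lin_trace scale (\<lambda>w. D (br h w)) = (\<Sum>b\<in>B. of_rat (g (\<chi> b)) * \<chi> b)"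
      unfolding lin_trace_eq_sum[OF ind B(2) e]
    proof (rule sum.cong[OF refl])
      fix b assume b: "b \<in> B"
      have "br h b \<in> span {c \<in> B. \<chi> c = \<chi> b}"
        by (rule generalized_eigenbasis_invariant[OF endo_br(1) B(1)]) (use b in \<open>auto intro: span_base\<close>)
      then show "representation B (D (br h b)) b = of_rat (g (\<chi> b)) * \<chi> b"
        by (simp add: D(3) representation_scale ind B(2) generalized_eigenbasis_diagonal[OF B(1) b])
    qed
    ultimately have "g (\<Sum>b\<in>B. of_rat (g (\<chi> b)) * \<chi> b) = 0" using additive.zero[OF g(1)] by simp
    then have "(\<Sum>b\<in>B. g (\<chi> b) * g (\<chi> b)) = 0" by (simp add: additive.sum[OF g(1)] g(2))
    then have "g (\<chi> b0) * g (\<chi> b0) = 0"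
      using b0 fin by (subst (asm) sum_nonneg_eq_0_iff) auto
    then show False using g(3) by simp
  qed
  then have "{b \<in> B. \<chi> b = 0} = B" by auto
  moreover have "shift (br h) 0 = br h" by (simp add: fun_eq_iff shift_def)
  ultimately show ?thesis using generalized_eigenbasis_nilpotent[OF endo_br(1) B(1), of 0] B(2) by simp
qed

text \<open>Engel's theorem for the action of a nilpotent subalgebra \<open>H\<close> on the quotient by \<open>H\<close>: if \<open>H\<close>
  is proper, an ideal of \<open>H\<close> that is maximal among those annihilating a nonzero class of the
  quotient must be \<open>H\<close>, so the normalizer of \<open>H\<close> is larger than \<open>H\<close>.\<close>

lemma ad_nilpotent_cartan_eq_UNIV:
  assumes H: "cartan_subalgebra scale br H" and nil: "\<And>h. h \<in> H \<Longrightarrow> \<exists>N. \<forall>v. (br h ^^ N) v = 0"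
  shows "H = UNIV"
proof (rule ccontr)
  assume "H \<noteq> UNIV"
  have subH: "subspace H" and brH: "\<And>x y. x \<in> H \<Longrightarrow> y \<in> H \<Longrightarrow> br x y \<in> H"
    and norm: "{x. \<forall>h\<in>H. br x h \<in> H} = H"
    using H by (auto simp: cartan_subalgebra_def lie_algebra_on_def)
  obtain m where m: "lower_central scale br H m = {0}" using H by (auto simp: cartan_subalgebra_def)
  define P where "P K \<longleftrightarrow> subspace K \<and> K \<subseteq> H \<and> (\<forall>h\<in>H. \<forall>k\<in>K. br h k \<in> K) \<and>
    (\<exists>x. x \<notin> H \<and> (\<forall>k\<in>K. br x k \<in> H))" for K
  have "P {0}" using \<open>H \<noteq> UNIV\<close> subspace_0[OF subH] by (auto simp: P_def br_linear)
  moreover have "dim K < Suc (card Basis)" for K using dim_subset_UNIV[of K] by (simp add: dimension_def)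
  ultimately obtain K where K: "P K" and maxK: "\<And>L. P L \<Longrightarrow> dim L \<le> dim K"
    using ex_has_greatest_nat[of P "{0}" dim "Suc (card Basis)"] by (metis less_imp_le)
  have subK: "subspace K" and KH: "K \<subseteq> H" and idK: "\<And>h k. h \<in> H \<Longrightarrow> k \<in> K \<Longrightarrow> br h k \<in> K"
    using K by (auto simp: P_def)
  obtain x where x: "x \<notin> H" "\<And>k. k \<in> K \<Longrightarrow> br x k \<in> H" using K by (auto simp: P_def)
  have lcH: "lower_central scale br H i \<subseteq> H" for i
  proof (induction i)
    case (Suc i)
    then show ?case using brH by (auto intro!: span_minimal[OF _ subH])
  qed simp
  show False
  proof (cases "H \<subseteq> K")
    case True
    then have "x \<in> {x. \<forall>h\<in>H. br x h \<in> H}" using x by blast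
    then show False using norm x(1) by simp
  next
    case False
    \<comment> \<open>nilpotency of \<open>H\<close> gives \<open>h\<close> outside \<open>K\<close> with \<open>[H, h]\<close> inside \<open>K\<close>, so that \<open>K + k h\<close> is an ideal\<close>
    let ?Q = "\<lambda>i. lower_central scale br H i \<subseteq> K"
    have "?Q m" using m subspace_0[OF subK] by simp
    then have "?Q (Least ?Q)" by (rule LeastI)
    moreover have "Least ?Q \<noteq> 0" using calculation False by (metis lower_central.simps(1))
    then obtain j where j: "Least ?Q = Suc j" using not0_implies_Suc by blast
    moreover have "\<not> ?Q j" by (rule not_less_Least) (simp add: j)
    ultimately obtain h where h: "h \<in> lower_central scale br H j" "h \<notin> K" "?Q (Suc j)" by auto
    have hH: "h \<in> H" using h(1) lcH by blast
    have hK: "br y h \<in> K" if "y \<in> H" for y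
    proof -
      have "br y h \<in> lower_central scale br H (Suc j)"
        using that h(1) by (auto intro!: span_base)
      then show ?thesis using h(3) by blast
    qed
    define L where "L = span (insert h K)"
    have L: "\<exists>c k. k \<in> K \<and> y = k + c *s h" if y: "y \<in> L" for y
    proof -
      obtain c where "y - c *s h \<in> span K" using y unfolding L_def span_insert by blast
      then have "y - c *s h \<in> K" unfolding span_eq_iff[THEN iffD2, OF subK] .
      then show ?thesis by (intro exI[of _ c] exI[of _ "y - c *s h"]) simp
    qed
    have KL: "K \<subseteq> L" unfolding L_def using span_superset by blast
    \<comment> \<open>\<open>y\<close> is the last iterate of \<open>x\<close> under the nilpotent \<open>ad h\<close> that is still outside \<open>H\<close>\<close>
    obtain N where "(br h ^^ N) x = 0" using nil[OF hH] by blast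
    then have "(br h ^^ N) x \<in> H" using subspace_0[OF subH] by simp
    then have least: "(br h ^^ (LEAST n. (br h ^^ n) x \<in> H)) x \<in> H" by (rule LeastI)
    then have "(LEAST n. (br h ^^ n) x \<in> H) \<noteq> 0"
      using x(1) by (metis funpow_0)
    then obtain n where n: "(LEAST n. (br h ^^ n) x \<in> H) = Suc n" using not0_implies_Suc by blast
    define y where "y = (br h ^^ n) x"
    have yH: "y \<notin> H" unfolding y_def by (rule not_less_Least) (simp add: n)
    have hy: "br h y \<in> H" using least unfolding n y_def by simp
    have "br ((br h ^^ n) x) k \<in> H" if "k \<in> K" for n k
      using that
    proof (induction n arbitrary: k)
      case (Suc n)
      have "br h (br ((br h ^^ n) x) k) \<in> H" by (rule brH[OF hH Suc.IH[OF Suc.prems]])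
      moreover have "br ((br h ^^ n) x) (br h k) \<in> H" by (rule Suc.IH[OF idK[OF hH Suc.prems]])
      ultimately show ?case by (simp add: ad_br[of h] subspace_diff[OF subH])
    qed (simp add: x(2))
    then have yK: "br y k \<in> H" if "k \<in> K" for k using that by (simp add: y_def)
    have "br y h \<in> H" using hy br_swap[of y h] subspace_neg[OF subH] by simp
    then have yL: "br y l \<in> H" if "l \<in> L" for l
      using L[OF that] yK by (auto simp: br_linear intro!: subspace_add[OF subH] subspace_scale[OF subH])
    have "P L" unfolding P_def
    proof (intro conjI ballI exI[of _ y])
      show "subspace L" by (simp add: L_def)
      show "L \<subseteq> H" unfolding L_def using hH KH by (intro span_minimal[OF _ subH]) auto
      fix h' l assume "h' \<in> H" "l \<in> L"
      then have "br h' l \<in> K"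
        using L[of l] idK hK by (auto simp: br_linear intro!: subspace_add[OF subK] subspace_scale[OF subK])
      then show "br h' l \<in> L" using KL by blast
    qed (use yH yL in auto)
    then have "dim L \<le> dim K" by (rule maxK)
    then have "K = L" by (intro subspace_dim_equal) (auto simp: subK L_def KL[unfolded L_def])
    then show False using h(2) span_base[of h "insert h K"] by (simp add: L_def)
  qed
qed

end

text \<open>The second assumption excludes the zero algebra.\<close>

locale nondegenerate_killing = fd_lie_algebra +
  assumes nondegenerate: "(\<And>y. \<kappa> x y = 0) \<Longrightarrow> x = 0"
    and killing_nonzero: "\<exists>x y. \<kappa> x y \<noteq> 0"

text \<open>The radical of the Killing form is an ideal. If it is everything, the Cartan subalgebra is the
  whole algebra, which is then both nilpotent and perfect.\<close>

lemma split_simple_imp_nondegenerate_killing: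
  fixes s :: "'a::field_char_0 \<Rightarrow> 'b::ab_group_add \<Rightarrow> 'b"
  assumes "split_simple_lie_algebra s br"
  obtains B where "nondegenerate_killing s B br"
proof -
  have lie: "lie_algebra_on s br UNIV" and fd: "\<exists>B. finite B \<and> module.span s B = UNIV"
    and nonab: "\<exists>x y. br x y \<noteq> 0"
    and simple: "\<And>I. module.subspace s I \<Longrightarrow> (\<And>x y. y \<in> I \<Longrightarrow> br x y \<in> I) \<Longrightarrow> I = {0} \<or> I = UNIV"
    and cartan: "\<exists>H. cartan_subalgebra s br H \<and> (\<forall>h\<in>H. triangularizable s (br h))"
    using assms unfolding split_simple_lie_algebra_def by blast+
  have "vector_space s" using lie by (simp add: lie_algebra_on_def)
  then interpret V: vector_space s .
  obtain F where F: "finite F" "V.span F = UNIV" using fd by blast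
  obtain B where B: "B \<subseteq> F" "V.independent B" "F \<subseteq> V.span B"
    using V.maximal_independent_subset by blast
  have "V.span B = UNIV" using V.span_mono[OF B(3)] F(2) V.span_span by auto
  then interpret fd_lie_algebra s B br
    by unfold_locales (use B F lie finite_subset in auto)
  have perfect: "V.span {br x y | x y. True} = UNIV"
  proof -
    have "br x y \<in> V.span {br x y | x y. True}" for x y by (rule V.span_base) blast
    then have "V.span {br x y | x y. True} = {0} \<or> V.span {br x y | x y. True} = UNIV"
      by (intro simple) auto
    then show ?thesis using \<open>\<And>x y. br x y \<in> V.span {br x y | x y. True}\<close> nonab by force
  qed
  let ?rad = "{x. \<forall>y. \<kappa> x y = 0}"
  have "?rad = {0} \<or> ?rad = UNIV"
  proof (rule simple)
    show "V.subspace ?rad"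
      by (rule V.subspaceI) (simp_all add: killing_zero killing_add_left killing_scale_left)
    fix x y assume "y \<in> ?rad"
    then show "br x y \<in> ?rad"
      using killing_invariant[of y x] br_swap[of x y] killing_scale_left[of "- 1" "br y x"] by simp
  qed
  moreover have False if rad: "?rad = UNIV"
  proof -
    obtain H where H: "cartan_subalgebra s br H" "\<And>h. h \<in> H \<Longrightarrow> triangularizable s (br h)"
      using cartan by blast
    have \<kappa>0: "\<kappa> x y = 0" for x y using rad by blast
    have "H = UNIV"
      by (rule ad_nilpotent_cartan_eq_UNIV[OF H(1)],
          rule killing_zero_imp_ad_nilpotent[OF \<kappa>0 perfect H(2)])
    moreover have "lower_central s br UNIV n = UNIV" for n :: nat
      by (induction n) (use perfect in simp_all)
    moreover obtain n where "lower_central s br H n = {0}" using H(1) by (auto simp: cartan_subalgebra_def)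
    ultimately have "(UNIV :: 'b set) = {0}" by simp
    then show False using nonab by blast
  qed
  ultimately have rad: "?rad = {0}" by blast
  have "nondegenerate_killing s B br"
  proof unfold_locales
    show "x = 0" if "\<And>y. \<kappa> x y = 0" for x using rad that by blast
    obtain x y where "br x y \<noteq> 0" using nonab by blast
    then have "br x y \<notin> ?rad" unfolding rad by simp
    then show "\<exists>x y. \<kappa> x y \<noteq> 0" by blast
  qed
  then show ?thesis by (rule that)
qed

context nondegenerate_killing
begin

lemma dual_basis_exists: "\<exists>e. \<forall>b\<in>Basis. \<forall>c\<in>Basis. \<kappa> c (e b) = (if c = b then 1 else 0)"
proof -
  define F where "F y = (\<Sum>b\<in>Basis. \<kappa> b y *s b)" for y
  have F: "endo F"
    by (rule endoI) (simp_all add: F_def killing_add_right killing_scale_right scale_left_distrib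
        sum.distrib scale_sum_right)
  have repF: "representation Basis (F y) c = \<kappa> c y" if "c \<in> Basis" for y c
    unfolding F_def using that finite_Basis
    by (simp add: representation_sum representation_scale representation_basis independent_Basis
        span_Basis sum.delta' if_distrib cong: if_cong)
  have "y = 0" if "F y = 0" for y
  proof (rule nondegenerate)
    fix x
    have 0: "\<kappa> c y = 0" if "c \<in> Basis" for c
      using repF[OF that, of y] \<open>F y = 0\<close> by (simp add: representation_zero)
    have "x = (\<Sum>b\<in>Basis. representation Basis x b *s b)"
      using sum_representation_eq[OF independent_Basis _ finite_Basis subset_refl] span_Basis by simp
    then have "\<kappa> x y = (\<Sum>b\<in>Basis. representation Basis x b * \<kappa> b y)"
      by (metis (no_types, lifting) killing_scale_left killing_sum_left sum.cong)
    then show "\<kappa> y x = 0" using 0 by (simp add: killing_sym[of y])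
  qed
  then have "inj F"
  proof -
    assume ker: "\<And>y. F y = 0 \<Longrightarrow> y = 0"
    show ?thesis
    proof (rule injI)
      fix x y assume "F x = F y"
      then have "F (x - y) = 0" by (simp add: endoD(3)[OF F])
      then have "x - y = 0" by (rule ker)
      then show "x = y" by simp
    qed
  qed
  then have "surj F" by (rule linear_inj_imp_surj[OF F])
  then have "\<forall>b. \<exists>y. F y = b" by (metis surjD)
  then obtain e where "\<And>b. F (e b) = b" by metis
  then have "\<forall>b\<in>Basis. \<forall>c\<in>Basis. \<kappa> c (e b) = (if c = b then 1 else 0)"
    using repF by (metis representation_basis[OF independent_Basis])
  then show ?thesis by blast
qed

definition dual :: "'b \<Rightarrow> 'b" where
  "dual = (SOME e. \<forall>b\<in>Basis. \<forall>c\<in>Basis. \<kappa> c (e b) = (if c = b then 1 else 0))"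

lemma killing_dual: "b \<in> Basis \<Longrightarrow> c \<in> Basis \<Longrightarrow> \<kappa> c (dual b) = (if c = b then 1 else 0)"
  using someI_ex[OF dual_basis_exists] unfolding dual_def by blast

lemma killing_dual_eq_representation:
  assumes "b \<in> Basis" shows "\<kappa> x (dual b) = representation Basis x b"
proof -
  have "x = (\<Sum>b\<in>Basis. representation Basis x b *s b)"
    using sum_representation_eq[OF independent_Basis _ finite_Basis subset_refl] span_Basis by simp
  then have "\<kappa> x (dual b) = (\<Sum>c\<in>Basis. representation Basis x c * \<kappa> c (dual b))"
    by (metis (no_types, lifting) killing_scale_left killing_sum_left sum.cong)
  also have "\<dots> = (\<Sum>c\<in>Basis. if c = b then representation Basis x c else 0)"
    by (intro sum.cong refl) (simp add: killing_dual assms)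
  finally show ?thesis using assms finite_Basis by simp
qed

lemma expand_basis: "(\<Sum>b\<in>Basis. \<kappa> x (dual b) *s b) = x"
  using sum_representation_eq[OF independent_Basis _ finite_Basis subset_refl, of x] span_Basis
  by (simp add: killing_dual_eq_representation cong: sum.cong)

lemma expand_dual: "(\<Sum>b\<in>Basis. \<kappa> x b *s dual b) = x"
proof -
  have "(\<Sum>b\<in>Basis. \<kappa> x b *s dual b) - x = 0"
  proof (rule nondegenerate)
    fix y
    have "\<kappa> x y = \<kappa> x (\<Sum>b\<in>Basis. \<kappa> y (dual b) *s b)" by (simp add: expand_basis)
    also have "\<dots> = (\<Sum>b\<in>Basis. \<kappa> y (dual b) * \<kappa> x b)" by (simp add: killing_sum_right killing_scale_right)
    also have "\<dots> = \<kappa> (\<Sum>b\<in>Basis. \<kappa> x b *s dual b) y"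
      by (simp add: killing_sum_left killing_scale_left killing_sym[of y] mult.commute)
    finally have "\<kappa> (\<Sum>b\<in>Basis. \<kappa> x b *s dual b) y - \<kappa> x y = 0" by simp
    moreover have "\<kappa> (u - v) y = \<kappa> u y - \<kappa> v y" for u v
      using killing_add_left[of "u - v" v y] by simp
    ultimately show "\<kappa> ((\<Sum>b\<in>Basis. \<kappa> x b *s dual b) - x) y = 0" by simp
  qed
  then show ?thesis by simp
qed

lemma killing_trace: "\<kappa> x y = (\<Sum>b\<in>Basis. \<kappa> (br x (br y b)) (dual b))"
  unfolding killing_eq[of x y] lin_trace_eq_sum[OF independent_Basis span_Basis endo_br_br]
  by (simp add: killing_dual_eq_representation cong: sum.cong)

text \<open>Paired with \<open>y\<close> the sum becomes the trace \<open>\<kappa> x y\<close>: the Casimir element of the Killing form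
  acts as the identity on the adjoint module.\<close>

lemma casimir_identity: "(\<Sum>b\<in>Basis. br (br x b) (dual b)) = x"
proof -
  have "(\<Sum>b\<in>Basis. br (br x b) (dual b)) - x = 0"
  proof (rule nondegenerate)
    fix y
    have "\<kappa> (\<Sum>b\<in>Basis. br (br x b) (dual b)) y = (\<Sum>b\<in>Basis. \<kappa> (br (br x b) (dual b)) y)"
      by (rule killing_sum_left)
    also have "\<dots> = (\<Sum>b\<in>Basis. \<kappa> (br y (br x b)) (dual b))"
      by (intro sum.cong refl) (metis killing_invariant killing_sym)
    also have "\<dots> = \<kappa> x y" by (simp add: killing_trace[symmetric] killing_sym[of y x])
    finally have "\<kappa> (\<Sum>b\<in>Basis. br (br x b) (dual b)) y - \<kappa> x y = 0" by simp
    moreover have "\<kappa> (u - v) y = \<kappa> u y - \<kappa> v y" for u v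
      using killing_add_left[of "u - v" v y] by simp
    ultimately show "\<kappa> ((\<Sum>b\<in>Basis. br (br x b) (dual b)) - x) y = 0" by simp
  qed
  then show ?thesis by simp
qed

end

section \<open>The current algebra\<close>

lemma unital_ring_homD:
  assumes "unital_ring_hom f"
  shows "f 1 = 1" "f (a + b) = f a + f b" "f (a * b) = f a * f b" "additive f"
  using assms unfolding unital_ring_hom_def by (auto intro: additiveI)

lemma lie_autD:
  assumes "\<theta> \<in> lie_aut s b"
  shows "bij \<theta>" "additive \<theta>" "\<theta> (s c x) = s c (\<theta> x)" "\<theta> (b x y) = b (\<theta> x) (\<theta> y)"
  using assms by (simp_all add: lie_aut_def additiveI)

lemma lie_autI:
  assumes "bij \<theta>" "\<And>x y. \<theta> (x + y) = \<theta> x + \<theta> y" "\<And>c x. \<theta> (s c x) = s c (\<theta> x)"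
    "\<And>x y. \<theta> (b x y) = b (\<theta> x) (\<theta> y)"
  shows "\<theta> \<in> lie_aut s b"
  using assms by (simp add: lie_aut_def)

locale current_algebra =
  nondegenerate_killing scale Basis br + tensor_product scale "\<lambda>c s. \<sigma> c * s" sT ten
  for scale :: "'k::field_char_0 \<Rightarrow> 'g::ab_group_add \<Rightarrow> 'g" (infixr \<open>*s\<close> 75) and Basis br
    and \<sigma> :: "'k \<Rightarrow> 's::{comm_ring,comm_monoid_mult}"
    and sT :: "'k \<Rightarrow> 't::ab_group_add \<Rightarrow> 't" and ten :: "'g \<Rightarrow> 's \<Rightarrow> 't" +
  assumes \<sigma>: "unital_ring_hom \<sigma>"
begin

lemma \<sigma>_simps: "\<sigma> 1 = 1" "\<sigma> (a + b) = \<sigma> a + \<sigma> b" "\<sigma> (a * b) = \<sigma> a * \<sigma> b" "\<sigma> 0 = 0"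
  using unital_ring_homD[OF \<sigma>] additive.zero[OF unital_ring_homD(4)[OF \<sigma>]] by auto

abbreviation sc :: "'s \<Rightarrow> 't \<Rightarrow> 't" where "sc \<equiv> current_scale ten"
abbreviation lbr :: "'t \<Rightarrow> 't \<Rightarrow> 't" where "lbr \<equiv> current_bracket br ten"

definition K :: "'t \<Rightarrow> 't \<Rightarrow> 's" where
  "K = tensor_bilin ten (\<lambda>x a y b. \<sigma> (\<kappa> x y) * (a * b))"

lemma sc_additive: "additive (sc a)" and sc_ten: "sc a (ten x b) = ten x (a * b)"
  unfolding current_scale_def
  by (rule tensor_map_props; auto intro: additiveI simp: algebra_simps)+

lemma lbr_additive: "additive (lbr X)" "additive (\<lambda>X. lbr X Y)"
  and lbr_ten: "lbr (ten x a) (ten y b) = ten (br x y) (a * b)"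
proof -
  have bal: "ten (br (c *s x) y) (a * b) = ten (br x y) (\<sigma> c * a * b)"
    "ten (br x (c *s y)) (a * b) = ten (br x y) (a * (\<sigma> c * b))" for c x y a b
    unfolding br_scale ten_scale_left ten_scale_right[symmetric] by (simp_all add: algebra_simps)
  have add: "additive (\<lambda>x. ten (br x y) (a * b))" "additive (\<lambda>a. ten (br x y) (a * b))"
    "additive (\<lambda>y. ten (br x y) (a * b))" "additive (\<lambda>b. ten (br x y) (a * b))" for x y a b
    by (rule additiveI, simp add: br_add ten_add_left ten_add_right algebra_simps)+
  note props = tensor_bilin_props[OF add bal, folded current_bracket_def]
  show "additive (lbr X)" "additive (\<lambda>X. lbr X Y)"
    "lbr (ten x a) (ten y b) = ten (br x y) (a * b)"
    by (rule props)+
qed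

lemma K_additive: "additive (K X)" "additive (\<lambda>X. K X Y)"
  and K_ten: "K (ten x a) (ten y b) = \<sigma> (\<kappa> x y) * (a * b)"
proof -
  let ?F = "\<lambda>x a y b. \<sigma> (\<kappa> x y) * (a * b)"
  have add: "additive (\<lambda>x. ?F x a y b)" "additive (\<lambda>a. ?F x a y b)"
    "additive (\<lambda>y. ?F x a y b)" "additive (\<lambda>b. ?F x a y b)" for x y a b
    by (rule additiveI, simp add: killing_add_left killing_add_right \<sigma>_simps algebra_simps)+
  have bal: "?F (c *s x) a y b = ?F x (\<sigma> c * a) y b" "?F x a (c *s y) b = ?F x a y (\<sigma> c * b)"
    for c x y a b
    by (simp_all add: killing_scale_left killing_scale_right \<sigma>_simps ac_simps)
  note props = tensor_bilin_props[of ?F, OF add bal, folded K_def]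
  show "additive (K X)" "additive (\<lambda>X. K X Y)" "K (ten x a) (ten y b) = \<sigma> (\<kappa> x y) * (a * b)"
    by (rule props)+
qed

lemmas sc_lin = additive.add[OF sc_additive] additive.zero[OF sc_additive]
  additive.diff[OF sc_additive] additive.sum[OF sc_additive]
lemmas lbr_lin = additive.add[OF lbr_additive(1)] additive.zero[OF lbr_additive(1)]
  additive.diff[OF lbr_additive(1)] additive.sum[OF lbr_additive(1)]
  additive.add[OF lbr_additive(2)] additive.zero[OF lbr_additive(2)]
  additive.diff[OF lbr_additive(2)] additive.sum[OF lbr_additive(2)]
  additive.minus[OF lbr_additive(1)] additive.minus[OF lbr_additive(2)]
lemmas K_lin = additive.add[OF K_additive(1)] additive.zero[OF K_additive(1)]
  additive.diff[OF K_additive(1)] additive.sum[OF K_additive(1)]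
  additive.add[OF K_additive(2)] additive.zero[OF K_additive(2)]
  additive.diff[OF K_additive(2)] additive.sum[OF K_additive(2)]

lemma sc_sc: "sc a (sc b X) = sc (a * b) X"
  by (induction X rule: tensor_induct) (simp_all add: sc_ten sc_lin mult.assoc)

lemma sc_one: "sc 1 X = X"
  by (induction X rule: tensor_induct) (simp_all add: sc_ten sc_lin)

lemma sc_add_scalar: "sc (a + b) X = sc a X + sc b X"
  by (induction X rule: tensor_induct) (simp_all add: sc_ten sc_lin distrib_right ten_add_right)

lemma sc_zero_scalar: "sc 0 X = 0"
  using sc_add_scalar[of 0 0 X] by simp

lemma sT_eq_sc: "sT c X = sc (\<sigma> c) X"
  by (induction X rule: tensor_induct)
    (simp_all add: sc_ten sc_lin ten_scale_right unital_moduleD[OF module_T])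

lemma lbr_sc: "lbr (sc a X) Y = sc a (lbr X Y)" "lbr X (sc a Y) = sc a (lbr X Y)"
  by (induction X Y rule: tensor_induct2) (simp_all add: sc_ten sc_lin lbr_lin lbr_ten mult.assoc mult.left_commute)

lemma K_sc: "K (sc a X) Y = a * K X Y" "K X (sc a Y) = a * K X Y"
  by (induction X Y rule: tensor_induct2)
    (simp_all add: sc_ten sc_lin K_lin K_ten distrib_left ac_simps)

lemma K_sym: "K X Y = K Y X"
  by (induction X Y rule: tensor_induct2)
    (simp_all add: K_lin K_ten ac_simps killing_sym)

lemma K_invariant: "K (lbr X Y) Z = K X (lbr Y Z)"
  by (induction X Y Z rule: tensor_induct3)
    (simp_all add: K_lin lbr_lin K_ten lbr_ten killing_invariant mult.assoc)

lemma lbr_swap: "lbr Y X = - lbr X Y"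
proof (induction X Y rule: tensor_induct2)
  case (pure x a y b)
  have "br y x = - br x y" by (rule br_swap)
  then show ?case
    by (simp add: lbr_ten mult.commute[of b] additive.minus[OF additive_ten(2)])
qed (simp_all add: lbr_lin)

lemma lbr_self: "lbr X X = 0"
proof -
  have "lbr X X + lbr X X = 0" using lbr_swap[of X X] by (metis add.right_inverse)
  then have "sc (\<sigma> (1/2)) (sc (\<sigma> 2) (lbr X X)) = 0"
    using \<sigma>_simps(2)[of 1 1] by (simp add: \<sigma>_simps sc_add_scalar sc_one sc_lin)
  then show ?thesis by (simp add: sc_sc sc_one \<sigma>_simps(1) flip: \<sigma>_simps(3))
qed

lemma ad_lbr: "lbr (lbr X Y) Z = lbr X (lbr Y Z) - lbr Y (lbr X Z)"
  by (induction X Y Z rule: tensor_induct3)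
    (simp_all add: lbr_lin lbr_ten ad_br ac_simps additive.diff[OF additive_ten(2)])

lemma lbr_jacobi: "lbr X (lbr Y Z) + lbr Y (lbr Z X) + lbr Z (lbr X Y) = 0"
proof -
  have "lbr Y (lbr Z X) = - lbr Y (lbr X Z)" using lbr_swap[of X Z] by (simp add: lbr_lin)
  moreover have "lbr Z (lbr X Y) = - lbr (lbr X Y) Z" by (rule lbr_swap)
  ultimately show ?thesis by (simp add: ad_lbr)
qed

text \<open>Dual bases for the Killing form remain dual bases over \<open>'s\<close>.\<close>

abbreviation E :: "'g \<Rightarrow> 't" where "E b \<equiv> ten b 1"
abbreviation E' :: "'g \<Rightarrow> 't" where "E' b \<equiv> ten (dual b) 1"

lemma expand_E: "(\<Sum>b\<in>Basis. sc (K X (E' b)) (E b)) = X"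
proof (induction X rule: tensor_induct)
  case (pure x a)
  have "(\<Sum>b\<in>Basis. sc (K (ten x a) (E' b)) (E b)) = (\<Sum>b\<in>Basis. ten (\<kappa> x (dual b) *s b) a)"
    unfolding ten_scale_left ten_scale_right[symmetric] by (simp add: K_ten sc_ten)
  also have "\<dots> = ten x a" unfolding ten_sum_left[symmetric] expand_basis ..
  finally show ?case .
qed (simp add: K_lin sc_add_scalar sum.distrib)

lemma expand_E': "(\<Sum>b\<in>Basis. sc (K X (E b)) (E' b)) = X"
proof (induction X rule: tensor_induct)
  case (pure x a)
  have "(\<Sum>b\<in>Basis. sc (K (ten x a) (E b)) (E' b)) = (\<Sum>b\<in>Basis. ten (\<kappa> x b *s dual b) a)"
    unfolding ten_scale_left ten_scale_right[symmetric] by (simp add: K_ten sc_ten)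
  also have "\<dots> = ten x a" unfolding ten_sum_left[symmetric] expand_dual ..
  finally show ?case .
qed (simp add: K_lin sc_add_scalar sum.distrib)

lemma K_trace: "K X Y = (\<Sum>b\<in>Basis. K (lbr X (lbr Y (E b))) (E' b))"
proof (induction X Y rule: tensor_induct2)
  case (pure x a y b)
  have "\<sigma> (\<kappa> x y) = (\<Sum>c\<in>Basis. \<sigma> (\<kappa> (br x (br y c)) (dual c)))"
    unfolding killing_trace[of x y] by (rule additive.sum[OF unital_ring_homD(4)[OF \<sigma>]])
  then show ?case by (simp add: K_ten lbr_ten sum_distrib_right)
qed (simp_all add: K_lin lbr_lin sum.distrib)

lemma lbr_casimir: "(\<Sum>b\<in>Basis. lbr (lbr X (E b)) (E' b)) = X"
proof (induction X rule: tensor_induct)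
  case (pure x a)
  show ?case by (simp add: lbr_ten ten_sum_left[symmetric] casimir_identity)
qed (simp add: lbr_lin sum.distrib)

lemma centre_zero:
  assumes "\<And>Y. lbr X Y = 0" shows "X = 0"
  using lbr_casimir[of X] by (simp add: assms lbr_lin)

text \<open>By invariance of the form \<open>ad Y\<close> has, up to sign, transposed matrices in the two dual bases.\<close>

lemma dual_bases_invariant:
  assumes F: "\<And>X. additive (F X)" "\<And>Y. additive (\<lambda>X. F X Y)"
    and bil: "\<And>a X Y. F (sc a X) Y = F X (sc a Y)"
  shows "(\<Sum>b\<in>Basis. F (E' b) (lbr Y (E b))) = (\<Sum>b\<in>Basis. F (lbr (E' b) Y) (E b))"
proof -
  have "(\<Sum>b\<in>Basis. F (E' b) (lbr Y (E b)))
      = (\<Sum>b\<in>Basis. \<Sum>c\<in>Basis. F (E' b) (sc (K (lbr Y (E b)) (E' c)) (E c)))"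
    unfolding additive.sum[OF F(1), symmetric] expand_E ..
  also have "\<dots> = (\<Sum>c\<in>Basis. \<Sum>b\<in>Basis. F (sc (K (lbr (E' c) Y) (E b)) (E' b)) (E c))"
  proof -
    have "K (lbr Y (E b)) (E' c) = K (lbr (E' c) Y) (E b)" for b c
      by (metis K_sym K_invariant)
    then show ?thesis by (subst sum.swap) (simp add: bil)
  qed
  also have "\<dots> = (\<Sum>c\<in>Basis. F (lbr (E' c) Y) (E c))"
    unfolding additive.sum[OF F(2), symmetric] expand_E' ..
  finally show ?thesis .
qed

text \<open>For a form \<open>\<beta>(X, Y) = (X | D Y)\<close> the last hypothesis says that \<open>D\<close> is a derivation into a
  multiple of the adjoint module. Such derivations are inner because \<open>(X | D Y)\<close> equals
  \<open>tr (D \<circ> ad Z)\<close> with \<open>Z = [Y, X]\<close>, and that trace is the sum of the \<open>(E' b | D [Z, E b])\<close>.\<close>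

lemma derivation_form_factors_through_bracket:
  assumes \<beta>: "\<And>X. additive (\<beta> X)" "\<And>Y. additive (\<lambda>X. \<beta> X Y)"
    and bil: "\<And>a X Y. \<beta> (sc a X) Y = \<beta> X (sc a Y)"
    and der: "\<And>X Y Z. \<beta> X (lbr Y Z) = \<beta> (lbr Z X) Y + \<beta> (lbr X Y) Z"
  shows "\<beta> X Y = (\<Sum>b\<in>Basis. \<beta> (E' b) (lbr (lbr Y X) (E b)))"
proof -
  note \<beta>_lin = additive.sum[OF \<beta>(1)] additive.diff[OF \<beta>(1)] additive.sum[OF \<beta>(2)] additive.minus[OF \<beta>(2)]
  have "(\<Sum>b\<in>Basis. \<beta> (E' b) (lbr (lbr Y X) (E b)))
      = (\<Sum>b\<in>Basis. \<beta> (E' b) (lbr Y (lbr X (E b)))) - (\<Sum>b\<in>Basis. \<beta> (E' b) (lbr X (lbr Y (E b))))"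
    by (simp add: ad_lbr[of Y X] \<beta>_lin sum_subtractf)
  also have "(\<Sum>b\<in>Basis. \<beta> (E' b) (lbr Y (lbr X (E b))))
      = \<beta> (\<Sum>b\<in>Basis. lbr (lbr X (E b)) (E' b)) Y + (\<Sum>b\<in>Basis. \<beta> (lbr (E' b) Y) (lbr X (E b)))"
    by (simp add: der[of _ Y] sum.distrib \<beta>_lin)
  also have "(\<Sum>b\<in>Basis. \<beta> (E' b) (lbr X (lbr Y (E b)))) = (\<Sum>b\<in>Basis. \<beta> (lbr (E' b) Y) (lbr X (E b)))"
    by (rule dual_bases_invariant[of "\<lambda>U V. \<beta> U (lbr X V)"])
      (auto intro: \<beta> additive_compose[OF \<beta>(1) lbr_additive(1)] simp: bil lbr_sc)
  finally show ?thesis by (simp add: lbr_casimir)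
qed

text \<open>The Killing form is the trace form of the adjoint representation over \<open>'s\<close>, and traces do
  not change under conjugation.\<close>

lemma K_automorphism:
  assumes \<theta>: "\<theta> \<in> lie_aut sc lbr" shows "K (\<theta> X) (\<theta> Y) = K X Y"
proof -
  have bij: "bij \<theta>" and add: "additive \<theta>" and lin: "\<And>a X. \<theta> (sc a X) = sc a (\<theta> X)"
    and hom: "\<And>X Y. \<theta> (lbr X Y) = lbr (\<theta> X) (\<theta> Y)"
    by (rule lie_autD[OF \<theta>])+
  define \<phi> where "\<phi> = inv_into UNIV \<theta>"
  have \<phi>: "\<theta> (\<phi> X) = X" "\<phi> (\<theta> X) = X" for X
    using bij by (simp_all add: \<phi>_def bij_is_surj surj_f_inv_f bij_is_inj)
  have \<phi>_add: "additive \<phi>"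
    by (rule additiveI) (metis \<phi> additive.add[OF add])
  have \<phi>_lin: "\<phi> (sc a X) = sc a (\<phi> X)" for a X by (metis \<phi> lin)
  have \<phi>_hom: "\<phi> (lbr X Y) = lbr (\<phi> X) (\<phi> Y)" for X Y by (metis \<phi> hom)
  define A where "A Z = lbr X (lbr Y Z)" for Z
  have A: "additive A" "\<And>a Z. A (sc a Z) = sc a (A Z)"
    by (auto intro: additiveI simp: A_def lbr_lin lbr_sc)
  have "K (\<theta> X) (\<theta> Y) = (\<Sum>b\<in>Basis. K (\<theta> (A (\<phi> (E b)))) (E' b))"
    unfolding K_trace[of "\<theta> X"] by (simp add: A_def hom \<phi>)
  \<comment> \<open>the trace of \<open>\<theta> A \<phi>\<close>; expanding \<open>\<phi> (E b)\<close> and exchanging the sums turns it into that of \<open>\<phi> \<theta> A\<close>\<close>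
  also have "\<dots> = (\<Sum>b\<in>Basis. \<Sum>c\<in>Basis. K (\<theta> (A (sc (K (\<phi> (E b)) (E' c)) (E c)))) (E' b))"
    by (simp only: additive.sum[OF A(1), symmetric] additive.sum[OF add, symmetric] K_lin(8)[symmetric] expand_E)
  also have "\<dots> = (\<Sum>c\<in>Basis. \<Sum>b\<in>Basis. K (\<phi> (sc (K (\<theta> (A (E c))) (E' b)) (E b))) (E' c))"
    by (subst sum.swap) (simp add: A(2) lin \<phi>_lin K_sc mult.commute)
  also have "\<dots> = (\<Sum>c\<in>Basis. K (\<phi> (\<theta> (A (E c)))) (E' c))"
    by (simp only: additive.sum[OF \<phi>_add, symmetric] K_lin(8)[symmetric] expand_E)
  also have "\<dots> = K X Y" by (simp add: \<phi> A_def K_trace[of X Y])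
  finally show ?thesis .
qed

end

section \<open>Differentials modulo exact differentials\<close>

locale kaehler =
  fixes \<eta> :: "'k::{comm_ring,comm_monoid_mult} \<Rightarrow> 'a::{comm_ring,comm_monoid_mult}"
    and om :: "'a \<Rightarrow> 'o::ab_group_add \<Rightarrow> 'o" and d :: "'a \<Rightarrow> 'o"
  assumes is_kaehler: "is_kaehler \<eta> om d"
begin

lemma presented_differentials: "presented_module om d (kaehler_relations \<eta>)"
  using is_kaehler by (simp add: is_kaehler_def)

lemma module_om: "unital_module om"
  using presented_differentials by (simp add: presented_module_def)

lemmas om_additive = unital_module_additive[OF module_om]
lemmas om_lin = additive.add[OF om_additive(1)] additive.zero[OF om_additive(1)]
  additive.diff[OF om_additive(1)] additive.sum[OF om_additive(1)]
  additive.add[OF om_additive(2)] additive.zero[OF om_additive(2)]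
  additive.diff[OF om_additive(2)] additive.sum[OF om_additive(2)]
lemmas om_om = unital_moduleD(3)[OF module_om] and om_one = unital_moduleD(4)[OF module_om]

lemma differential_relation:
  assumes "p \<in> kaehler_relations \<eta>"
  shows "free_ext (\<lambda>x c. om c (d x)) p = 0"
  using presented_module_relation[OF presented_differentials assms] .

lemmas free_ext_differential_simps =
  additive.diff[OF additive_free_ext[of "\<lambda>x c. om c (d x)", OF om_additive(2)]]
  free_ext_single[of "\<lambda>x c. om c (d x)", OF om_additive(2)] om_one

lemma d_add: "d (a + b) = d a + d b"
proof -
  have "Poly_Mapping.single (a + b) 1 - Poly_Mapping.single a 1 - Poly_Mapping.single b 1
        \<in> kaehler_relations \<eta>" unfolding kaehler_relations_def by blast
  from differential_relation[OF this] show ?thesis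
    unfolding free_ext_differential_simps by (simp add: algebra_simps)
qed

lemma d_mult: "d (a * b) = om a (d b) + om b (d a)"
proof -
  have "Poly_Mapping.single (a * b) 1 - Poly_Mapping.single b (1 * a) - Poly_Mapping.single a (1 * b)
        \<in> kaehler_relations \<eta>" unfolding kaehler_relations_def by blast
  from differential_relation[OF this] show ?thesis
    unfolding free_ext_differential_simps by (simp add: algebra_simps)
qed

lemma d_const: "d (\<eta> z) = 0"
proof -
  have "Poly_Mapping.single (\<eta> z) 1 \<in> kaehler_relations \<eta>" unfolding kaehler_relations_def by blast
  from differential_relation[OF this] show ?thesis unfolding free_ext_differential_simps .
qed

lemma d_additive: "additive d"
  by (rule additiveI) (rule d_add)

lemmas d_lin = additive.add[OF d_additive] additive.zero[OF d_additive]
  additive.diff[OF d_additive] additive.sum[OF d_additive]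

lemma d_one: "d 1 = 0"
  using d_mult[of 1 1] by (simp add: om_one)

lemma differential_induct [case_names generator add]:
  assumes "\<And>a b. P (om a (d b))" "\<And>v w. P v \<Longrightarrow> P w \<Longrightarrow> P (v + w)"
  shows "P v"
  using presented_differentials assms by (rule presented_module_induct)

lemma differential_eqI:
  assumes "additive h" "additive h'" "\<And>a b. h (om a (d b)) = h' (om a (d b))"
  shows "h v = h' v"
  by (induction v rule: differential_induct) (simp_all add: assms additive.add)

lemma differential_hom_exists:
  assumes F: "\<And>b. additive (\<lambda>a. F a b)" "\<And>a. additive (F a)"
    and leibniz: "\<And>a b c. F c (a * b) = F (c * a) b + F (c * b) a"
    and const: "\<And>c z. F c (\<eta> z) = 0"
  obtains h where "additive h" "\<And>a b. h (om a (d b)) = F a b"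
proof -
  let ?F = "\<lambda>b a. F a b"
  have single: "free_ext ?F (Poly_Mapping.single b a) = F a b" for a b
    by (rule free_ext_single) (rule F)
  have "free_ext ?F p = 0" if "p \<in> kaehler_relations \<eta>" for p
    using that unfolding kaehler_relations_def
    by (auto simp: additive.diff[OF additive_free_ext[of ?F, OF F(1)]] single leibniz const
        additive.add[OF F(2)])
  from presented_module_hom_exists[of om d _ ?F, OF presented_differentials F(1) this] that
  show ?thesis by blast
qed

end

locale kaehler_quotient = kaehler \<eta> om d
  for \<eta> :: "'k::field \<Rightarrow> 'a::{comm_ring,comm_monoid_mult}"
    and om :: "'a \<Rightarrow> 'o::ab_group_add \<Rightarrow> 'o" and d :: "'a \<Rightarrow> 'o" +
  fixes sQ :: "'k \<Rightarrow> 'q::ab_group_add \<Rightarrow> 'q" and cl :: "'o \<Rightarrow> 'q"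
  assumes quotient: "is_quotient_space (\<lambda>c. om (\<eta> c)) (range d) sQ cl"
begin

definition w :: "'a \<Rightarrow> 'a \<Rightarrow> 'q" where "w a b = cl (om a (d b))"

lemma vector_space_sQ: "vector_space sQ" and cl_additive: "additive cl"
  and cl_scale: "cl (om (\<eta> c) v) = sQ c (cl v)"
  and cl_surj: "surj cl" and cl_eq_0_iff: "cl v = 0 \<longleftrightarrow> v \<in> range d"
  using quotient by (auto simp: is_quotient_space_def Vector_Spaces.linear_iff intro: additiveI)

lemmas cl_lin = additive.add[OF cl_additive] additive.zero[OF cl_additive]
  additive.diff[OF cl_additive] additive.sum[OF cl_additive] additive.minus[OF cl_additive]

lemma cl_d: "cl (d a) = 0"
  by (simp add: cl_eq_0_iff)

lemma w_swap: "w b a = - w a b"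
proof -
  have "w a b + w b a = cl (d (a * b))" by (simp add: w_def d_mult cl_lin)
  then show ?thesis by (simp add: cl_d eq_neg_iff_add_eq_0 add.commute)
qed

lemma quotient_induct [case_names generator add]:
  assumes "\<And>a b. P (w a b)" "\<And>z z'. P z \<Longrightarrow> P z' \<Longrightarrow> P (z + z')"
  shows "P z"
proof -
  have "P (cl v)" for v
    by (induction v rule: differential_induct) (simp_all add: assms cl_lin flip: w_def)
  then show ?thesis using cl_surj by (metis surjD)
qed

lemma quotient_eqI:
  assumes "additive h" "additive h'" "\<And>a b. h (w a b) = h' (w a b)"
  shows "h z = h' z"
  by (induction z rule: quotient_induct) (simp_all add: assms additive.add)

lemma quotient_hom_exists:
  assumes h: "additive h" and hd: "\<And>a. h (d a) = 0"
  obtains h' where "additive h'" "\<And>v. h' (cl v) = h v"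
proof -
  define h' where "h' z = h (inv_into UNIV cl z)" for z
  have h': "h' (cl v) = h v" for v
  proof -
    have "cl (inv_into UNIV cl (cl v) - v) = 0"
      by (simp add: cl_lin surj_f_inv_f[OF cl_surj])
    then obtain a where "inv_into UNIV cl (cl v) - v = d a" unfolding cl_eq_0_iff by blast
    then have "h (inv_into UNIV cl (cl v)) - h v = 0" by (metis hd additive.diff[OF h])
    then show ?thesis by (simp add: h'_def)
  qed
  moreover have "additive h'"
  proof (rule additiveI)
    fix y z obtain v u where "y = cl v" "z = cl u" using cl_surj by (metis surjD)
    then show "h' (y + z) = h' y + h' z"
      using h'[of "v + u"] h' by (simp add: cl_lin additive.add[OF h])
  qed
  ultimately show ?thesis using that by blast
qed

lemma diff_class_map_eqI:
  assumes "additive h" "\<And>a b. h (w a b) = w' (f a) (f b)"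
  shows "diff_class_map w w' f = h"
  unfolding diff_class_map_def
proof (rule the_equality)
  fix h' assume h': "additive h' \<and> (\<forall>a b. h' (w a b) = w' (f a) (f b))"
  show "h' = h" by (rule ext, rule quotient_eqI) (simp_all add: h' assms)
qed (simp add: assms)

end

lemma differential_functorial:
  assumes A: "kaehler \<eta> om d" and B: "kaehler \<eta>' om' d'"
    and f: "unital_ring_hom f" "\<And>c. f (\<eta> c) = \<eta>' c"
  obtains h where "additive h" "\<And>a b. h (om a (d b)) = om' (f a) (d' (f b))"
proof -
  interpret A: kaehler \<eta> om d by fact
  interpret B: kaehler \<eta>' om' d' by fact
  show ?thesis
  proof (rule A.differential_hom_exists[of "\<lambda>a b. om' (f a) (d' (f b))"])
    show "additive (\<lambda>a. om' (f a) (d' (f b)))" "additive (\<lambda>b. om' (f a) (d' (f b)))" for a b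
      by (auto intro!: additiveI simp: unital_ring_homD[OF f(1)] B.om_lin B.d_lin)
  qed (simp_all add: unital_ring_homD[OF f(1)] f(2) B.d_const B.d_mult B.om_lin B.om_om that)
qed

lemma diff_class_map_props:
  assumes A: "kaehler_quotient \<eta> om d sQ cl" and B: "kaehler_quotient \<eta>' om' d' sQ' cl'"
    and f: "unital_ring_hom f" "\<And>c. f (\<eta> c) = \<eta>' c"
  defines "w \<equiv> kaehler_quotient.w om d cl" and "w' \<equiv> kaehler_quotient.w om' d' cl'"
  shows "additive (diff_class_map w w' f)" "diff_class_map w w' f (w a b) = w' (f a) (f b)"
proof -
  interpret A: kaehler_quotient \<eta> om d sQ cl by fact
  interpret B: kaehler_quotient \<eta>' om' d' sQ' cl' by fact
  obtain h where h: "additive h" "\<And>a b. h (om a (d b)) = om' (f a) (d' (f b))"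
    by (rule differential_functorial[OF A.kaehler_axioms B.kaehler_axioms f]) blast
  have f1: "f 1 = 1" using f(1) by (rule unital_ring_homD)
  have "h (d a) = d' (f a)" for a using h(2)[of 1 a] by (simp add: A.om_one B.om_one f1)
  then have "cl' (h (d a)) = 0" for a by (simp add: B.cl_d)
  then obtain h' where h': "additive h'" "\<And>v. h' (cl v) = cl' (h v)"
    using A.quotient_hom_exists[of "\<lambda>v. cl' (h v)"] additive_compose[OF B.cl_additive h(1)] by metis
  have h'w: "h' (A.w a b) = B.w (f a) (f b)" for a b by (simp add: A.w_def B.w_def h' h)
  have "diff_class_map w w' f = h'"
    unfolding w_def w'_def by (rule A.diff_class_map_eqI[of h' B.w f, OF h'(1) h'w])
  then show "additive (diff_class_map w w' f)" "diff_class_map w w' f (w a b) = w' (f a) (f b)"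
    using h'(1) h'w by (simp_all add: w_def w'_def)
qed

section \<open>Lifting automorphisms to the universal central extension\<close>

locale kassel_extension =
  current_algebra scale Basis br \<sigma> sT ten + kaehler_quotient \<sigma> om d sQ cl
  for scale :: "'k::field_char_0 \<Rightarrow> 'g::ab_group_add \<Rightarrow> 'g" (infixr \<open>*s\<close> 75) and Basis br
    and \<sigma> :: "'k \<Rightarrow> 's::{comm_ring,comm_monoid_mult}"
    and sT :: "'k \<Rightarrow> 't::ab_group_add \<Rightarrow> 't" and ten :: "'g \<Rightarrow> 's \<Rightarrow> 't"
    and om :: "'s \<Rightarrow> 'o::ab_group_add \<Rightarrow> 'o" and d :: "'s \<Rightarrow> 'o"
    and sQ :: "'k \<Rightarrow> 'q::ab_group_add \<Rightarrow> 'q" and cl :: "'o \<Rightarrow> 'q"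
begin

text \<open>The cocycle before passing to the quotient, with values in the \<open>'s\<close>-module of differentials.
  There it is \<open>(X | \<nabla> Y)\<close> for the derivation \<open>\<nabla> = id \<otimes> d\<close>, which explains the two rules
  \<open>W_sc_right\<close> and \<open>W_bracket\<close> below.\<close>

definition W :: "'t \<Rightarrow> 't \<Rightarrow> 'o" where
  "W = tensor_bilin ten (\<lambda>x a y b. om (\<sigma> (\<kappa> x y) * a) (d b))"

lemma W_additive: "additive (W X)" "additive (\<lambda>X. W X Y)"
  and W_ten: "W (ten x a) (ten y b) = om (\<sigma> (\<kappa> x y) * a) (d b)"
proof -
  let ?F = "\<lambda>x a y b. om (\<sigma> (\<kappa> x y) * a) (d b)"
  have add: "additive (\<lambda>x. ?F x a y b)" "additive (\<lambda>a. ?F x a y b)"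
    "additive (\<lambda>y. ?F x a y b)" "additive (\<lambda>b. ?F x a y b)" for x y a b
    by (rule additiveI, simp add: killing_add_left killing_add_right \<sigma>_simps algebra_simps om_lin d_lin)+
  have bal: "?F (c *s x) a y b = ?F x (\<sigma> c * a) y b" "?F x a (c *s y) b = ?F x a y (\<sigma> c * b)"
    for c x y a b
    by (simp_all add: killing_scale_left killing_scale_right \<sigma>_simps ac_simps d_mult d_const om_lin om_om)
  note props = tensor_bilin_props[of ?F, OF add bal, folded W_def]
  show "additive (W X)" "additive (\<lambda>X. W X Y)" "W (ten x a) (ten y b) = om (\<sigma> (\<kappa> x y) * a) (d b)"
    by (rule props)+
qed

lemmas W_lin = additive.add[OF W_additive(1)] additive.zero[OF W_additive(1)]
  additive.diff[OF W_additive(1)] additive.sum[OF W_additive(1)]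
  additive.add[OF W_additive(2)] additive.zero[OF W_additive(2)]
  additive.diff[OF W_additive(2)] additive.sum[OF W_additive(2)]

lemma W_sc_left: "W (sc a X) Y = om a (W X Y)"
  by (induction X Y rule: tensor_induct2)
    (simp_all add: sc_ten sc_lin W_lin W_ten om_lin om_om ac_simps)

lemma W_sc_right: "W X (sc a Y) = om a (W X Y) + om (K X Y) (d a)"
  by (induction X Y rule: tensor_induct2)
    (simp_all add: sc_ten sc_lin W_lin W_ten K_lin K_ten om_lin om_om d_mult ac_simps)

lemma W_bracket: "W X (lbr Y Z) = W (lbr Z X) Y + W (lbr X Y) Z"
proof (induction X Y Z rule: tensor_induct3)
  case (pure x a y b z c)
  have "\<kappa> (br z x) y = \<kappa> x (br y z)" "\<kappa> (br x y) z = \<kappa> x (br y z)"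
    using killing_invariant[of x y z] killing_invariant[of z x y] killing_sym[of z] by simp_all
  then show ?case by (simp add: lbr_ten W_ten d_mult om_lin om_om ac_simps)
qed (simp_all add: lbr_lin W_lin ac_simps)

lemma cl_W_swap: "cl (W Y X) = - cl (W X Y)"
proof (induction X Y rule: tensor_induct2)
  case (pure x a y b)
  interpret Q: vector_space sQ by (rule vector_space_sQ)
  have "cl (om (\<sigma> (\<kappa> x y) * a) (d b)) = sQ (\<kappa> x y) (w a b)" for a b
    by (simp add: om_om[symmetric] cl_scale w_def)
  then show ?case
    by (simp add: W_ten killing_sym[of y x] w_swap[of b a])
qed (simp_all add: W_lin cl_lin)

abbreviation sE :: "'k \<Rightarrow> 't \<times> 'q \<Rightarrow> 't \<times> 'q" where
  "sE c \<equiv> map_prod (sT c) (sQ c)"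

abbreviation brE :: "'t \<times> 'q \<Rightarrow> 't \<times> 'q \<Rightarrow> 't \<times> 'q" where
  "brE \<equiv> uce_bracket scale br ten sQ w"

lemma brE_eq: "brE U V = (lbr (fst U) (fst V), cl (W (fst U) (fst V)))"
proof -
  have "tensor_bilin ten (\<lambda>x a y b. sQ (\<kappa> x y) (w a b)) = (\<lambda>X Y. cl (W X Y))"
  proof (rule tensor_bilin_eqI)
    show "additive (\<lambda>Y. cl (W X Y))" "additive (\<lambda>X. cl (W X Y))" for X Y
      by (auto intro!: additiveI simp: W_lin cl_lin)
    show "cl (W (ten x a) (ten y b)) = sQ (\<kappa> x y) (w a b)" for x a y b
      by (simp add: W_ten w_def om_om[symmetric] cl_scale)
  qed
  then show ?thesis by (simp add: uce_bracket_def split: prod.split)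
qed

lemma sT_vector_space: "vector_space sT"
  by unfold_locales (simp_all add: unital_moduleD[OF module_T])

lemma sE_vector_space: "vector_space sE"
proof -
  interpret Q: vector_space sQ by (rule vector_space_sQ)
  interpret T: vector_space sT by (rule sT_vector_space)
  show ?thesis
    by unfold_locales (auto simp: Q.scale_right_distrib T.scale_right_distrib
        Q.scale_left_distrib T.scale_left_distrib)
qed

lemma lie_algebra_T: "lie_algebra_on sT lbr UNIV"
  unfolding lie_algebra_on_def
  using sT_vector_space module.subspace_UNIV[OF sT_vector_space[folded module_iff_vector_space]]
  by (auto simp: lbr_lin lbr_self lbr_jacobi sT_eq_sc lbr_sc)

lemma cl_W_scale: "cl (W (sT c X) Y) = sQ c (cl (W X Y))" "cl (W X (sT c Y)) = sQ c (cl (W X Y))"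
  by (simp_all add: sT_eq_sc W_sc_left W_sc_right d_const om_lin cl_scale)

text \<open>Modulo exact differentials the cocycle is antisymmetric by \<open>d (a b) = a db + b da\<close>, and then
  \<open>W_bracket\<close> is the cocycle identity.\<close>

lemma lie_algebra_E: "lie_algebra_on sE brE UNIV"
proof -
  have "cl (W X X) = 0" for X
  proof -
    interpret Q: vector_space sQ by (rule vector_space_sQ)
    have "cl (W X X) + cl (W X X) = 0" using cl_W_swap[of X X] by (metis add.right_inverse)
    then have "sQ 2 (cl (W X X)) = 0" using Q.scale_left_distrib[of 1 1] by simp
    then show ?thesis by simp
  qed
  moreover have "cl (W X (lbr Y Z)) + cl (W Y (lbr Z X)) + cl (W Z (lbr X Y)) = 0" for X Y Z
    using cl_W_swap[of Y "lbr Z X"] cl_W_swap[of Z "lbr X Y"] by (simp add: W_bracket[of X Y Z] cl_lin)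
  ultimately show ?thesis
    unfolding lie_algebra_on_def
    using sE_vector_space module.subspace_UNIV[OF sE_vector_space[folded module_iff_vector_space]]
    using lie_algebra_T
    by (auto simp: brE_eq lbr_lin W_lin cl_lin cl_W_scale lie_algebra_on_def zero_prod_def)
qed

text \<open>The extension is perfect: the Casimir identity produces \<open>x \<otimes> a\<close>, and \<open>a db\<close> is the defect
  between \<open>[x \<otimes> a, y \<otimes> b]\<close> and \<open>[x \<otimes> ab, y \<otimes> 1]\<close>.\<close>

lemma perfect_induct [case_names bracket add minus]:
  assumes br: "\<And>U V. P (brE U V)" and add: "\<And>U V. P U \<Longrightarrow> P V \<Longrightarrow> P (U + V)"
    and minus: "\<And>U. P U \<Longrightarrow> P (- U)"
  shows "P U"
proof -
  have "P 0" using br[of 0 0] by (simp add: brE_eq lbr_lin W_lin cl_lin zero_prod_def)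
  have sum: "P (sum f A)" if "finite A" "\<And>i. i \<in> A \<Longrightarrow> P (f i)" for f :: "'g \<Rightarrow> _" and A
    using that by (induction A) (auto intro: add \<open>P 0\<close>)
  have T: "P (X, 0)" for X
  proof (induction X rule: tensor_induct)
    case (pure x a)
    have "(ten x a, 0) = (\<Sum>b\<in>Basis. brE (ten (br x b) a, 0) (E' b, 0))"
    proof -
      have "(\<Sum>b\<in>Basis. brE (ten (br x b) a, 0) (E' b, 0)) = (\<Sum>b\<in>Basis. (ten (br (br x b) (dual b)) a, 0))"
        by (simp add: brE_eq lbr_ten W_ten d_one om_lin cl_lin)
      also have "\<dots> = (\<Sum>b\<in>Basis. ten (br (br x b) (dual b)) a, 0)"
        by (simp add: prod_eq_iff fst_sum snd_sum)
      finally show ?thesis by (simp add: ten_sum_left[symmetric] casimir_identity)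
    qed
    then show ?case by (simp only: sum[OF finite_Basis br])
  next
    case (add X Y)
    then show ?case using assms(2)[of "(X, 0)" "(Y, 0)"] by simp
  qed
  have Q: "P (0, z)" for z
  proof (induction z rule: quotient_induct)
    case (generator a b)
    obtain x y where xy: "\<kappa> x y \<noteq> 0" using killing_nonzero by blast
    let ?a = "\<sigma> (inverse (\<kappa> x y)) * a"
    have "\<sigma> (\<kappa> x y) * ?a = a"
      using xy by (simp add: mult.assoc[symmetric] \<sigma>_simps flip: \<sigma>_simps(3))
    then have "(0, w a b) = brE (ten x ?a, 0) (ten y b, 0) + - brE (ten x (?a * b), 0) (ten y 1, 0)"
      by (simp add: brE_eq lbr_ten W_ten d_one om_lin cl_lin w_def)
    then show ?case using add[OF br minus[OF br]] by (simp only:)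
  next
    case (add y z)
    then show ?case using assms(2)[of "(0, y)" "(0, z)"] by simp
  qed
  show ?thesis using add[OF T Q, of "fst U" "snd U"] by simp
qed

text \<open>The bracket of two elements depends on their projections only, and brackets generate.\<close>

lemma automorphism_determined_by_projection:
  assumes "\<psi> \<in> lie_aut sE brE" "\<psi>' \<in> lie_aut sE brE" "fst \<circ> \<psi> = fst \<circ> \<psi>'"
  shows "\<psi> = \<psi>'"
proof
  note lin = assms(1,2)[THEN lie_autD(2)]
  note lin = lin[THEN additive.add] lin[THEN additive.minus]
  have fst: "fst (\<psi> V) = fst (\<psi>' V)" for V using assms(3) by (metis comp_apply)
  fix U show "\<psi> U = \<psi>' U"
  proof (induction U rule: perfect_induct)
    case (bracket U V)
    have "\<psi> (brE U V) = brE (\<psi> U) (\<psi> V)" "\<psi>' (brE U V) = brE (\<psi>' U) (\<psi>' V)"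
      by (rule lie_autD(4)[OF assms(1)], rule lie_autD(4)[OF assms(2)])
    then show ?case by (simp add: brE_eq fst)
  qed (simp_all add: lin)
qed

text \<open>An \<open>'s\<close>-linear automorphism preserves the Killing form, so the derivations \<open>\<nabla>\<close> and
  \<open>\<theta>\<inverse> \<nabla> \<theta>\<close> differ by an \<open>'s\<close>-linear derivation, which is inner. Hence the two cocycles differ
  by a coboundary.\<close>

lemma W_automorphism:
  assumes \<theta>: "\<theta> \<in> lie_aut sc lbr"
  obtains \<Phi> where "additive \<Phi>" "\<And>a X. \<Phi> (sc a X) = om a (\<Phi> X)"
    "\<And>X Y. W (\<theta> X) (\<theta> Y) = W X Y + \<Phi> (lbr X Y)"
proof -
  have add: "additive \<theta>" and lin: "\<And>a X. \<theta> (sc a X) = sc a (\<theta> X)"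
    and hom: "\<And>X Y. \<theta> (lbr X Y) = lbr (\<theta> X) (\<theta> Y)"
    by (rule lie_autD[OF \<theta>])+
  define \<beta> where "\<beta> X Y = W (\<theta> X) (\<theta> Y) - W X Y" for X Y
  have \<beta>: "additive (\<beta> X)" "additive (\<lambda>X. \<beta> X Y)" for X Y
    by (auto intro!: additiveI simp: \<beta>_def additive.add[OF add] W_lin)
  have bil: "\<beta> (sc a X) Y = om a (\<beta> X Y)" "\<beta> X (sc a Y) = om a (\<beta> X Y)" for a X Y
    by (simp_all add: \<beta>_def lin W_sc_left W_sc_right K_automorphism[OF \<theta>] om_lin)
  have der: "\<beta> X (lbr Y Z) = \<beta> (lbr Z X) Y + \<beta> (lbr X Y) Z" for X Y Z
    by (simp add: \<beta>_def hom W_bracket)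
  define \<Phi> where "\<Phi> U = (\<Sum>b\<in>Basis. \<beta> (E' b) (lbr (- U) (E b)))" for U
  have "additive \<Phi>"
    by (rule additiveI) (simp add: \<Phi>_def lbr_lin additive.diff[OF \<beta>(1)] sum.distrib[symmetric]
        sum_subtractf[symmetric] additive.minus[OF \<beta>(1)])
  moreover have "\<Phi> (sc a X) = om a (\<Phi> X)" for a X
    by (simp add: \<Phi>_def lbr_lin lbr_sc bil om_lin additive.minus[OF \<beta>(1)] additive.minus[OF om_additive(1)])
  moreover have "W (\<theta> X) (\<theta> Y) = W X Y + \<Phi> (lbr X Y)" for X Y
  proof -
    have "\<beta> X Y = \<Phi> (lbr X Y)"
      using derivation_form_factors_through_bracket[OF \<beta> _ der, of X Y] lbr_swap[of X Y]
      by (simp add: bil \<Phi>_def)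
    then show ?thesis by (simp add: \<beta>_def algebra_simps)
  qed
  ultimately show ?thesis by (rule that)
qed

text \<open>The lift adds to the central component the class of \<open>\<Phi>\<close>, which vanishes on the centre; this is
  why central elements are fixed.\<close>

lemma lie_lift_props:
  assumes \<theta>: "\<theta> \<in> lie_aut sc lbr"
  shows "lie_lift sE brE \<theta> \<in> lie_aut sE brE" "fst (lie_lift sE brE \<theta> U) = \<theta> (fst U)"
    "lie_lift sE brE \<theta> (0, z) = (0, z)"
proof -
  obtain \<Phi> where \<Phi>: "additive \<Phi>" "\<And>a X. \<Phi> (sc a X) = om a (\<Phi> X)"
    "\<And>X Y. W (\<theta> X) (\<theta> Y) = W X Y + \<Phi> (lbr X Y)"
    by (rule W_automorphism[OF \<theta>]) blast
  have bij: "bij \<theta>" and add: "additive \<theta>" and lin: "\<And>a X. \<theta> (sc a X) = sc a (\<theta> X)"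
    and hom: "\<And>X Y. \<theta> (lbr X Y) = lbr (\<theta> X) (\<theta> Y)"
    by (rule lie_autD[OF \<theta>])+
  define \<psi> where "\<psi> U = (\<theta> (fst U), snd U + cl (\<Phi> (fst U)))" for U
  have "bij \<psi>"
  proof (rule bijI)
    show "inj \<psi>"
    proof (rule injI)
      fix U V assume eq: "\<psi> U = \<psi> V"
      then have "fst U = fst V" using bij by (simp add: \<psi>_def bij_is_inj inj_eq)
      then show "U = V" using eq by (simp add: \<psi>_def prod_eq_iff)
    qed
    show "surj \<psi>"
      unfolding surj_def
    proof (intro allI exI)
      fix V :: "'t \<times> 'q"
      let ?X = "inv_into UNIV \<theta> (fst V)"
      show "V = \<psi> (?X, snd V - cl (\<Phi> ?X))"
        using bij by (simp add: \<psi>_def bij_is_surj surj_f_inv_f)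
    qed
  qed
  moreover have "\<psi> (sE c U) = sE c (\<psi> U)" for c U
  proof -
    interpret Q: vector_space sQ by (rule vector_space_sQ)
    show ?thesis
      by (simp add: \<psi>_def prod_eq_iff sT_eq_sc lin \<Phi> cl_scale Q.scale_right_distrib)
  qed
  ultimately have \<psi>: "\<psi> \<in> lie_aut sE brE"
    by (intro lie_autI)
      (simp_all add: \<psi>_def brE_eq hom \<Phi> cl_lin additive.add[OF add] additive.add[OF \<Phi>(1)])
  have fst\<psi>: "fst \<circ> \<psi> = \<theta> \<circ> fst" by (simp add: \<psi>_def fun_eq_iff)
  have "lie_lift sE brE \<theta> = \<psi>"
    unfolding lie_lift_def
    by (rule the_equality) (use \<psi> fst\<psi> in \<open>auto intro: automorphism_determined_by_projection\<close>)
  then show "lie_lift sE brE \<theta> \<in> lie_aut sE brE" "fst (lie_lift sE brE \<theta> U) = \<theta> (fst U)"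
    "lie_lift sE brE \<theta> (0, z) = (0, z)"
    using \<psi> fst\<psi> by (simp_all add: \<psi>_def additive.zero[OF add] additive.zero[OF \<Phi>(1)] cl_lin)
qed

end

section \<open>Galois extensions and their differentials\<close>

locale galois =
  fixes \<iota> :: "'r::{comm_ring,comm_monoid_mult} \<Rightarrow> 's::{comm_ring,comm_monoid_mult}"
    and G :: "('p, 'e) monoid_scheme" and act :: "'p \<Rightarrow> 's \<Rightarrow> 's"
  assumes galois: "galois_extension \<iota> G act"
begin

abbreviation C where "C \<equiv> carrier G"

lemma \<iota>: "unital_ring_hom \<iota>" and inj_\<iota>: "inj \<iota>" and group: "group G" and fin: "finite C"
  and act: "g \<in> C \<Longrightarrow> unital_ring_hom (act g)" and act_\<iota>: "g \<in> C \<Longrightarrow> act g (\<iota> r) = \<iota> r"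
  and act_one: "act \<one>\<^bsub>G\<^esub> s = s"
  and act_mult: "g \<in> C \<Longrightarrow> h \<in> C \<Longrightarrow> act (g \<otimes>\<^bsub>G\<^esub> h) s = act g (act h s)"
  and fixed: "(\<And>g. g \<in> C \<Longrightarrow> act g s = s) \<Longrightarrow> s \<in> range \<iota>"
proof -
  note gal = galois[unfolded galois_extension_def]
  show "unital_ring_hom \<iota>" "inj \<iota>" "group G" "finite C" using gal by blast+
  show "unital_ring_hom (act g)" "act g (\<iota> r) = \<iota> r" if "g \<in> C" using gal that by blast+
  have "act \<one>\<^bsub>G\<^esub> = id" using gal by blast
  then show "act \<one>\<^bsub>G\<^esub> s = s" by simp
  have "act (g \<otimes>\<^bsub>G\<^esub> h) = act g \<circ> act h" if "g \<in> C" "h \<in> C" using gal that by blast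
  then show "act (g \<otimes>\<^bsub>G\<^esub> h) s = act g (act h s)" if "g \<in> C" "h \<in> C" using that by simp
  have "{s. \<forall>g\<in>C. act g s = s} = range \<iota>" using gal by blast
  then show "s \<in> range \<iota>" if "\<And>g. g \<in> C \<Longrightarrow> act g s = s" using that by blast
qed

sublocale group G by (rule group)

lemmas \<iota>_simps = unital_ring_homD(1-3)[OF \<iota>] additive.zero[OF unital_ring_homD(4)[OF \<iota>]]
  additive.sum[OF unital_ring_homD(4)[OF \<iota>]]
lemmas act_simps = unital_ring_homD(1-3)[OF act] additive.zero[OF unital_ring_homD(4)[OF act]]
  additive.sum[OF unital_ring_homD(4)[OF act]]

lemma sum_C_translate:
  assumes "h \<in> C" shows "(\<Sum>g\<in>C. f (h \<otimes>\<^bsub>G\<^esub> g)) = sum f C"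
proof (rule sum.reindex_bij_betw)
  show "bij_betw (\<lambda>g. h \<otimes>\<^bsub>G\<^esub> g) C C"
    unfolding bij_betw_def using inj_on_cmult[OF assms] surj_const_mult[OF assms] by auto
qed

definition can :: "('s \<times> 's \<Rightarrow>\<^sub>0 'r) \<Rightarrow> 'p \<Rightarrow> 's" where
  "can p g = free_ext (\<lambda>(a, b) r. \<iota> r * (a * act g b)) p"

lemma can_surj: "\<exists>p. \<forall>g\<in>C. can p g = f g"
  and can_inj: "(\<And>g. g \<in> C \<Longrightarrow> can p g = 0)
    \<Longrightarrow> p \<in> group_closure (tensor_relations (\<lambda>r s. \<iota> r * s) (\<lambda>r s. \<iota> r * s))"
proof -
  have "(\<lambda>x c. \<iota> c * (case x of (a, b) \<Rightarrow> a * act g b)) = (\<lambda>(a, b) r. \<iota> r * (a * act g b))" for g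
    by (auto simp: fun_eq_iff)
  then have can: "lin_ext (\<lambda>r s. \<iota> r * s) (\<lambda>(a, b). a * act g b) p = can p g" for p g
    by (simp add: lin_ext_eq_free_ext can_def)
  note gal = galois[unfolded galois_extension_def Let_def can]
  have "\<forall>f. \<exists>p. \<forall>g\<in>C. can p g = f g" using gal by (elim conjE)
  then show "\<exists>p. \<forall>g\<in>C. can p g = f g" by (rule spec)
  have "\<forall>p. (\<forall>g\<in>C. can p g = 0)
      \<longrightarrow> p \<in> group_closure (tensor_relations (\<lambda>r s. \<iota> r * s) (\<lambda>r s. \<iota> r * s))"
    using gal by (elim conjE)
  then show "(\<And>g. g \<in> C \<Longrightarrow> can p g = 0)
      \<Longrightarrow> p \<in> group_closure (tensor_relations (\<lambda>r s. \<iota> r * s) (\<lambda>r s. \<iota> r * s))"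
    by blast
qed

text \<open>The Galois coordinates are the components of the separability idempotent
  \<open>\<Sum> a i \<otimes> b i\<close>, the preimage of the function that is \<open>1\<close> at the unit and \<open>0\<close> elsewhere.\<close>

definition galois_coordinates :: "('s \<times> 's) set \<Rightarrow> ('s \<times> 's \<Rightarrow> 's) \<Rightarrow> ('s \<times> 's \<Rightarrow> 's) \<Rightarrow> bool" where
  "galois_coordinates I a b \<longleftrightarrow> finite I \<and>
     (\<forall>g\<in>C. (\<Sum>i\<in>I. a i * act g (b i)) = (if g = \<one>\<^bsub>G\<^esub> then 1 else 0))"

lemma galois_coordinates_exist: "\<exists>I a b. galois_coordinates I a b"
proof -
  obtain p where p: "\<forall>g\<in>C. can p g = (if g = \<one>\<^bsub>G\<^esub> then 1 else 0)"
    using can_surj[of "\<lambda>g. if g = \<one>\<^bsub>G\<^esub> then 1 else 0"] ..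
  let ?I = "Poly_Mapping.keys p"
  have "can p g = (\<Sum>i\<in>?I. \<iota> (Poly_Mapping.lookup p i) * fst i * act g (snd i))" for g
    by (simp add: can_def free_ext_def case_prod_unfold mult.assoc)
  then have "galois_coordinates ?I (\<lambda>i. \<iota> (Poly_Mapping.lookup p i) * fst i) snd"
    using p by (simp add: galois_coordinates_def)
  then show ?thesis by blast
qed

text \<open>The idempotent satisfies \<open>(s \<otimes> 1) e = (1 \<otimes> s) e\<close>, since both sides have the same image in
  the product. This is used for maps that are balanced only modulo a subgroup \<open>N\<close>.\<close>

lemma separability_idempotent:
  assumes I: "galois_coordinates I a b"
    and B: "\<And>u. additive (B u)" "\<And>v. additive (\<lambda>u. B u v)"
    and N: "0 \<in> N" "\<And>v w. v \<in> N \<Longrightarrow> w \<in> N \<Longrightarrow> v - w \<in> N"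
    and bal: "\<And>r u v. B (\<iota> r * u) v - B u (\<iota> r * v) \<in> N"
  shows "(\<Sum>i\<in>I. B (a i * s) (b i)) - (\<Sum>i\<in>I. B (a i) (s * b i)) \<in> N"
proof -
  let ?p = "\<Sum>i\<in>I. Poly_Mapping.single (a i * s, b i) 1 - Poly_Mapping.single (a i, s * b i) (1::'r)"
  have M: "unital_module (\<lambda>r s. \<iota> r * s)"
    by (simp add: unital_module_def \<iota>_simps algebra_simps)
  have "can ?p g = 0" if g: "g \<in> C" for g
  proof -
    have add: "additive (case xy of (a, b) \<Rightarrow> \<lambda>r. \<iota> r * (a * act g b))" for xy
      by (cases xy) (auto intro: additiveI simp: \<iota>_simps distrib_right)
    have "can ?p g = (\<Sum>i\<in>I. a i * s * act g (b i) - a i * (act g s * act g (b i)))"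
      unfolding can_def additive.sum[OF additive_free_ext[OF add]]
      by (simp add: additive.diff[OF additive_free_ext[OF add]] free_ext_single[OF add] \<iota>_simps act_simps[OF g])
    also have "\<dots> = (s - act g s) * (\<Sum>i\<in>I. a i * act g (b i))"
      by (simp add: sum_distrib_left algebra_simps)
    also have "\<dots> = 0" using I g by (simp add: galois_coordinates_def act_one)
    finally show ?thesis .
  qed
  from free_ext_tensor_relations[OF M B N bal can_inj[OF this]]
  have *: "free_ext (\<lambda>(x, y) c. B (\<iota> c * x) y) ?p \<in> N" .
  have add: "additive (case xy of (x, y) \<Rightarrow> \<lambda>c. B (\<iota> c * x) y)" for xy
    by (cases xy) (auto intro: additiveI simp: \<iota>_simps distrib_right additive.add[OF B(2)])
  have "free_ext (\<lambda>(x, y) c. B (\<iota> c * x) y) ?p = (\<Sum>i\<in>I. B (a i * s) (b i) - B (a i) (s * b i))"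
    unfolding additive.sum[OF additive_free_ext[OF add]]
    by (simp add: additive.diff[OF additive_free_ext[OF add]] free_ext_single[OF add] \<iota>_simps)
  then show ?thesis using * by (simp add: sum_subtractf)
qed

definition tr :: "'s \<Rightarrow> 'r" where
  "tr s = inv_into UNIV \<iota> (\<Sum>g\<in>C. act g s)"

lemma \<iota>_tr: "\<iota> (tr s) = (\<Sum>g\<in>C. act g s)"
proof -
  have "(\<Sum>g\<in>C. act g s) \<in> range \<iota>"
  proof (rule fixed)
    fix h assume h: "h \<in> C"
    have "act h (\<Sum>g\<in>C. act g s) = (\<Sum>g\<in>C. act (h \<otimes>\<^bsub>G\<^esub> g) s)"
      by (simp add: act_simps[OF h] act_mult h cong: sum.cong)
    then show "act h (\<Sum>g\<in>C. act g s) = (\<Sum>g\<in>C. act g s)" using sum_C_translate[OF h, of "\<lambda>g. act g s"] by simp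
  qed
  then show ?thesis unfolding tr_def by (rule f_inv_into_f)
qed

lemma tr_eqI: "(\<Sum>g\<in>C. act g s) = \<iota> r \<Longrightarrow> tr s = r"
  using \<iota>_tr[of s] inj_\<iota> by (simp add: inj_eq)

lemma tr_additive: "additive tr"
proof (rule additiveI, rule tr_eqI)
  fix s t
  have "(\<Sum>g\<in>C. act g (s + t)) = (\<Sum>g\<in>C. act g s + act g t)"
    by (intro sum.cong refl) (simp add: act_simps)
  then show "(\<Sum>g\<in>C. act g (s + t)) = \<iota> (tr s + tr t)"
    by (simp add: \<iota>_simps(2) \<iota>_tr sum.distrib)
qed

lemma tr_mult: "tr (\<iota> r * s) = r * tr s"
proof (rule tr_eqI)
  have "(\<Sum>g\<in>C. act g (\<iota> r * s)) = (\<Sum>g\<in>C. \<iota> r * act g s)"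
    by (intro sum.cong refl) (simp add: act_simps act_\<iota>)
  then show "(\<Sum>g\<in>C. act g (\<iota> r * s)) = \<iota> (r * tr s)"
    by (simp add: \<iota>_simps(3) \<iota>_tr sum_distrib_left)
qed

lemma tr_\<iota>: "tr (\<iota> r) = (\<Sum>g\<in>C. r)"
  unfolding tr_def
  by (rule inv_into_f_eq[OF inj_\<iota>]) (auto simp: \<iota>_simps(5) act_\<iota> intro!: sum.cong)

lemmas tr_lin = additive.add[OF tr_additive] additive.zero[OF tr_additive]
  additive.diff[OF tr_additive] additive.sum[OF tr_additive]

text \<open>So \<open>'s\<close> is finitely generated projective over \<open>'r\<close>, with dual basis \<open>tr (b i \<cdot>)\<close>.\<close>

lemma trace_expansion:
  assumes I: "galois_coordinates I a b"
  shows "(\<Sum>i\<in>I. a i * \<iota> (tr (b i * s))) = s"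
proof -
  have "(\<Sum>i\<in>I. a i * \<iota> (tr (b i * s))) = (\<Sum>i\<in>I. \<Sum>g\<in>C. act g s * (a i * act g (b i)))"
    by (simp add: \<iota>_tr act_simps sum_distrib_left ac_simps cong: sum.cong)
  also have "\<dots> = (\<Sum>g\<in>C. act g s * (\<Sum>i\<in>I. a i * act g (b i)))"
    by (subst sum.swap) (simp add: sum_distrib_left)
  also have "\<dots> = (\<Sum>g\<in>C. if g = \<one>\<^bsub>G\<^esub> then s else 0)"
    using I by (intro sum.cong refl) (simp add: galois_coordinates_def act_one)
  also have "\<dots> = s" using fin by simp
  finally show ?thesis .
qed

lemma galois_coordinates_sum_one:
  assumes "galois_coordinates I a b" shows "(\<Sum>i\<in>I. a i * b i) = 1"
proof -
  have "(\<Sum>i\<in>I. a i * act \<one>\<^bsub>G\<^esub> (b i)) = (if \<one>\<^bsub>G\<^esub> = \<one>\<^bsub>G\<^esub> then 1 else 0)"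
    using assms one_closed unfolding galois_coordinates_def by blast
  then show ?thesis by (simp add: act_one)
qed

end

lemma diff_class_map_scale:
  assumes A: "kaehler_quotient \<eta> om d sQ cl" and B: "kaehler_quotient \<eta>' om' d' sQ' cl'"
    and f: "unital_ring_hom f" "\<And>c. f (\<eta> c) = \<eta>' c"
  defines "w \<equiv> kaehler_quotient.w om d cl" and "w' \<equiv> kaehler_quotient.w om' d' cl'"
  shows "diff_class_map w w' f (sQ c z) = sQ' c (diff_class_map w w' f z)"
proof -
  interpret A: kaehler_quotient \<eta> om d sQ cl by fact
  interpret B: kaehler_quotient \<eta>' om' d' sQ' cl' by fact
  interpret vA: vector_space sQ by (rule A.vector_space_sQ)
  interpret vB: vector_space sQ' by (rule B.vector_space_sQ)
  note props = diff_class_map_props[OF A B f]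
  have A_scale: "sQ c (A.w a b) = A.w (\<eta> c * a) b" for a b
    by (simp add: A.w_def A.om_om[symmetric] A.cl_scale)
  have B_scale: "sQ' c (B.w a b) = B.w (\<eta>' c * a) b" for a b
    by (simp add: B.w_def B.om_om[symmetric] B.cl_scale)
  have "diff_class_map A.w B.w f (sQ c z) = sQ' c (diff_class_map A.w B.w f z)"
  proof (induction z rule: A.quotient_induct)
    case (generator a b)
    show ?case by (simp add: A_scale B_scale props(2) unital_ring_homD(3)[OF f(1)] f(2))
  next
    case (add y z)
    then show ?case
      by (simp add: vA.scale_right_distrib vB.scale_right_distrib additive.add[OF props(1)])
  qed
  then show ?thesis by (simp add: w_def w'_def)
qed

locale galois_differentials =
  galois \<iota> G act + R: kaehler_quotient \<eta> omR dR sQR clR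
    + S: kaehler_quotient "\<lambda>c. \<iota> (\<eta> c)" omS dS sQS clS
  for \<iota> :: "'r::{comm_ring,comm_monoid_mult} \<Rightarrow> 's::{comm_ring,comm_monoid_mult}"
    and G :: "('p, 'e) monoid_scheme" and act :: "'p \<Rightarrow> 's \<Rightarrow> 's"
    and \<eta> :: "'k::field_char_0 \<Rightarrow> 'r"
    and omR :: "'r \<Rightarrow> 'omr::ab_group_add \<Rightarrow> 'omr" and dR :: "'r \<Rightarrow> 'omr"
    and sQR :: "'k \<Rightarrow> 'qr::ab_group_add \<Rightarrow> 'qr" and clR :: "'omr \<Rightarrow> 'qr"
    and omS :: "'s \<Rightarrow> 'oms::ab_group_add \<Rightarrow> 'oms" and dS :: "'s \<Rightarrow> 'oms"
    and sQS :: "'k \<Rightarrow> 'qs::ab_group_add \<Rightarrow> 'qs" and clS :: "'oms \<Rightarrow> 'qs" +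
  assumes \<eta>: "unital_ring_hom \<eta>"
begin

text \<open>A Galois extension is unramified: modulo the span of the \<open>d (\<iota> r)\<close> the map \<open>d\<close> is
  \<open>'r\<close>-linear, and the separability idempotent kills linear derivations.\<close>

lemma differentials_generated_by_base [case_names generator add]:
  assumes gen: "\<And>s r. P (omS s (dS (\<iota> r)))" and add: "\<And>v w. P v \<Longrightarrow> P w \<Longrightarrow> P (v + w)"
  shows "P v"
proof -
  define N where "N = {v. \<forall>s. P (omS s v)}"
  have om_minus: "omS s (- v) = omS (- s) v" for s v
    by (simp add: additive.minus[OF S.om_additive(1)] additive.minus[OF S.om_additive(2)])
  have N0: "0 \<in> N" unfolding N_def using gen[of 0] by (simp add: S.om_lin)
  have Nadd: "v + w \<in> N" if "v \<in> N" "w \<in> N" for v w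
    using that add by (simp add: N_def S.om_lin)
  have Nminus: "- v \<in> N" if "v \<in> N" for v using that by (simp add: N_def om_minus)
  have Ndiff: "v - w \<in> N" if "v \<in> N" "w \<in> N" for v w
    using Nadd[OF that(1) Nminus[OF that(2)]] by simp
  have Ngen: "omS s (dS (\<iota> r)) \<in> N" for s r by (simp add: N_def S.om_om gen)
  obtain I a b where I: "galois_coordinates I a b" using galois_coordinates_exist by blast
  have "dS t \<in> N" for t
  proof -
    have B: "additive (\<lambda>v. omS u (dS v))" "additive (\<lambda>u. omS u (dS v))" for u v
      by (auto intro!: additiveI simp: S.om_lin S.d_lin)
    have "omS (\<iota> r * u) (dS v) - omS u (dS (\<iota> r * v)) \<in> N" for r u v
      using Nminus[OF Ngen, of "u * v" r] by (simp add: S.d_mult S.om_lin S.om_om ac_simps)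
    from separability_idempotent[OF I B N0 Ndiff this]
    have "(\<Sum>i\<in>I. omS (a i * t) (dS (b i))) - (\<Sum>i\<in>I. omS (a i) (dS (t * b i))) \<in> N" .
    also have "(\<Sum>i\<in>I. omS (a i * t) (dS (b i))) - (\<Sum>i\<in>I. omS (a i) (dS (t * b i)))
        = - omS (\<Sum>i\<in>I. a i * b i) (dS t)"
      by (simp add: S.d_mult S.om_lin S.om_om sum.distrib)
    finally have "- dS t \<in> N" by (simp add: galois_coordinates_sum_one[OF I] S.om_one)
    from Nminus[OF this] show ?thesis by simp
  qed
  then have P: "P (omS s (dS t))" for s t by (simp add: N_def)
  show ?thesis by (induction v rule: S.differential_induct) (auto intro: P add)
qed

text \<open>The trace on differentials. \<open>T0 s t\<close> is the trace of \<open>s \<nabla> t\<close> for the connection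
  \<open>\<nabla> t = \<Sum> a j \<otimes> d (tr (b j t))\<close> on \<open>'s \<otimes> \<Omega>\<close>; it fails to be a derivation in \<open>t\<close> by a
  two-cocycle, and contracting with the separability idempotent corrects this.\<close>

lemma trace_differentials_exists:
  obtains Tr where "additive Tr" "\<And>s r. Tr (omS s (dS (\<iota> r))) = omR (tr s) (dR r)"
proof -
  obtain I a b where I: "galois_coordinates I a b" using galois_coordinates_exist by blast
  define T0 where "T0 s t = (\<Sum>j\<in>I. omR (tr (s * a j)) (dR (tr (b j * t))))" for s t
  have T0: "additive (T0 s)" "additive (\<lambda>s. T0 s t)" for s t
    by (rule additiveI, simp only: T0_def distrib_left distrib_right tr_lin(1) R.d_lin(1)
        R.om_lin(1) R.om_lin(5) sum.distrib)+
  have T0_base: "T0 s (\<iota> r * t) = T0 (\<iota> r * s) t + omR (tr (s * t)) (dR r)" for s t r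
  proof -
    have "tr (b j * (\<iota> r * t)) = r * tr (b j * t)" "tr (\<iota> r * s * a j) = r * tr (s * a j)" for j
      using tr_mult[of r "b j * t"] tr_mult[of r "s * a j"] by (simp_all add: ac_simps)
    then have "T0 s (\<iota> r * t)
        = T0 (\<iota> r * s) t + omR (\<Sum>j\<in>I. tr (s * a j) * tr (b j * t)) (dR r)"
      by (simp add: T0_def R.d_mult R.om_lin R.om_om sum.distrib ac_simps)
    also have "(\<Sum>j\<in>I. tr (s * a j) * tr (b j * t)) = tr (s * (\<Sum>j\<in>I. a j * \<iota> (tr (b j * t))))"
    proof -
      have "tr (s * a j) * tr (b j * t) = tr (s * (a j * \<iota> (tr (b j * t))))" for j
        using tr_mult[of "tr (b j * t)" "s * a j"] by (simp add: ac_simps)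
      then show ?thesis by (simp only: sum_distrib_left tr_lin(4))
    qed
    finally show ?thesis by (simp add: trace_expansion[OF I])
  qed
  define T where "T s t = (\<Sum>i\<in>I. T0 (s * a i) (b i * t) - T0 (s * a i * t) (b i))" for s t
  have T: "additive (T s)" "additive (\<lambda>s. T s t)" for s t
    by (rule additiveI, simp only: T_def distrib_left distrib_right additive.add[OF T0(1)]
        additive.add[OF T0(2)] add_diff_add sum.distrib)+
  have T_base: "T s (\<iota> r) = omR (tr s) (dR r)" for s r
  proof -
    have "T s (\<iota> r) = (\<Sum>i\<in>I. omR (tr (s * (a i * b i))) (dR r))"
      unfolding T_def
    proof (intro sum.cong refl)
      fix i show "T0 (s * a i) (b i * \<iota> r) - T0 (s * a i * \<iota> r) (b i) = omR (tr (s * (a i * b i))) (dR r)"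
        using T0_base[of "s * a i" r "b i"] by (simp add: ac_simps)
    qed
    also have "\<dots> = omR (tr (s * (\<Sum>i\<in>I. a i * b i))) (dR r)"
      by (simp add: sum_distrib_left tr_lin R.om_lin)
    finally show ?thesis by (simp add: galois_coordinates_sum_one[OF I])
  qed
  have leibniz: "T c (s * t) = T (c * s) t + T (c * t) s" for c s t
  proof -
    \<comment> \<open>unlike \<open>T0\<close> the form \<open>B\<close> is balanced, so \<open>s\<close> can be moved across the separability idempotent\<close>
    define B where "B u v = T0 (c * u) (v * t) - T0 (c * u * t) v" for u v
    have B: "additive (B u)" "additive (\<lambda>u. B u v)" for u v
      by (rule additiveI, simp only: B_def distrib_left distrib_right additive.add[OF T0(1)]
          additive.add[OF T0(2)] add_diff_add)+
    have "B (\<iota> r * u) v - B u (\<iota> r * v) \<in> {0}" for r u v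
      using T0_base[of "c * u" r "v * t"] T0_base[of "c * u * t" r v] by (simp add: B_def ac_simps)
    from separability_idempotent[OF I B _ _ this]
    have "(\<Sum>i\<in>I. B (a i * s) (b i)) = (\<Sum>i\<in>I. B (a i) (s * b i))" by simp
    moreover have "T (c * s) t = (\<Sum>i\<in>I. B (a i * s) (b i))"
      by (simp add: T_def B_def ac_simps)
    moreover have "T c (s * t) = (\<Sum>i\<in>I. B (a i) (s * b i)) + T (c * t) s"
      by (simp add: T_def B_def ac_simps flip: sum.distrib)
    ultimately show ?thesis by simp
  qed
  obtain Tr where "additive Tr" "\<And>s t. Tr (omS s (dS t)) = T s t"
    by (rule S.differential_hom_exists[of T, OF T(2) T(1) leibniz])
      (simp_all add: T_base R.d_const R.om_lin)
  then show ?thesis using that T_base by simp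
qed

abbreviation j :: "'qr \<Rightarrow> 'qs" where "j \<equiv> diff_class_map R.w S.w \<iota>"
abbreviation \<rho>Q :: "'p \<Rightarrow> 'qs \<Rightarrow> 'qs" where "\<rho>Q g \<equiv> diff_class_map S.w S.w (act g)"

lemmas j_props = diff_class_map_props[OF R.kaehler_quotient_axioms S.kaehler_quotient_axioms \<iota> refl]
lemmas j_scale = diff_class_map_scale[OF R.kaehler_quotient_axioms S.kaehler_quotient_axioms \<iota> refl]
lemmas \<rho>Q_props =
  diff_class_map_props[OF S.kaehler_quotient_axioms S.kaehler_quotient_axioms act act_\<iota>]
lemmas \<rho>Q_scale =
  diff_class_map_scale[OF S.kaehler_quotient_axioms S.kaehler_quotient_axioms act act_\<iota>]

text \<open>Both identities already hold for differentials, with \<open>J\<close> induced by \<open>\<iota>\<close> in place of \<open>j\<close>. There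
  \<open>Tr J\<close> is multiplication by the order of the group, so \<open>J\<close> is injective, and applying \<open>J\<close> shows
  \<open>Tr (dS t) = dR (tr t)\<close>. Hence the trace descends to the quotients.\<close>

lemma trace_classes_exists:
  obtains \<tau> where "additive \<tau>" "\<And>z. \<tau> (j z) = (\<Sum>g\<in>C. z)" "\<And>z. j (\<tau> z) = (\<Sum>g\<in>C. \<rho>Q g z)"
proof -
  obtain Tr where Tr: "additive Tr" "\<And>s r. Tr (omS s (dS (\<iota> r))) = omR (tr s) (dR r)"
    by (rule trace_differentials_exists) blast
  obtain J where J: "additive J" "\<And>a b. J (omR a (dR b)) = omS (\<iota> a) (dS (\<iota> b))"
    by (rule differential_functorial[OF R.kaehler_axioms S.kaehler_axioms \<iota> refl]) blast
  have "\<exists>h. additive h \<and> (\<forall>a b. h (omS a (dS b)) = omS (act g a) (dS (act g b)))" if "g \<in> C" for g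
    by (rule differential_functorial[OF S.kaehler_axioms S.kaehler_axioms act[OF that] act_\<iota>[OF that]])
      blast
  then have "\<forall>g\<in>C. \<exists>h. additive h \<and> (\<forall>a b. h (omS a (dS b)) = omS (act g a) (dS (act g b)))" by blast
  from bchoice[OF this] obtain A where
    "\<forall>g\<in>C. additive (A g) \<and> (\<forall>a b. A g (omS a (dS b)) = omS (act g a) (dS (act g b)))" ..
  then have A: "\<And>g. g \<in> C \<Longrightarrow> additive (A g)"
    "\<And>g a b. g \<in> C \<Longrightarrow> A g (omS a (dS b)) = omS (act g a) (dS (act g b))" by blast+
  have TrJ: "Tr (J v) = (\<Sum>g\<in>C. v)" for v
    by (induction v rule: R.differential_induct)
      (simp_all add: J(2) Tr(2) tr_\<iota> R.om_lin additive.add[OF J(1)] additive.add[OF Tr(1)] sum.distrib)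
  have JTr: "J (Tr v) = (\<Sum>g\<in>C. A g v)" for v
  proof (induction v rule: differentials_generated_by_base)
    case (generator s r)
    have "(\<Sum>g\<in>C. A g (omS s (dS (\<iota> r)))) = (\<Sum>g\<in>C. omS (act g s) (dS (\<iota> r)))"
      by (intro sum.cong refl) (simp add: A(2) act_\<iota>)
    then show ?case by (simp add: Tr(2) J(2) \<iota>_tr S.om_lin)
  next
    case (add v w)
    have "(\<Sum>g\<in>C. A g (v + w)) = (\<Sum>g\<in>C. A g v + A g w)"
      by (intro sum.cong refl) (simp add: additive.add[OF A(1)])
    then show ?case by (simp add: add additive.add[OF J(1)] additive.add[OF Tr(1)] sum.distrib)
  qed
  have J_inj: "v = 0" if "J v = 0" for v
  proof -
    interpret V: vector_space "\<lambda>c. omR (\<eta> c)"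
      using R.quotient by (simp add: is_quotient_space_def Vector_Spaces.linear_iff)
    have "(\<Sum>g\<in>C. v) = 0" using TrJ[of v] that additive.zero[OF Tr(1)] by simp
    then have "omR (\<eta> (of_nat (card C))) v = 0" by (simp only: V.sum_constant_scale)
    moreover have "card C \<noteq> 0" using fin one_closed by auto
    ultimately show ?thesis unfolding V.scale_eq_0_iff of_nat_eq_0_iff by blast
  qed
  have Trd: "Tr (dS t) = dR (tr t)" for t
  proof -
    have "A g (dS t) = dS (act g t)" if "g \<in> C" for g
      using A(2)[OF that, of 1 t] by (simp add: S.om_one act_simps[OF that])
    then have "J (Tr (dS t)) = dS (\<iota> (tr t))" unfolding JTr \<iota>_tr by (simp add: S.d_lin cong: sum.cong)
    also have "\<dots> = J (dR (tr t))" using J(2)[of 1] by (simp add: R.om_one S.om_one \<iota>_simps)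
    finally have "J (Tr (dS t) - dR (tr t)) = 0" by (simp add: additive.diff[OF J(1)])
    then have "Tr (dS t) - dR (tr t) = 0" by (rule J_inj)
    then show ?thesis by simp
  qed
  have "clR (Tr (dS t)) = 0" for t by (simp add: Trd R.cl_d)
  then obtain \<tau> where \<tau>: "additive \<tau>" "\<And>v. \<tau> (clS v) = clR (Tr v)"
    using S.quotient_hom_exists[of "\<lambda>v. clR (Tr v)", OF additive_compose[OF R.cl_additive Tr(1)]]
    by blast
  have jcl: "j (clR v) = clS (J v)" for v
    by (rule R.differential_eqI[OF additive_compose[OF j_props(1) R.cl_additive]
          additive_compose[OF S.cl_additive J(1)]])
      (simp add: j_props(2) J(2) flip: R.w_def S.w_def)
  have \<rho>cl: "\<rho>Q g (clS v) = clS (A g v)" if "g \<in> C" for g v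
    by (rule S.differential_eqI[OF additive_compose[OF \<rho>Q_props(1)[OF that that] S.cl_additive]
          additive_compose[OF S.cl_additive A(1)[OF that]]])
      (simp add: \<rho>Q_props(2)[OF that that] A(2)[OF that] flip: S.w_def)
  have "\<tau> (j z) = (\<Sum>g\<in>C. z)" for z
  proof -
    obtain v where "z = clR v" using R.cl_surj by (metis surjD)
    then show ?thesis by (simp only: jcl \<tau> TrJ R.cl_lin)
  qed
  moreover have "j (\<tau> z) = (\<Sum>g\<in>C. \<rho>Q g z)" for z
  proof -
    obtain v where z: "z = clS v" using S.cl_surj by (metis surjD)
    have "j (\<tau> z) = (\<Sum>g\<in>C. clS (A g v))" unfolding z by (simp only: jcl \<tau> JTr S.cl_lin)
    also have "\<dots> = (\<Sum>g\<in>C. \<rho>Q g z)" unfolding z by (intro sum.cong refl \<rho>cl[symmetric])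
    finally show ?thesis .
  qed
  ultimately show ?thesis using \<tau>(1) that by blast
qed

lemma \<rho>Q_j: assumes "g \<in> C" shows "\<rho>Q g (j z) = j z"
  by (rule R.quotient_eqI[OF additive_compose[OF \<rho>Q_props(1)[OF assms assms] j_props(1)] j_props(1)])
    (simp add: j_props(2) \<rho>Q_props(2)[OF assms assms] act_\<iota>[OF assms])

text \<open>The inverse is the trace divided by the order of the group.\<close>

lemma invariant_classes_iso:
  "linear_iso_on sQR UNIV sQS {z. \<forall>g\<in>C. \<rho>Q g z = z} j"
proof -
  interpret VR: vector_space sQR by (rule R.vector_space_sQ)
  interpret VS: vector_space sQS by (rule S.vector_space_sQ)
  obtain \<tau> where \<tau>: "additive \<tau>" "\<And>z. \<tau> (j z) = (\<Sum>g\<in>C. z)" "\<And>z. j (\<tau> z) = (\<Sum>g\<in>C. \<rho>Q g z)"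
    by (rule trace_classes_exists) blast
  let ?n = "of_nat (card C) :: 'k"
  have n: "?n \<noteq> 0" using fin one_closed by auto
  have "VS.subspace {z. \<forall>g\<in>C. \<rho>Q g z = z}"
    by (rule VS.subspaceI)
      (simp_all add: additive.zero[OF \<rho>Q_props(1)] additive.add[OF \<rho>Q_props(1)] \<rho>Q_scale)
  moreover have "inj j"
  proof (rule injI)
    fix y z assume "j y = j z"
    then have "sQR ?n y = sQR ?n z" using \<tau>(2)[of y] \<tau>(2)[of z] by (simp only: VR.sum_constant_scale)
    then show "y = z" using n unfolding VR.scale_cancel_left by blast
  qed
  moreover have "range j = {z. \<forall>g\<in>C. \<rho>Q g z = z}"
  proof
    show "{z. \<forall>g\<in>C. \<rho>Q g z = z} \<subseteq> range j"
    proof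
      fix z assume "z \<in> {z. \<forall>g\<in>C. \<rho>Q g z = z}"
      then have "j (\<tau> z) = sQS ?n z" using \<tau>(3)[of z] by (simp add: VS.sum_constant_scale del: sum_constant)
      then have "j (sQR (inverse ?n) (\<tau> z)) = z" using n by (simp add: j_scale)
      then show "z \<in> range j" by (metis rangeI)
    qed
  qed (use \<rho>Q_j in auto)
  ultimately show ?thesis
    unfolding linear_iso_on_def bij_betw_def
    by (auto simp: VR.vector_space_axioms VS.vector_space_axioms j_scale additive.add[OF j_props(1)])
qed

end

section \<open>Twisted forms\<close>

lemma lie_aut_compose:
  assumes "\<theta> \<in> lie_aut s b" "\<phi> \<in> lie_aut s b" shows "\<theta> \<circ> \<phi> \<in> lie_aut s b"
proof (rule lie_autI)
  show "bij (\<theta> \<circ> \<phi>)" using assms by (intro bij_comp lie_autD(1))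
qed (simp_all add: lie_autD(3,4)[OF assms(1)] lie_autD(3,4)[OF assms(2)]
    additive.add[OF lie_autD(2)[OF assms(1)]] additive.add[OF lie_autD(2)[OF assms(2)]])

lemma fixed_points_lie_algebra:
  assumes L: "lie_algebra_on s b UNIV" and A: "\<And>g. g \<in> C \<Longrightarrow> A g \<in> lie_aut s b"
  shows "lie_algebra_on s b {x. \<forall>g\<in>C. A g x = x}"
proof -
  interpret vector_space s using L by (simp add: lie_algebra_on_def)
  note lin = additive.add[OF lie_autD(2)[OF A]] additive.zero[OF lie_autD(2)[OF A]]
    lie_autD(3,4)[OF A]
  have "subspace {x. \<forall>g\<in>C. A g x = x}" by (rule subspaceI) (simp_all add: lin)
  then show ?thesis using L unfolding lie_algebra_on_def by (simp add: lin)
qed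

text \<open>The cocycle identity says that \<open>g \<mapsto> u g \<circ> \<rho> g\<close> is again an action, the twisted one. The descended
  space consists of its fixed points, so orbit sums lie in it.\<close>

lemma twisted_action:
  assumes G: "group G"
    and \<rho>: "\<And>g h x. g \<in> carrier G \<Longrightarrow> h \<in> carrier G \<Longrightarrow> \<rho> (g \<otimes>\<^bsub>G\<^esub> h) x = \<rho> g (\<rho> h x)"
      "\<And>x. \<rho> \<one>\<^bsub>G\<^esub> x = x"
    and u: "cocycle G \<rho> H u" and inj: "\<And>f. f \<in> H \<Longrightarrow> inj f"
  shows "g \<in> carrier G \<Longrightarrow> h \<in> carrier G \<Longrightarrow> u (g \<otimes>\<^bsub>G\<^esub> h) (\<rho> (g \<otimes>\<^bsub>G\<^esub> h) x) = u g (\<rho> g (u h (\<rho> h x)))"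
    and "u \<one>\<^bsub>G\<^esub> (\<rho> \<one>\<^bsub>G\<^esub> x) = x"
proof -
  interpret group G by (rule G)
  have coc: "u (g \<otimes>\<^bsub>G\<^esub> h) x = u g (\<rho> g (u h (\<rho> (inv\<^bsub>G\<^esub> g) x)))"
    if "g \<in> carrier G" "h \<in> carrier G" for g h x
    using u that by (simp add: cocycle_def)
  show mult: "u (g \<otimes>\<^bsub>G\<^esub> h) (\<rho> (g \<otimes>\<^bsub>G\<^esub> h) x) = u g (\<rho> g (u h (\<rho> h x)))"
    if gh: "g \<in> carrier G" "h \<in> carrier G" for g h x
  proof -
    have "\<rho> (inv\<^bsub>G\<^esub> g) (\<rho> (g \<otimes>\<^bsub>G\<^esub> h) x) = \<rho> (inv\<^bsub>G\<^esub> g \<otimes>\<^bsub>G\<^esub> (g \<otimes>\<^bsub>G\<^esub> h)) x"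
      using gh by (simp add: \<rho>(1))
    also have "\<dots> = \<rho> h x" using gh by (simp add: m_assoc[symmetric])
    finally show ?thesis by (simp add: coc gh)
  qed
  have "inj (u \<one>\<^bsub>G\<^esub>)" using u inj by (auto simp: cocycle_def)
  moreover have "u \<one>\<^bsub>G\<^esub> (u \<one>\<^bsub>G\<^esub> x) = u \<one>\<^bsub>G\<^esub> x"
    using mult[of "\<one>\<^bsub>G\<^esub>" "\<one>\<^bsub>G\<^esub>" x] by (simp add: \<rho>(2))
  ultimately show "u \<one>\<^bsub>G\<^esub> (\<rho> \<one>\<^bsub>G\<^esub> x) = x" by (simp add: \<rho>(2) inj_eq)
qed

locale twisted_current_algebra =
  kassel_extension scale Basis br "\<lambda>c. \<iota> (\<eta> c)" sT ten omS dS sQS clS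
    + galois_differentials \<iota> G act \<eta> omR dR sQR clR omS dS sQS clS
  for scale :: "'k::field_char_0 \<Rightarrow> 'g::ab_group_add \<Rightarrow> 'g" (infixr \<open>*s\<close> 75) and Basis br
    and \<iota> :: "'r::{comm_ring,comm_monoid_mult} \<Rightarrow> 's::{comm_ring,comm_monoid_mult}" and \<eta>
    and sT :: "'k \<Rightarrow> 't::ab_group_add \<Rightarrow> 't" and ten :: "'g \<Rightarrow> 's \<Rightarrow> 't"
    and omS :: "'s \<Rightarrow> 'oms::ab_group_add \<Rightarrow> 'oms" and dS :: "'s \<Rightarrow> 'oms"
    and sQS :: "'k \<Rightarrow> 'qs::ab_group_add \<Rightarrow> 'qs" and clS :: "'oms \<Rightarrow> 'qs"
    and G :: "('p, 'e) monoid_scheme" and act :: "'p \<Rightarrow> 's \<Rightarrow> 's"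
    and omR :: "'r \<Rightarrow> 'omr::ab_group_add \<Rightarrow> 'omr" and dR :: "'r \<Rightarrow> 'omr"
    and sQR :: "'k \<Rightarrow> 'qr::ab_group_add \<Rightarrow> 'qr" and clR :: "'omr \<Rightarrow> 'qr" +
  fixes u :: "'p \<Rightarrow> 't \<Rightarrow> 't"
  assumes u: "cocycle G (\<lambda>g. tensor_map ten (act g)) (lie_aut sc lbr) u"
begin

abbreviation \<rho>T :: "'p \<Rightarrow> 't \<Rightarrow> 't" where "\<rho>T g \<equiv> tensor_map ten (act g)"
abbreviation \<rho>E :: "'p \<Rightarrow> 't \<times> 'qs \<Rightarrow> 't \<times> 'qs" where "\<rho>E g \<equiv> map_prod (\<rho>T g) (\<rho>Q g)"
abbreviation uhat :: "'p \<Rightarrow> 't \<times> 'qs \<Rightarrow> 't \<times> 'qs" where "uhat g \<equiv> lie_lift sE brE (u g)"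

lemma \<rho>T_props:
  assumes "g \<in> C"
  shows "additive (\<rho>T g)" "\<rho>T g (ten x a) = ten x (act g a)"
  using assms unital_ring_homD(4)[OF act] by (auto intro!: tensor_map_props simp: act_simps act_\<iota>)

lemma \<rho>T_sc: assumes "g \<in> C" shows "\<rho>T g (sc a X) = sc (act g a) (\<rho>T g X)"
  by (induction X rule: tensor_induct)
    (simp_all add: \<rho>T_props[OF assms] sc_ten sc_lin act_simps[OF assms] additive.add[OF \<rho>T_props(1)[OF assms]])

lemma \<rho>T_lbr: assumes "g \<in> C" shows "\<rho>T g (lbr X Y) = lbr (\<rho>T g X) (\<rho>T g Y)"
  by (induction X Y rule: tensor_induct2)
    (simp_all add: \<rho>T_props[OF assms] lbr_ten lbr_lin act_simps[OF assms] additive.add[OF \<rho>T_props(1)[OF assms]])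

lemma \<rho>T_mult: assumes "g \<in> C" "h \<in> C" shows "\<rho>T (g \<otimes>\<^bsub>G\<^esub> h) X = \<rho>T g (\<rho>T h X)"
  by (rule tensor_eqI[OF \<rho>T_props(1) additive_compose[OF \<rho>T_props(1) \<rho>T_props(1)]])
    (simp_all add: assms \<rho>T_props act_mult)

lemma \<rho>T_one: "\<rho>T \<one>\<^bsub>G\<^esub> X = X"
  by (rule tensor_eqI[OF \<rho>T_props(1), of _ "\<lambda>X. X"]) (auto intro: additiveI simp: \<rho>T_props act_one)

lemma \<rho>Q_mult: assumes g: "g \<in> C" and h: "h \<in> C" shows "\<rho>Q (g \<otimes>\<^bsub>G\<^esub> h) z = \<rho>Q g (\<rho>Q h z)"
proof (rule quotient_eqI[where h' = "\<lambda>z. \<rho>Q g (\<rho>Q h z)"])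
  have gh: "g \<otimes>\<^bsub>G\<^esub> h \<in> C" using g h by simp
  show "additive (\<rho>Q (g \<otimes>\<^bsub>G\<^esub> h))" by (rule \<rho>Q_props(1)[OF gh gh])
  show "additive (\<lambda>z. \<rho>Q g (\<rho>Q h z))"
    by (rule additive_compose[OF \<rho>Q_props(1)[OF g g] \<rho>Q_props(1)[OF h h]])
  show "\<rho>Q (g \<otimes>\<^bsub>G\<^esub> h) (w a b) = \<rho>Q g (\<rho>Q h (w a b))" for a b
    by (simp only: \<rho>Q_props(2)[OF gh gh] \<rho>Q_props(2)[OF g g] \<rho>Q_props(2)[OF h h] act_mult[OF g h])
qed

lemma \<rho>Q_one: "\<rho>Q \<one>\<^bsub>G\<^esub> z = z"
proof (rule quotient_eqI[where h' = "\<lambda>z. z"])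
  show "additive (\<rho>Q \<one>\<^bsub>G\<^esub>)" by (rule \<rho>Q_props(1)[OF one_closed one_closed])
  show "\<rho>Q \<one>\<^bsub>G\<^esub> (w a b) = w a b" for a b
    by (simp only: \<rho>Q_props(2)[OF one_closed one_closed] act_one)
qed (simp add: additiveI)

lemma cl_W_\<rho>T: assumes g: "g \<in> C" shows "clS (W (\<rho>T g X) (\<rho>T g Y)) = \<rho>Q g (clS (W X Y))"
proof (induction X Y rule: tensor_induct2)
  case (pure x a y b)
  have "clS (omS (\<iota> (\<eta> (\<kappa> x y)) * a) (dS b)) = sQS (\<kappa> x y) (w a b)" for a b
    by (simp add: om_om[symmetric] cl_scale w_def)
  then show ?case by (simp add: \<rho>T_props[OF g] W_ten \<rho>Q_scale[OF g g] \<rho>Q_props(2)[OF g g])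
qed (simp_all add: W_lin cl_lin additive.add[OF \<rho>T_props(1)[OF g]] additive.add[OF \<rho>Q_props(1)[OF g g]])

lemma \<rho>T_aut: assumes g: "g \<in> C" shows "\<rho>T g \<in> lie_aut sT lbr"
proof (rule lie_autI)
  show "bij (\<rho>T g)"
    by (rule o_bij[of "\<rho>T (inv\<^bsub>G\<^esub> g)"])
      (simp_all add: fun_eq_iff g \<rho>T_one flip: \<rho>T_mult)
qed (simp_all add: additive.add[OF \<rho>T_props(1)[OF g]] sT_eq_sc \<rho>T_sc[OF g] act_\<iota>[OF g] \<rho>T_lbr[OF g])

lemma \<rho>E_mult: "g \<in> C \<Longrightarrow> h \<in> C \<Longrightarrow> \<rho>E (g \<otimes>\<^bsub>G\<^esub> h) U = \<rho>E g (\<rho>E h U)"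
  and \<rho>E_one: "\<rho>E \<one>\<^bsub>G\<^esub> U = U"
  by (simp_all add: prod_eq_iff \<rho>T_mult \<rho>Q_mult \<rho>T_one \<rho>Q_one)

lemma \<rho>E_aut: assumes g: "g \<in> C" shows "\<rho>E g \<in> lie_aut sE brE"
proof (rule lie_autI)
  show "bij (\<rho>E g)"
    by (rule o_bij[of "\<rho>E (inv\<^bsub>G\<^esub> g)"])
      (simp_all add: fun_eq_iff g \<rho>T_one \<rho>Q_one flip: \<rho>T_mult \<rho>Q_mult)
qed (simp_all add: prod_eq_iff additive.add[OF lie_autD(2)[OF \<rho>T_aut[OF g]]]
    additive.add[OF \<rho>Q_props(1)[OF g g]] lie_autD(3)[OF \<rho>T_aut[OF g]] \<rho>Q_scale[OF g g]
    brE_eq \<rho>T_lbr[OF g] cl_W_\<rho>T[OF g])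

lemma u_aut: assumes "g \<in> C" shows "u g \<in> lie_aut sc lbr"
  using u assms by (auto simp: cocycle_def)

lemma u_aut_k: assumes g: "g \<in> C" shows "u g \<in> lie_aut sT lbr"
  using u_aut[OF g] by (simp add: lie_aut_def sT_eq_sc)

lemmas uhat_props = lie_lift_props[OF u_aut]

text \<open>Both sides of the cocycle identity lift the same automorphism.\<close>

lemma uhat_cocycle: "cocycle G \<rho>E (lie_aut sE brE) uhat"
  unfolding cocycle_def
proof (intro conjI ballI)
  fix g h assume g: "g \<in> C" and h: "h \<in> C"
  show "uhat (g \<otimes>\<^bsub>G\<^esub> h) = uhat g \<circ> (\<rho>E g \<circ> uhat h \<circ> \<rho>E (inv\<^bsub>G\<^esub> g))"
  proof (rule automorphism_determined_by_projection)
    have "u (g \<otimes>\<^bsub>G\<^esub> h) = u g \<circ> (\<rho>T g \<circ> u h \<circ> \<rho>T (inv\<^bsub>G\<^esub> g))"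
      using u g h by (auto simp: cocycle_def)
    then show "fst \<circ> uhat (g \<otimes>\<^bsub>G\<^esub> h) = fst \<circ> (uhat g \<circ> (\<rho>E g \<circ> uhat h \<circ> \<rho>E (inv\<^bsub>G\<^esub> g)))"
      by (simp add: fun_eq_iff uhat_props g h)
  qed (intro lie_aut_compose uhat_props \<rho>E_aut g h m_closed inv_closed)+
qed (rule uhat_props)

definition twT :: "'p \<Rightarrow> 't \<Rightarrow> 't" where "twT g X = u g (\<rho>T g X)"
definition twE :: "'p \<Rightarrow> 't \<times> 'qs \<Rightarrow> 't \<times> 'qs" where "twE g U = uhat g (\<rho>E g U)"

lemma twT_mult: "g \<in> C \<Longrightarrow> h \<in> C \<Longrightarrow> twT (g \<otimes>\<^bsub>G\<^esub> h) X = twT g (twT h X)"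
  and twT_one: "twT \<one>\<^bsub>G\<^esub> X = X"
  unfolding twT_def
  by (rule twisted_action[OF group \<rho>T_mult \<rho>T_one u bij_is_inj[OF lie_autD(1)]]; assumption)+

lemma twE_mult: "g \<in> C \<Longrightarrow> h \<in> C \<Longrightarrow> twE (g \<otimes>\<^bsub>G\<^esub> h) U = twE g (twE h U)"
  unfolding twE_def
  by (rule twisted_action(1)[OF group \<rho>E_mult \<rho>E_one uhat_cocycle bij_is_inj[OF lie_autD(1)]])

lemma twT_aut: "g \<in> C \<Longrightarrow> twT g \<in> lie_aut sT lbr"
  using lie_aut_compose[OF u_aut_k \<rho>T_aut] by (simp add: twT_def[abs_def] o_def)

lemma twE_aut: "g \<in> C \<Longrightarrow> twE g \<in> lie_aut sE brE"
  using lie_aut_compose[OF uhat_props(1) \<rho>E_aut] by (simp add: twE_def[abs_def] o_def)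

lemma twE_fst: "g \<in> C \<Longrightarrow> fst (twE g U) = twT g (fst U)"
  by (simp add: twE_def twT_def uhat_props)

lemma twE_centre: "g \<in> C \<Longrightarrow> twE g (0, z) = (0, \<rho>Q g z)"
  by (simp add: twE_def uhat_props additive.zero[OF \<rho>T_props(1)])

lemma twT_sc: "g \<in> C \<Longrightarrow> twT g (sc a X) = sc (act g a) (twT g X)"
  by (simp add: twT_def \<rho>T_sc lie_autD(3)[OF u_aut])

abbreviation Lu where "Lu \<equiv> descended G \<rho>T u"
abbreviation Luhat where "Luhat \<equiv> descended G \<rho>E uhat"

lemma Lu_eq: "Lu = {X. \<forall>g\<in>C. twT g X = X}" and Luhat_eq: "Luhat = {U. \<forall>g\<in>C. twE g U = U}"
  by (simp_all add: descended_def twT_def twE_def)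

lemma orbit_sum_T: "(\<Sum>g\<in>C. twT g X) \<in> Lu"
  unfolding Lu_eq
proof (intro CollectI ballI)
  fix h assume h: "h \<in> C"
  have "twT h (\<Sum>g\<in>C. twT g X) = (\<Sum>g\<in>C. twT h (twT g X))"
    by (rule additive.sum[OF lie_autD(2)[OF twT_aut[OF h]]])
  also have "\<dots> = (\<Sum>g\<in>C. twT (h \<otimes>\<^bsub>G\<^esub> g) X)" by (intro sum.cong refl) (simp add: twT_mult h)
  finally show "twT h (\<Sum>g\<in>C. twT g X) = (\<Sum>g\<in>C. twT g X)"
    using sum_C_translate[OF h, of "\<lambda>g. twT g X"] by simp
qed

lemma orbit_sum_E: "(\<Sum>g\<in>C. twE g U) \<in> Luhat"
  unfolding Luhat_eq
proof (intro CollectI ballI)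
  fix h assume h: "h \<in> C"
  have "twE h (\<Sum>g\<in>C. twE g U) = (\<Sum>g\<in>C. twE h (twE g U))"
    by (rule additive.sum[OF lie_autD(2)[OF twE_aut[OF h]]])
  also have "\<dots> = (\<Sum>g\<in>C. twE (h \<otimes>\<^bsub>G\<^esub> g) U)" by (intro sum.cong refl) (simp add: twE_mult h)
  finally show "twE h (\<Sum>g\<in>C. twE g U) = (\<Sum>g\<in>C. twE g U)"
    using sum_C_translate[OF h, of "\<lambda>g. twE g U"] by simp
qed

lemma sc_sum_scalar: "sc (sum f I) X = (\<Sum>i\<in>I. sc (f i) X)"
  by (rule additive.sum[of "\<lambda>a. sc a X"], rule additiveI) (rule sc_add_scalar)

text \<open>Galois descent: with the coordinates \<open>a i\<close>, \<open>b i\<close> every \<open>Y\<close> is the combination with coefficients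
  \<open>a i\<close> of the orbit sums of \<open>b i Y\<close>, because the twisted action is semilinear.\<close>

lemma centralizer_Lu_zero:
  assumes X: "\<And>Y. Y \<in> Lu \<Longrightarrow> lbr X Y = 0" shows "X = 0"
proof (rule centre_zero)
  fix Y
  obtain I a b where I: "galois_coordinates I a b" using galois_coordinates_exist by blast
  have "(\<Sum>i\<in>I. sc (a i) (\<Sum>g\<in>C. twT g (sc (b i) Y))) = (\<Sum>i\<in>I. \<Sum>g\<in>C. sc (a i * act g (b i)) (twT g Y))"
    by (simp add: sc_lin twT_sc sc_sc cong: sum.cong)
  also have "\<dots> = (\<Sum>g\<in>C. sc (\<Sum>i\<in>I. a i * act g (b i)) (twT g Y))"
    by (subst sum.swap) (simp only: sc_sum_scalar)
  also have "\<dots> = (\<Sum>g\<in>C. if g = \<one>\<^bsub>G\<^esub> then Y else 0)"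
    using I by (intro sum.cong refl) (simp add: galois_coordinates_def twT_one sc_one sc_zero_scalar)
  also have "\<dots> = Y" using fin by simp
  finally have Y: "(\<Sum>i\<in>I. sc (a i) (\<Sum>g\<in>C. twT g (sc (b i) Y))) = Y" .
  have "lbr X (\<Sum>i\<in>I. sc (a i) (f i)) = (\<Sum>i\<in>I. sc (a i) (lbr X (f i)))" for f
    by (simp only: lbr_lin(4) lbr_sc(2))
  from this[of "\<lambda>i. \<Sum>g\<in>C. twT g (sc (b i) Y)"] show "lbr X Y = 0"
    unfolding Y by (simp only: X[OF orbit_sum_T] sc_lin(2) sum.neutral_const)
qed

text \<open>A central element commutes with lifts of nonzero multiples of all elements of \<open>\<L>\<^sub>u\<close>, so its
  projection centralizes \<open>\<L>\<^sub>u\<close> and vanishes.\<close>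

lemma centre_Luhat: "lie_center brE Luhat = Pair 0 ` {z. \<forall>g\<in>C. \<rho>Q g z = z}"
proof
  show "Pair 0 ` {z. \<forall>g\<in>C. \<rho>Q g z = z} \<subseteq> lie_center brE Luhat"
  proof
    fix U :: "'t \<times> 'qs" assume "U \<in> Pair 0 ` {z. \<forall>g\<in>C. \<rho>Q g z = z}"
    then obtain z where z: "U = (0, z)" "\<And>g. g \<in> C \<Longrightarrow> \<rho>Q g z = z" by blast
    have "brE U V = 0" for V by (simp add: z(1) brE_eq lbr_lin W_lin cl_lin zero_prod_def)
    moreover have "U \<in> Luhat" by (simp add: Luhat_eq z twE_centre)
    ultimately show "U \<in> lie_center brE Luhat" by (simp add: lie_center_def)
  qed
  show "lie_center brE Luhat \<subseteq> Pair 0 ` {z. \<forall>g\<in>C. \<rho>Q g z = z}"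
  proof
    fix U assume U: "U \<in> lie_center brE Luhat"
    have "fst U = 0"
    proof (rule centralizer_Lu_zero)
      fix Y assume Y: "Y \<in> Lu"
      \<comment> \<open>a multiple of \<open>Y\<close> lifts to the orbit sum of \<open>(Y, 0)\<close>\<close>
      let ?V = "\<Sum>g\<in>C. twE g (Y, 0)"
      interpret T: vector_space sT by (rule sT_vector_space)
      have "fst ?V = (\<Sum>g\<in>C. Y)" using Y by (simp add: fst_sum twE_fst Lu_eq del: sum_constant cong: sum.cong)
      then have V: "fst ?V = sT (of_nat (card C)) Y" by (simp only: T.sum_constant_scale)
      have "brE U ?V = 0" using U orbit_sum_E by (auto simp: lie_center_def)
      then have "lbr (fst U) (fst ?V) = 0" by (simp add: brE_eq zero_prod_def)
      then have "sT (of_nat (card C)) (lbr (fst U) Y) = 0" unfolding V by (simp add: sT_eq_sc lbr_sc)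
      then show "lbr (fst U) Y = 0" using fin one_closed unfolding T.scale_eq_0_iff of_nat_eq_0_iff by auto
    qed
    then obtain z where z: "U = (0, z)" by (cases U) simp
    have "twE g U = U" if "g \<in> C" for g using U that by (simp add: lie_center_def Luhat_eq)
    then have "\<rho>Q g z = z" if "g \<in> C" for g using twE_centre[OF that, of z] that by (simp add: z)
    then show "U \<in> Pair 0 ` {z. \<forall>g\<in>C. \<rho>Q g z = z}" unfolding z by blast
  qed
qed

lemma lie_algebra_Luhat: "lie_algebra_on sE brE Luhat"
  unfolding Luhat_eq by (rule fixed_points_lie_algebra[OF lie_algebra_E twE_aut])

lemma lie_algebra_Lu: "lie_algebra_on sT lbr Lu"
  unfolding Lu_eq by (rule fixed_points_lie_algebra[OF lie_algebra_T twT_aut])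

text \<open>A preimage of \<open>X\<close> is the average of the orbit of \<open>(X, 0)\<close>.\<close>

lemma Luhat_central_extension: "central_extension sE brE Luhat sT lbr Lu fst"
  unfolding central_extension_def
proof (intro conjI ballI allI)
  show "lie_algebra_on sE brE Luhat" "lie_algebra_on sT lbr Lu"
    by (rule lie_algebra_Luhat lie_algebra_Lu)+
  show "fst ` Luhat = Lu"
  proof
    have "twT g (fst U) = fst U" if "U \<in> Luhat" "g \<in> C" for U g
    proof -
      have "twE g U = U" using that by (simp add: Luhat_eq)
      then show ?thesis using twE_fst[OF that(2), of U] by simp
    qed
    then show "fst ` Luhat \<subseteq> Lu" unfolding Lu_eq by blast
    show "Lu \<subseteq> fst ` Luhat"
    proof
      fix X assume X: "X \<in> Lu"
      interpret T: vector_space sT by (rule sT_vector_space)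
      interpret E: vector_space sE by (rule sE_vector_space)
      let ?n = "of_nat (card C) :: 'k"
      let ?U = "\<Sum>g\<in>C. twE g (X, 0)"
      have "E.subspace Luhat" using lie_algebra_Luhat by (simp add: lie_algebra_on_def)
      then have "sE (inverse ?n) ?U \<in> Luhat" using orbit_sum_E by (rule E.subspace_scale)
      moreover have "fst (sE (inverse ?n) ?U) = X"
      proof -
        have "fst ?U = (\<Sum>g\<in>C. X)" using X by (simp add: fst_sum twE_fst Lu_eq del: sum_constant cong: sum.cong)
        then have "fst ?U = sT ?n X" by (simp only: T.sum_constant_scale)
        moreover have "?n \<noteq> 0" using fin one_closed by auto
        then have "inverse ?n * ?n = 1" by simp
        ultimately show ?thesis by (simp only: fst_map_prod T.scale_scale T.scale_one)
      qed
      ultimately show "X \<in> fst ` Luhat" by (intro image_eqI[where x = "sE (inverse ?n) ?U"]) (rule sym, assumption+)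
    qed
  qed
  show "{U \<in> Luhat. fst U = 0} \<subseteq> lie_center brE Luhat"
  proof
    fix U assume "U \<in> {U \<in> Luhat. fst U = 0}"
    then have "U \<in> Luhat" "fst U = 0" by simp_all
    then show "U \<in> lie_center brE Luhat"
      by (simp add: lie_center_def brE_eq lbr_lin W_lin cl_lin zero_prod_def)
  qed
qed (simp_all add: brE_eq)

lemma centre_iso: "linear_iso_on sQS {z. \<forall>g\<in>C. \<rho>Q g z = z} sE (lie_center brE Luhat) (Pair 0)"
proof -
  interpret Q: vector_space sQS by (rule vector_space_sQ)
  interpret T: vector_space sT by (rule sT_vector_space)
  interpret E: vector_space sE by (rule sE_vector_space)
  have "Q.subspace {z. \<forall>g\<in>C. \<rho>Q g z = z}"
    using invariant_classes_iso by (simp add: linear_iso_on_def)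
  moreover have "E.subspace (Pair 0 ` {z. \<forall>g\<in>C. \<rho>Q g z = z})"
    using calculation
    by (intro E.subspaceI) (auto simp: zero_prod_def Q.subspace_def)
  moreover have "inj_on (Pair 0) {z. \<forall>g\<in>C. \<rho>Q g z = z}" by (simp add: inj_on_def)
  ultimately show ?thesis
    unfolding linear_iso_on_def centre_Luhat bij_betw_def
    by (simp add: Q.vector_space_axioms E.vector_space_axioms)
qed

end

theorem proposition22:
  fixes sg :: "'k::field_char_0 \<Rightarrow> 'g::ab_group_add \<Rightarrow> 'g"
    and br :: "'g \<Rightarrow> 'g \<Rightarrow> 'g"
    and \<eta> :: "'k \<Rightarrow> 'r::{comm_ring,comm_monoid_mult}"
    and \<iota> :: "'r \<Rightarrow> 's::{comm_ring,comm_monoid_mult}"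
    and G :: "('p, 'e) monoid_scheme"
    and act :: "'p \<Rightarrow> 's \<Rightarrow> 's"
    and sT :: "'k \<Rightarrow> 't::ab_group_add \<Rightarrow> 't"
    and ten :: "'g \<Rightarrow> 's \<Rightarrow> 't"
    and omR :: "'r \<Rightarrow> 'omr::ab_group_add \<Rightarrow> 'omr" and dR :: "'r \<Rightarrow> 'omr"
    and omS :: "'s \<Rightarrow> 'oms::ab_group_add \<Rightarrow> 'oms" and dS :: "'s \<Rightarrow> 'oms"
    and sQR :: "'k \<Rightarrow> 'qr::ab_group_add \<Rightarrow> 'qr" and clR :: "'omr \<Rightarrow> 'qr"
    and sQS :: "'k \<Rightarrow> 'qs::ab_group_add \<Rightarrow> 'qs" and clS :: "'oms \<Rightarrow> 'qs"
    and wR :: "'r \<Rightarrow> 'r \<Rightarrow> 'qr" and wS :: "'s \<Rightarrow> 's \<Rightarrow> 'qs"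
    and brT :: "'t \<Rightarrow> 't \<Rightarrow> 't"
    and sE :: "'k \<Rightarrow> 't \<times> 'qs \<Rightarrow> 't \<times> 'qs"
    and brE :: "'t \<times> 'qs \<Rightarrow> 't \<times> 'qs \<Rightarrow> 't \<times> 'qs"
    and \<rho>T :: "'p \<Rightarrow> 't \<Rightarrow> 't" and \<rho>Q :: "'p \<Rightarrow> 'qs \<Rightarrow> 'qs" and \<rho>E :: "'p \<Rightarrow> 't \<times> 'qs \<Rightarrow> 't \<times> 'qs"
    and u :: "'p \<Rightarrow> 't \<Rightarrow> 't"
    and uhat :: "'p \<Rightarrow> 't \<times> 'qs \<Rightarrow> 't \<times> 'qs"
  assumes "split_simple_lie_algebra sg br"
    and "unital_ring_hom \<eta>"
    and "galois_extension \<iota> G act"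
    and "is_tensor_product sg (\<lambda>c s. \<iota> (\<eta> c) * s) sT ten"
    and "is_kaehler \<eta> omR dR"
    and "is_quotient_space (\<lambda>c. omR (\<eta> c)) (range dR) sQR clR"
    and "is_kaehler (\<iota> \<circ> \<eta>) omS dS"
    and "is_quotient_space (\<lambda>c. omS (\<iota> (\<eta> c))) (range dS) sQS clS"
    and wR_def: "wR = (\<lambda>a b. clR (omR a (dR b)))"
    and wS_def: "wS = (\<lambda>a b. clS (omS a (dS b)))"
    and brT_def: "brT = current_bracket br ten"
    and sE_def: "sE = (\<lambda>c. map_prod (sT c) (sQS c))"
    and brE_def: "brE = uce_bracket sg br ten sQS wS"
    and \<rho>T_def: "\<rho>T = (\<lambda>g. tensor_map ten (act g))"
    and \<rho>Q_def: "\<rho>Q = (\<lambda>g. diff_class_map wS wS (act g))"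
    and \<rho>E_def: "\<rho>E = (\<lambda>g. map_prod (\<rho>T g) (\<rho>Q g))"
    and "cocycle G \<rho>T (lie_aut (current_scale ten) brT) u"
    and uhat_def: "uhat = (\<lambda>g. lie_lift sE brE (u g))"
  shows "cocycle G \<rho>E (lie_aut sE brE) uhat
    \<and> central_extension sE brE (descended G \<rho>E uhat) sT brT (descended G \<rho>T u) fst
    \<and> linear_iso_on sQS {z. \<forall>g\<in>carrier G. \<rho>Q g z = z}
          sE (lie_center brE (descended G \<rho>E uhat)) (Pair 0)
    \<and> linear_iso_on sQR UNIV sQS {z. \<forall>g\<in>carrier G. \<rho>Q g z = z} (diff_class_map wR wS \<iota>)"
proof -
  obtain B where B: "nondegenerate_killing sg B br"
    by (rule split_simple_imp_nondegenerate_killing[OF assms(1)])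
  interpret nondegenerate_killing sg B br by (rule B)
  have \<sigma>: "unital_ring_hom (\<lambda>c. \<iota> (\<eta> c))"
    using assms(2,3) by (auto simp: unital_ring_hom_def galois_extension_def)
  interpret twisted_current_algebra sg B br \<iota> \<eta> sT ten omS dS sQS clS G act omR dR sQR clR u
    by unfold_locales
      (use assms \<sigma> in \<open>simp_all add: comp_def\<close>)
  have wR: "wR = R.w" and wS: "wS = w" by (simp_all add: fun_eq_iff wR_def wS_def R.w_def w_def)
  show ?thesis
    unfolding uhat_def \<rho>E_def \<rho>Q_def \<rho>T_def brE_def sE_def brT_def wR wS
    by (intro conjI uhat_cocycle Luhat_central_extension centre_iso invariant_classes_iso)
qed

end
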